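(* Let $(\mathfrak{E},h)=(E,\Phi,h)$ be a hermitian Higgs bundle over a compact Kähler manifold $M$, with Hitchin-Simpson connection $\mathcal{D}_h = D_h+\Phi+\bar\Phi_h$. Let $\mathfrak{S}=(S,\Phi|_S)\subset\mathfrak{E}$ be a Higgs subbundle, let $S^{\perp}$ be the orthogonal complement of $S$ with respect to $h$, and let $\mathfrak{Q}=(Q,\Phi_Q)$ be the quotient Higgs bundle, $Q=E/S$, with the hermitian metric $h_Q$ induced by $h|_{S^{\perp}}$ via the $C^\infty$ isomorphism $Q\cong S^{\perp}$. For $\eta\in A^0(S^{\perp})$ write $D_h\eta = B_h\eta + D_{h,S^{\perp}}\eta$ with $B_h\eta\in A^1(S)$ and $D_{h,S^{\perp}}\eta\in A^1(S^{\perp})$, and define $$\mathcal{D}_{h,S^{\perp}} = D_{h,S^{\perp}}+P_{S^{\perp}}\Phi|_{S^{\perp}}+\bar\Phi_h|_{S^{\perp}},\qquad \mathcal{B}_h = B_h+P_S\Phi|_{S^{\perp}},$$ so that $\mathcal{D}_h\eta=\mathcal{B}_h\eta+\mathcal{D}_{h,S^{\perp}}\eta$ for all $\eta\in A^0(S^{\perp})$. Let $\mathcal{D}_{h,Q}:A^0(Q)\to A^1(Q)$ be the operator corresponding to $\mathcal{D}_{h,S^{\perp}}$ under the isomorphism $Q\cong S^{\perp}$. Then $\mathcal{D}_{h,Q}$ is the Hitchin-Simpson connection of $(\mathfrak{Q},h_Q)$, i.e. $\mathcal{D}_{h,Q}=\mathcal{D}_{h_Q}$, and $\mathcal{B}_h$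 is a $1$-form with values in $\mathrm{Hom}(S^{\perp},S)$, i.e. $\mathcal{B}_h\in A^1(\mathrm{Hom}(S^{\perp},S))$.
   Context: $M$ is a compact Kähler manifold. $\Omega^{1,0}$ is its holomorphic cotangent bundle. For a $C^\infty$ complex vector bundle $V$ over $M$, $A^s(V)$ (resp. $A^{p,q}(V)$) is the space of $C^\infty$ complex $s$-forms (resp. $(p,q)$-forms) on $M$ with values in $V$. A Higgs bundle $\mathfrak{E}=(E,\Phi)$ over $M$ is a holomorphic vector bundle $E$ with a holomorphic $\Phi\in A^{1,0}(\mathrm{End}\,E)$ (the Higgs field) satisfying $\Phi\wedge\Phi=0$. A hermitian Higgs bundle $(\mathfrak{E},h)=(E,\Phi,h)$ is a Higgs bundle with a hermitian metric $h$ in $E$. $D_h=D'_h+d''$ is the Chern connection of $(E,h)$, and $\bar\Phi_h\in A^{0,1}(\mathrm{End}\,E)$ is the hermitian conjugate of $\Phi$ with respect to $h$, i.e. $h(\bar\Phi_h\xi,\eta)=h(\xi,\Phi\eta)$ for all sections $\xi,\eta$ of $E$. The Hitchin-Simpson connection of $(\mathfrak{E},h)$ is $\mathcal{D}_h=D_h+\Phi+\bar\Phi_h$ (and similarly for any hermitian Higgs bundle, in particular $(\mathfrak{Q},h_Q)$). A Higgs subbundle $\mathfrak{S}\subset\mathfrak{E}$ is a holomorphic subbundle $S\subset E$ that is $\Phi$-invariant ($\Phi(S)\subset S\otimes\Omega^{1,0}$); then $\mathfrak{S}=(S,\Phi|_S)$ is itself a Higgs bundle. The quotient Higgs bundle is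 $\mathfrak{Q}=(Q,\Phi_Q)$, where $Q=E/S$ is the holomorphic quotient bundle and $\Phi_Q\in A^{1,0}(\mathrm{End}\,Q)$ is the Higgs field induced by $\Phi$ on the quotient. $S^{\perp}$ is a $C^\infty$ complex subbundle of $E$, not necessarily holomorphic; it is $\bar\Phi_h$-invariant because $S$ is $\Phi$-invariant. The isomorphism $Q\cong S^{\perp}$ of $C^\infty$ complex vector bundles is the one given by restricting the quotient map $E\to Q$ to $S^{\perp}$. $P_S$ and $P_{S^{\perp}}$ are the orthogonal projections of $E=S\oplus S^{\perp}$ onto $S$ and $S^{\perp}$; $P_S\Phi$ and $P_{S^{\perp}}\Phi$ denote their compositions with $\Phi$ (acting on the bundle factor). *)

theory Defs
  imports "HOL-Analysis.Analysis" "HOL-Algebra.Module" "HOL-Algebra.AbelCoset"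
begin

section \<open>Smooth and holomorphic functions on open subsets of \<open>\<complex>\<^sup>n\<close>\<close>

text \<open>All sets below are meant to be open; derivatives are real Frechet derivatives.\<close>

primrec Ck_on :: "nat \<Rightarrow> ('a::real_normed_vector \<Rightarrow> 'b::real_normed_vector) \<Rightarrow> 'a set \<Rightarrow> bool" where
  "Ck_on 0 f U \<longleftrightarrow> continuous_on U f"
| "Ck_on (Suc k) f U \<longleftrightarrow>
     (\<forall>x\<in>U. f differentiable (at x)) \<and> (\<forall>v. Ck_on k (\<lambda>x. frechet_derivative f (at x) v) U)"

definition smooth_on :: "('a::real_normed_vector \<Rightarrow> 'b::real_normed_vector) \<Rightarrow> 'a set \<Rightarrow> bool" where
  "smooth_on f U \<longleftrightarrow> (\<forall>k. Ck_on k f U)"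

text \<open>Holomorphic in several variables: smooth with \<open>\<partial>\<close>-bar \<open>f = 0\<close>, i.e. with
  complex linear derivative.\<close>

definition holo_on :: "(complex^'n \<Rightarrow> complex) \<Rightarrow> (complex^'n) set \<Rightarrow> bool" where
  "holo_on f U \<longleftrightarrow> smooth_on f U \<and>
     (\<forall>x\<in>U. \<forall>v. frechet_derivative f (at x) (\<i> *s v) = \<i> * frechet_derivative f (at x) v)"


section \<open>Complex manifolds\<close>

type_synonym ('m, 'n) chart = "'m set \<times> ('m \<Rightarrow> complex^'n)"

text \<open>The manifold is the whole type \<open>'m\<close>. Besides the atlas, a preferred chart is chosen around
  every point; through it the tangent space at \<open>p\<close> is identified with \<open>\<complex>\<^sup>n\<close>, where multiplication
  by \<open>\<i>\<close> is the complex structure. Hence a tangent vector at \<open>p\<close> is an element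
  of \<open>complex^'n\<close>, and a \<open>1\<close>-form is a function of \<open>p\<close> and of such a vector.\<close>

record ('m, 'n) cmanifold =
  atlas :: "('m, 'n) chart set"
  chart_at :: "'m \<Rightarrow> ('m, 'n) chart"

definition chart_inv :: "('m, 'n) chart \<Rightarrow> complex^'n \<Rightarrow> 'm" where
  "chart_inv c = inv_into (fst c) (snd c)"

definition complex_manifold :: "('m::topological_space, 'n::finite) cmanifold \<Rightarrow> bool" where
  "complex_manifold M \<longleftrightarrow>
     (\<forall>c\<in>atlas M. open (fst c) \<and> open (snd c ` fst c) \<and>
        homeomorphism (fst c) (snd c ` fst c) (snd c) (chart_inv c)) \<and>
     (\<forall>c\<in>atlas M. \<forall>c'\<in>atlas M. \<forall>k.
        holo_on (\<lambda>x. snd c' (chart_inv c x) $ k) (snd c ` (fst c \<inter> fst c'))) \<and>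
     (\<forall>p. chart_at M p \<in> atlas M \<and> p \<in> fst (chart_at M p))"

text \<open>The tangent vector at \<open>p\<close> whose coordinate vector in the chart \<open>c\<close> is \<open>v\<close>. For fixed \<open>v\<close> this
  is a coordinate vector field on the domain of \<open>c\<close>.\<close>

definition coord_vec :: "('m, 'n::finite) cmanifold \<Rightarrow> ('m, 'n) chart \<Rightarrow> 'm \<Rightarrow> complex^'n \<Rightarrow> complex^'n" where
  "coord_vec M c p v = frechet_derivative (snd (chart_at M p) \<circ> chart_inv c) (at (snd c p)) v"

definition smooth_fun_on :: "('m, 'n::finite) cmanifold \<Rightarrow> 'm set \<Rightarrow> ('m \<Rightarrow> complex) \<Rightarrow> bool" where
  "smooth_fun_on M W f \<longleftrightarrow> (\<forall>c\<in>atlas M. smooth_on (f \<circ> chart_inv c) (snd c ` (fst c \<inter> W)))"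

definition holo_fun_on :: "('m, 'n::finite) cmanifold \<Rightarrow> 'm set \<Rightarrow> ('m \<Rightarrow> complex) \<Rightarrow> bool" where
  "holo_fun_on M W f \<longleftrightarrow> (\<forall>c\<in>atlas M. holo_on (f \<circ> chart_inv c) (snd c ` (fst c \<inter> W)))"

definition dfun :: "('m, 'n::finite) cmanifold \<Rightarrow> ('m \<Rightarrow> complex) \<Rightarrow> 'm \<Rightarrow> complex^'n \<Rightarrow> complex" where
  "dfun M f p v =
     frechet_derivative (f \<circ> chart_inv (chart_at M p)) (at (snd (chart_at M p) p)) v"

definition dbar_fun :: "('m, 'n::finite) cmanifold \<Rightarrow> ('m \<Rightarrow> complex) \<Rightarrow> 'm \<Rightarrow> complex^'n \<Rightarrow> complex" where
  "dbar_fun M f p v = (dfun M f p v + \<i> * dfun M f p (\<i> *s v)) / 2"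

text \<open>For a hermitian metric \<open>g\<close> on the tangent bundle, complex linear in the first argument, the
  fundamental form is \<open>Re (g (J u) v) = - Im (g u v)\<close>.\<close>

definition fundamental_form ::
    "('m \<Rightarrow> complex^'n \<Rightarrow> complex^'n \<Rightarrow> complex) \<Rightarrow> 'm \<Rightarrow> complex^'n \<Rightarrow> complex^'n \<Rightarrow> real" where
  "fundamental_form g p u v = - Im (g p u v)"

definition closed_2form ::
    "('m, 'n::finite) cmanifold \<Rightarrow> ('m \<Rightarrow> complex^'n \<Rightarrow> complex^'n \<Rightarrow> real) \<Rightarrow> bool" where
  "closed_2form M \<omega> \<longleftrightarrow>
     (\<forall>c\<in>atlas M. \<forall>x\<in>snd c ` fst c. \<forall>u v w.
        let W = (\<lambda>u v y. \<omega> (chart_inv c y) (coord_vec M c (chart_inv c y) u)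
                                            (coord_vec M c (chart_inv c y) v))
        in frechet_derivative (W v w) (at x) u - frechet_derivative (W u w) (at x) v
             + frechet_derivative (W u v) (at x) w = 0)"

definition kaehler_metric ::
    "('m, 'n::finite) cmanifold \<Rightarrow> ('m \<Rightarrow> complex^'n \<Rightarrow> complex^'n \<Rightarrow> complex) \<Rightarrow> bool" where
  "kaehler_metric M g \<longleftrightarrow>
     (\<forall>p u v w. g p (u + v) w = g p u w + g p v w) \<and>
     (\<forall>p a u v. g p (a *s u) v = a * g p u v) \<and>
     (\<forall>p u v. g p v u = cnj (g p u v)) \<and>
     (\<forall>p u. u \<noteq> 0 \<longrightarrow> Re (g p u u) > 0) \<and>
     (\<forall>c\<in>atlas M. \<forall>u v. smooth_fun_on M (fst c) (\<lambda>p. g p (coord_vec M c p u) (coord_vec M c p v))) \<and>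
     closed_2form M (fundamental_form g)"

definition compact_kaehler_manifold :: "('m::topological_space, 'n::finite) cmanifold \<Rightarrow> bool" where
  "compact_kaehler_manifold M \<longleftrightarrow>
     compact (UNIV :: 'm set) \<and> complex_manifold M \<and> (\<exists>g. kaehler_metric M g)"


section \<open>Holomorphic vector bundles\<close>

abbreviation complex_ring :: "complex ring" where
  "complex_ring \<equiv> \<lparr>carrier = UNIV, mult = (*), one = 1, zero = 0, add = (+)\<rparr>"

text \<open>A vector bundle is given by its fibres and a set of local frames \<open>(U, n, e)\<close>, where
  \<open>e 0, \<dots>, e (n - 1)\<close> are sections over \<open>U\<close>. The fields \<open>mult\<close> and \<open>one\<close> of a fibre play no role.
  The rank is only locally constant.\<close>

record ('m, 'v) vbundle =
  fibre :: "'m \<Rightarrow> (complex, 'v) module"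
  frames :: "('m set \<times> nat \<times> (nat \<Rightarrow> 'm \<Rightarrow> 'v)) set"

abbreviation fib :: "('m, 'v) vbundle \<Rightarrow> 'm \<Rightarrow> 'v set" where
  "fib E p \<equiv> carrier (fibre E p)"

definition lincomb :: "(complex, 'v) module \<Rightarrow> nat \<Rightarrow> (nat \<Rightarrow> complex) \<Rightarrow> (nat \<Rightarrow> 'v) \<Rightarrow> 'v" where
  "lincomb V n a e = (\<Oplus>\<^bsub>V\<^esub>i\<in>{..<n}. a i \<odot>\<^bsub>V\<^esub> e i)"

definition is_basis :: "(complex, 'v) module \<Rightarrow> nat \<Rightarrow> (nat \<Rightarrow> 'v) \<Rightarrow> bool" where
  "is_basis V n e \<longleftrightarrow> (\<forall>i<n. e i \<in> carrier V) \<and>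
     (\<forall>x\<in>carrier V. \<exists>!a. a \<in> {..<n} \<rightarrow>\<^sub>E UNIV \<and> x = lincomb V n a e)"

definition smooth_section_on ::
    "('m, 'n::finite) cmanifold \<Rightarrow> ('m, 'v) vbundle \<Rightarrow> 'm set \<Rightarrow> ('m \<Rightarrow> 'v) \<Rightarrow> bool" where
  "smooth_section_on M E W \<sigma> \<longleftrightarrow>
     (\<forall>(U, n, e)\<in>frames E. \<exists>a. (\<forall>i<n. smooth_fun_on M (U \<inter> W) (a i)) \<and>
        (\<forall>p\<in>U \<inter> W. \<sigma> p = lincomb (fibre E p) n (\<lambda>i. a i p) (\<lambda>i. e i p)))"

definition holo_section_on ::
    "('m, 'n::finite) cmanifold \<Rightarrow> ('m, 'v) vbundle \<Rightarrow> 'm set \<Rightarrow> ('m \<Rightarrow> 'v) \<Rightarrow> bool" where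
  "holo_section_on M E W \<sigma> \<longleftrightarrow>
     (\<forall>(U, n, e)\<in>frames E. \<exists>a. (\<forall>i<n. holo_fun_on M (U \<inter> W) (a i)) \<and>
        (\<forall>p\<in>U \<inter> W. \<sigma> p = lincomb (fibre E p) n (\<lambda>i. a i p) (\<lambda>i. e i p)))"

definition holo_frame :: "('m::topological_space, 'n::finite) cmanifold \<Rightarrow> ('m, 'v) vbundle \<Rightarrow>
    'm set \<Rightarrow> nat \<Rightarrow> (nat \<Rightarrow> 'm \<Rightarrow> 'v) \<Rightarrow> bool" where
  "holo_frame M E U n e \<longleftrightarrow> open U \<and> (\<forall>i<n. holo_section_on M E U (e i)) \<and>
     (\<forall>p\<in>U. is_basis (fibre E p) n (\<lambda>i. e i p))"

definition holo_bundle :: "('m::topological_space, 'n::finite) cmanifold \<Rightarrow> ('m, 'v) vbundle \<Rightarrow> bool" where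
  "holo_bundle M E \<longleftrightarrow>
     (\<forall>p. Module.module complex_ring (fibre E p)) \<and>
     (\<forall>(U, n, e)\<in>frames E. holo_frame M E U n e) \<and>
     (\<forall>p. \<exists>(U, n, e)\<in>frames E. p \<in> U)"


section \<open>Sections and forms\<close>

text \<open>\<open>F\<close> (and \<open>G\<close>) denote families of fibrewise subspaces of \<open>E\<close> forming smooth subbundles; \<open>fib E\<close>
  stands for \<open>E\<close> itself. \<open>sections M E F\<close> is \<open>A\<^sup>0(F)\<close>, \<open>forms M E F\<close> is \<open>A\<^sup>1(F)\<close> and
  \<open>hom_forms M E F G\<close> is \<open>A\<^sup>1(Hom(F, G))\<close>. A complex-valued form is determined by its restriction
  to real tangent vectors, where it is real linear.\<close>

type_synonym ('m, 'n, 'v) form = "'m \<Rightarrow> complex^'n \<Rightarrow> 'v"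
type_synonym ('m, 'n, 'v) hom_form = "'m \<Rightarrow> complex^'n \<Rightarrow> 'v \<Rightarrow> 'v"
type_synonym ('m, 'n, 'v) operator = "('m \<Rightarrow> 'v) \<Rightarrow> ('m, 'n, 'v) form"

definition real_linear_into :: "(complex, 'v) module \<Rightarrow> (complex^'n \<Rightarrow> 'v) \<Rightarrow> bool" where
  "real_linear_into V f \<longleftrightarrow> (\<forall>u v. f (u + v) = f u \<oplus>\<^bsub>V\<^esub> f v) \<and>
     (\<forall>r v. f (r *\<^sub>R v) = complex_of_real r \<odot>\<^bsub>V\<^esub> f v)"

definition sections ::
    "('m, 'n::finite) cmanifold \<Rightarrow> ('m, 'v) vbundle \<Rightarrow> ('m \<Rightarrow> 'v set) \<Rightarrow> ('m \<Rightarrow> 'v) set" where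
  "sections M E F = {\<sigma>. (\<forall>p. \<sigma> p \<in> F p) \<and> smooth_section_on M E UNIV \<sigma>}"

definition forms ::
    "('m, 'n::finite) cmanifold \<Rightarrow> ('m, 'v) vbundle \<Rightarrow> ('m \<Rightarrow> 'v set) \<Rightarrow> ('m, 'n, 'v) form set" where
  "forms M E F = {\<omega>. (\<forall>p v. \<omega> p v \<in> F p) \<and> (\<forall>p. real_linear_into (fibre E p) (\<omega> p)) \<and>
     (\<forall>c\<in>atlas M. \<forall>v. smooth_section_on M E (fst c) (\<lambda>p. \<omega> p (coord_vec M c p v)))}"

definition smooth_frame :: "('m::topological_space, 'n::finite) cmanifold \<Rightarrow> ('m, 'v) vbundle \<Rightarrow>
    ('m \<Rightarrow> 'v set) \<Rightarrow> 'm set \<Rightarrow> nat \<Rightarrow> (nat \<Rightarrow> 'm \<Rightarrow> 'v) \<Rightarrow> bool" where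
  "smooth_frame M E F U n e \<longleftrightarrow> open U \<and> (\<forall>i<n. smooth_section_on M E U (e i)) \<and>
     (\<forall>p\<in>U. is_basis (fibre E p\<lparr>carrier := F p\<rparr>) n (\<lambda>i. e i p))"

definition linear_between :: "(complex, 'v) module \<Rightarrow> 'v set \<Rightarrow> 'v set \<Rightarrow> ('v \<Rightarrow> 'v) \<Rightarrow> bool" where
  "linear_between V A B f \<longleftrightarrow> (\<forall>x\<in>A. f x \<in> B) \<and>
     (\<forall>x\<in>A. \<forall>y\<in>A. f (x \<oplus>\<^bsub>V\<^esub> y) = f x \<oplus>\<^bsub>V\<^esub> f y) \<and>
     (\<forall>a. \<forall>x\<in>A. f (a \<odot>\<^bsub>V\<^esub> x) = a \<odot>\<^bsub>V\<^esub> f x)"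

text \<open>Smoothness of a \<open>Hom\<close>-valued form is smoothness of its matrix entries with respect to smooth
  local frames of \<open>F\<close>.\<close>

definition hom_forms :: "('m::topological_space, 'n::finite) cmanifold \<Rightarrow> ('m, 'v) vbundle \<Rightarrow>
    ('m \<Rightarrow> 'v set) \<Rightarrow> ('m \<Rightarrow> 'v set) \<Rightarrow> ('m, 'n, 'v) hom_form set" where
  "hom_forms M E F G = {\<beta>.
     (\<forall>p v. linear_between (fibre E p) (F p) (G p) (\<beta> p v)) \<and>
     (\<forall>p. \<forall>x\<in>F p. real_linear_into (fibre E p) (\<lambda>v. \<beta> p v x)) \<and>
     (\<forall>c\<in>atlas M. \<forall>v. \<forall>U n e. smooth_frame M E F U n e \<longrightarrow>
        (\<forall>j<n. smooth_section_on M E (fst c \<inter> U) (\<lambda>p. \<beta> p (coord_vec M c p v) (e j p))))}"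


section \<open>Hermitian Higgs bundles\<close>

text \<open>The last condition is \<open>\<Phi> \<and> \<Phi> = 0\<close>, since
  \<open>(\<Phi> \<and> \<Phi>)(u, v) = \<Phi>(u) \<circ> \<Phi>(v) - \<Phi>(v) \<circ> \<Phi>(u)\<close>.\<close>

definition higgs_field :: "('m::topological_space, 'n::finite) cmanifold \<Rightarrow> ('m, 'v) vbundle \<Rightarrow>
    ('m, 'n, 'v) hom_form \<Rightarrow> bool" where
  "higgs_field M E \<Phi> \<longleftrightarrow> \<Phi> \<in> hom_forms M E (fib E) (fib E) \<and>
     (\<forall>p v. \<forall>x\<in>fib E p. \<Phi> p (\<i> *s v) x = \<i> \<odot>\<^bsub>fibre E p\<^esub> \<Phi> p v x) \<and>
     (\<forall>c\<in>atlas M. \<forall>v. \<forall>(U, n, e)\<in>frames E. \<forall>j<n.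
        holo_section_on M E (fst c \<inter> U) (\<lambda>p. \<Phi> p (coord_vec M c p v) (e j p))) \<and>
     (\<forall>p u v. \<forall>x\<in>fib E p. \<Phi> p u (\<Phi> p v x) \<ominus>\<^bsub>fibre E p\<^esub> \<Phi> p v (\<Phi> p u x) = \<zero>\<^bsub>fibre E p\<^esub>)"

text \<open>Hermitian metrics are complex linear in the first argument.\<close>

definition hermitian_metric :: "('m, 'n::finite) cmanifold \<Rightarrow> ('m, 'v) vbundle \<Rightarrow>
    ('m \<Rightarrow> 'v \<Rightarrow> 'v \<Rightarrow> complex) \<Rightarrow> bool" where
  "hermitian_metric M E h \<longleftrightarrow>
     (\<forall>p. \<forall>x\<in>fib E p. \<forall>y\<in>fib E p. \<forall>z\<in>fib E p. h p (x \<oplus>\<^bsub>fibre E p\<^esub> y) z = h p x z + h p y z) \<and>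
     (\<forall>p a. \<forall>x\<in>fib E p. \<forall>y\<in>fib E p. h p (a \<odot>\<^bsub>fibre E p\<^esub> x) y = a * h p x y) \<and>
     (\<forall>p. \<forall>x\<in>fib E p. \<forall>y\<in>fib E p. h p y x = cnj (h p x y)) \<and>
     (\<forall>p. \<forall>x\<in>fib E p. x \<noteq> \<zero>\<^bsub>fibre E p\<^esub> \<longrightarrow> Re (h p x x) > 0) \<and>
     (\<forall>(U, n, e)\<in>frames E. \<forall>i<n. \<forall>j<n. smooth_fun_on M U (\<lambda>p. h p (e i p) (e j p)))"

definition hermitian_higgs_bundle :: "('m::topological_space, 'n::finite) cmanifold \<Rightarrow>
    ('m, 'v) vbundle \<Rightarrow> ('m, 'n, 'v) hom_form \<Rightarrow> ('m \<Rightarrow> 'v \<Rightarrow> 'v \<Rightarrow> complex) \<Rightarrow> bool" where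
  "hermitian_higgs_bundle M E \<Phi> h \<longleftrightarrow>
     holo_bundle M E \<and> higgs_field M E \<Phi> \<and> hermitian_metric M E h"

definition connection :: "('m, 'n::finite) cmanifold \<Rightarrow> ('m, 'v) vbundle \<Rightarrow>
    ('m, 'n, 'v) operator \<Rightarrow> bool" where
  "connection M E D \<longleftrightarrow>
     (\<forall>\<xi>\<in>sections M E (fib E). D \<xi> \<in> forms M E (fib E)) \<and>
     (\<forall>\<xi>\<in>sections M E (fib E). \<forall>\<eta>\<in>sections M E (fib E).
        D (\<lambda>p. \<xi> p \<oplus>\<^bsub>fibre E p\<^esub> \<eta> p) = (\<lambda>p v. D \<xi> p v \<oplus>\<^bsub>fibre E p\<^esub> D \<eta> p v)) \<and>
     (\<forall>f. smooth_fun_on M UNIV f \<longrightarrow> (\<forall>\<xi>\<in>sections M E (fib E).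
        D (\<lambda>p. f p \<odot>\<^bsub>fibre E p\<^esub> \<xi> p) =
          (\<lambda>p v. dfun M f p v \<odot>\<^bsub>fibre E p\<^esub> \<xi> p \<oplus>\<^bsub>fibre E p\<^esub> f p \<odot>\<^bsub>fibre E p\<^esub> D \<xi> p v)))"

definition part01 :: "('m, 'v) vbundle \<Rightarrow> ('m, 'n::finite, 'v) form \<Rightarrow> ('m, 'n, 'v) form" where
  "part01 E \<omega> p v = (1 / 2) \<odot>\<^bsub>fibre E p\<^esub>
     (\<omega> p v \<oplus>\<^bsub>fibre E p\<^esub> \<i> \<odot>\<^bsub>fibre E p\<^esub> \<omega> p (\<i> *s v))"

text \<open>\<open>\<omega>\<close> is \<open>d'' \<xi>\<close>: if \<open>\<xi> = \<Sum>\<^sub>i a\<^sub>i e\<^sub>i\<close> in a local holomorphic frame, then \<open>\<omega> = \<Sum>\<^sub>i (dbar a\<^sub>i) e\<^sub>i\<close>.\<close>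

definition is_dbar_of :: "('m, 'n::finite) cmanifold \<Rightarrow> ('m, 'v) vbundle \<Rightarrow> ('m \<Rightarrow> 'v) \<Rightarrow>
    ('m, 'n, 'v) form \<Rightarrow> bool" where
  "is_dbar_of M E \<xi> \<omega> \<longleftrightarrow>
     (\<forall>(U, n, e)\<in>frames E. \<forall>a. (\<forall>i<n. smooth_fun_on M U (a i)) \<longrightarrow>
        (\<forall>p\<in>U. \<xi> p = lincomb (fibre E p) n (\<lambda>i. a i p) (\<lambda>i. e i p)) \<longrightarrow>
        (\<forall>p\<in>U. \<forall>v. \<omega> p v = lincomb (fibre E p) n (\<lambda>i. dbar_fun M (a i) p v) (\<lambda>i. e i p)))"

definition chern_connection :: "('m, 'n::finite) cmanifold \<Rightarrow> ('m, 'v) vbundle \<Rightarrow>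
    ('m \<Rightarrow> 'v \<Rightarrow> 'v \<Rightarrow> complex) \<Rightarrow> ('m, 'n, 'v) operator \<Rightarrow> bool" where
  "chern_connection M E h D \<longleftrightarrow> connection M E D \<and>
     (\<forall>\<xi>\<in>sections M E (fib E). \<forall>\<eta>\<in>sections M E (fib E). \<forall>p v.
        dfun M (\<lambda>q. h q (\<xi> q) (\<eta> q)) p v = h p (D \<xi> p v) (\<eta> p) + h p (\<xi> p) (D \<eta> p v)) \<and>
     (\<forall>\<xi>\<in>sections M E (fib E). is_dbar_of M E \<xi> (part01 E (D \<xi>)))"

definition higgs_adj :: "('m, 'v) vbundle \<Rightarrow> ('m \<Rightarrow> 'v \<Rightarrow> 'v \<Rightarrow> complex) \<Rightarrow>
    ('m, 'n, 'v) hom_form \<Rightarrow> ('m, 'n, 'v) hom_form" where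
  "higgs_adj E h \<Phi> p v x = (THE y. y \<in> fib E p \<and> (\<forall>z\<in>fib E p. h p y z = h p x (\<Phi> p v z)))"

text \<open>\<open>\<D>\<^sub>h = D + \<Phi> + \<Phi>bar\<^sub>h\<close>, where \<open>D\<close> is the Chern connection.\<close>

definition hs_operator :: "('m, 'v) vbundle \<Rightarrow> ('m, 'n, 'v) hom_form \<Rightarrow>
    ('m \<Rightarrow> 'v \<Rightarrow> 'v \<Rightarrow> complex) \<Rightarrow> ('m, 'n, 'v) operator \<Rightarrow> ('m, 'n, 'v) operator" where
  "hs_operator E \<Phi> h D \<xi> p v =
     D \<xi> p v \<oplus>\<^bsub>fibre E p\<^esub> \<Phi> p v (\<xi> p) \<oplus>\<^bsub>fibre E p\<^esub> higgs_adj E h \<Phi> p v (\<xi> p)"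

definition hitchin_simpson_connection :: "('m, 'n::finite) cmanifold \<Rightarrow> ('m, 'v) vbundle \<Rightarrow>
    ('m, 'n, 'v) hom_form \<Rightarrow> ('m \<Rightarrow> 'v \<Rightarrow> 'v \<Rightarrow> complex) \<Rightarrow> ('m, 'n, 'v) operator \<Rightarrow> bool" where
  "hitchin_simpson_connection M E \<Phi> h \<D> \<longleftrightarrow>
     (\<exists>D. chern_connection M E h D \<and> (\<forall>\<xi>\<in>sections M E (fib E). \<D> \<xi> = hs_operator E \<Phi> h D \<xi>))"


section \<open>Higgs subbundles and quotients\<close>

definition adapted_frame :: "('m::topological_space, 'n::finite) cmanifold \<Rightarrow> ('m, 'v) vbundle \<Rightarrow>
    ('m \<Rightarrow> 'v set) \<Rightarrow> 'm set \<Rightarrow> nat \<Rightarrow> nat \<Rightarrow> (nat \<Rightarrow> 'm \<Rightarrow> 'v) \<Rightarrow> bool" where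
  "adapted_frame M E S U n s e \<longleftrightarrow> holo_frame M E U n e \<and> s \<le> n \<and>
     (\<forall>p\<in>U. is_basis (fibre E p\<lparr>carrier := S p\<rparr>) s (\<lambda>i. e i p))"

definition holo_subbundle :: "('m::topological_space, 'n::finite) cmanifold \<Rightarrow> ('m, 'v) vbundle \<Rightarrow>
    ('m \<Rightarrow> 'v set) \<Rightarrow> bool" where
  "holo_subbundle M E S \<longleftrightarrow> (\<forall>p. submodule (S p) complex_ring (fibre E p)) \<and>
     (\<forall>p. \<exists>U n s e. p \<in> U \<and> adapted_frame M E S U n s e)"

definition higgs_subbundle :: "('m::topological_space, 'n::finite) cmanifold \<Rightarrow> ('m, 'v) vbundle \<Rightarrow>
    ('m, 'n, 'v) hom_form \<Rightarrow> ('m \<Rightarrow> 'v set) \<Rightarrow> bool" where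
  "higgs_subbundle M E \<Phi> S \<longleftrightarrow> holo_subbundle M E S \<and> (\<forall>p v. \<forall>x\<in>S p. \<Phi> p v x \<in> S p)"

definition quot_map :: "('m, 'v) vbundle \<Rightarrow> ('m \<Rightarrow> 'v set) \<Rightarrow> 'm \<Rightarrow> 'v \<Rightarrow> 'v set" where
  "quot_map E S p x = S p +>\<^bsub>fibre E p\<^esub> x"

text \<open>In \<open>quot_smult\<close> and \<open>quot_higgs\<close> the coset does not depend on \<open>x \<in> X\<close>, so the union is just
  that coset.\<close>

definition quot_smult :: "('m, 'v) vbundle \<Rightarrow> ('m \<Rightarrow> 'v set) \<Rightarrow> 'm \<Rightarrow> complex \<Rightarrow> 'v set \<Rightarrow> 'v set" where
  "quot_smult E S p a X = (\<Union>x\<in>X. quot_map E S p (a \<odot>\<^bsub>fibre E p\<^esub> x))"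

definition quot_bundle :: "('m::topological_space, 'n::finite) cmanifold \<Rightarrow> ('m, 'v) vbundle \<Rightarrow>
    ('m \<Rightarrow> 'v set) \<Rightarrow> ('m, 'v set) vbundle" where
  "quot_bundle M E S = \<lparr>
     fibre = (\<lambda>p. \<lparr>carrier = a_rcosets\<^bsub>fibre E p\<^esub> S p, mult = undefined, one = undefined,
                   zero = S p, add = set_add (fibre E p), smult = quot_smult E S p\<rparr>),
     frames = {(U, n - s, \<lambda>i p. quot_map E S p (e (s + i) p)) | U n s e. adapted_frame M E S U n s e}\<rparr>"

definition quot_higgs :: "('m, 'v) vbundle \<Rightarrow> ('m, 'n, 'v) hom_form \<Rightarrow> ('m \<Rightarrow> 'v set) \<Rightarrow>
    ('m, 'n, 'v set) hom_form" where
  "quot_higgs E \<Phi> S p v X = (\<Union>x\<in>X. quot_map E S p (\<Phi> p v x))"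

definition orth :: "('m, 'v) vbundle \<Rightarrow> ('m \<Rightarrow> 'v \<Rightarrow> 'v \<Rightarrow> complex) \<Rightarrow> ('m \<Rightarrow> 'v set) \<Rightarrow> 'm \<Rightarrow> 'v set" where
  "orth E h S p = {x \<in> fib E p. \<forall>y\<in>S p. h p x y = 0}"

text \<open>The inverse of the isomorphism from the orthogonal complement of \<open>S\<close> to the quotient.\<close>

definition quot_lift :: "('m, 'v) vbundle \<Rightarrow> ('m \<Rightarrow> 'v \<Rightarrow> 'v \<Rightarrow> complex) \<Rightarrow> ('m \<Rightarrow> 'v set) \<Rightarrow>
    'm \<Rightarrow> 'v set \<Rightarrow> 'v" where
  "quot_lift E h S p = inv_into (orth E h S p) (quot_map E S p)"

definition quot_metric :: "('m, 'v) vbundle \<Rightarrow> ('m \<Rightarrow> 'v \<Rightarrow> 'v \<Rightarrow> complex) \<Rightarrow> ('m \<Rightarrow> 'v set) \<Rightarrow>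
    'm \<Rightarrow> 'v set \<Rightarrow> 'v set \<Rightarrow> complex" where
  "quot_metric E h S p X Y = h p (quot_lift E h S p X) (quot_lift E h S p Y)"

text \<open>The projection of \<open>A \<oplus> B\<close> onto \<open>A\<close>.\<close>

definition proj_along :: "(complex, 'v) module \<Rightarrow> 'v set \<Rightarrow> 'v set \<Rightarrow> 'v \<Rightarrow> 'v" where
  "proj_along V A B x = (THE a. a \<in> A \<and> (\<exists>b\<in>B. x = a \<oplus>\<^bsub>V\<^esub> b))"

definition proj_S :: "('m, 'v) vbundle \<Rightarrow> ('m \<Rightarrow> 'v \<Rightarrow> 'v \<Rightarrow> complex) \<Rightarrow> ('m \<Rightarrow> 'v set) \<Rightarrow> 'm \<Rightarrow> 'v \<Rightarrow> 'v" where
  "proj_S E h S p = proj_along (fibre E p) (S p) (orth E h S p)"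

definition proj_orth :: "('m, 'v) vbundle \<Rightarrow> ('m \<Rightarrow> 'v \<Rightarrow> 'v \<Rightarrow> complex) \<Rightarrow> ('m \<Rightarrow> 'v set) \<Rightarrow> 'm \<Rightarrow> 'v \<Rightarrow> 'v" where
  "proj_orth E h S p = proj_along (fibre E p) (orth E h S p) (S p)"

text \<open>The components \<open>B\<^sub>h\<close> and \<open>D\<^sub>h\<^sub>,\<^sub>S\<^sub>\<bottom>\<close> of a connection \<open>D\<close> on sections of the orthogonal
  complement of \<open>S\<close>, followed by their Higgs versions.\<close>

definition B_op :: "('m, 'v) vbundle \<Rightarrow> ('m \<Rightarrow> 'v \<Rightarrow> 'v \<Rightarrow> complex) \<Rightarrow> ('m \<Rightarrow> 'v set) \<Rightarrow>
    ('m, 'n, 'v) operator \<Rightarrow> ('m, 'n, 'v) operator" where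
  "B_op E h S D \<eta> p v = proj_S E h S p (D \<eta> p v)"

definition D_orth_op :: "('m, 'v) vbundle \<Rightarrow> ('m \<Rightarrow> 'v \<Rightarrow> 'v \<Rightarrow> complex) \<Rightarrow> ('m \<Rightarrow> 'v set) \<Rightarrow>
    ('m, 'n, 'v) operator \<Rightarrow> ('m, 'n, 'v) operator" where
  "D_orth_op E h S D \<eta> p v = proj_orth E h S p (D \<eta> p v)"

definition hs_B_op :: "('m, 'v) vbundle \<Rightarrow> ('m, 'n, 'v) hom_form \<Rightarrow> ('m \<Rightarrow> 'v \<Rightarrow> 'v \<Rightarrow> complex) \<Rightarrow>
    ('m \<Rightarrow> 'v set) \<Rightarrow> ('m, 'n, 'v) operator \<Rightarrow> ('m, 'n, 'v) operator" where
  "hs_B_op E \<Phi> h S D \<eta> p v =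
     B_op E h S D \<eta> p v \<oplus>\<^bsub>fibre E p\<^esub> proj_S E h S p (\<Phi> p v (\<eta> p))"

definition hs_orth_op :: "('m, 'v) vbundle \<Rightarrow> ('m, 'n, 'v) hom_form \<Rightarrow> ('m \<Rightarrow> 'v \<Rightarrow> 'v \<Rightarrow> complex) \<Rightarrow>
    ('m \<Rightarrow> 'v set) \<Rightarrow> ('m, 'n, 'v) operator \<Rightarrow> ('m, 'n, 'v) operator" where
  "hs_orth_op E \<Phi> h S D \<eta> p v =
     D_orth_op E h S D \<eta> p v \<oplus>\<^bsub>fibre E p\<^esub> proj_orth E h S p (\<Phi> p v (\<eta> p))
       \<oplus>\<^bsub>fibre E p\<^esub> higgs_adj E h \<Phi> p v (\<eta> p)"

definition hs_quot_op :: "('m, 'v) vbundle \<Rightarrow> ('m, 'n, 'v) hom_form \<Rightarrow> ('m \<Rightarrow> 'v \<Rightarrow> 'v \<Rightarrow> complex) \<Rightarrow>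
    ('m \<Rightarrow> 'v set) \<Rightarrow> ('m, 'n, 'v) operator \<Rightarrow> ('m, 'n, 'v set) operator" where
  "hs_quot_op E \<Phi> h S D \<zeta> p v =
     quot_map E S p (hs_orth_op E \<Phi> h S D (\<lambda>q. quot_lift E h S q (\<zeta> q)) p v)"

end

theory Submission
  imports Defs "HOL-Real_Asymp.Real_Asymp"
begin

text \<open>
  Write \<open>B = P\<^sub>S D\<close> for the \<open>S\<close>-component of the Chern connection \<open>D\<close> on sections of \<open>S\<^sup>\<bottom>\<close>. For
  \<open>\<eta>\<close> in \<open>S\<^sup>\<bottom>\<close> and \<open>\<xi>\<close> in \<open>S\<close> the function \<open>h(\<eta>, \<xi>)\<close> vanishes, so metric compatibility gives
  \<open>h(B \<eta>, \<xi>) = - h(\<eta>, D \<xi>)\<close>. The right-hand side depends on \<open>\<eta>\<close> only through its value at the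
  point, and every vector of \<open>S\<close> is the value of a global section \<open>\<xi>\<close>. Hence \<open>B\<close>, and with it
  \<open>B + P\<^sub>S \<Phi>\<close>, is a form with values in \<open>Hom(S\<^sup>\<bottom>, S)\<close> (\<open>B_op_pointwise\<close>,
  \<open>second_fundamental_form_hom_forms\<close>).

  Under \<open>Q \<cong> S\<^sup>\<bottom>\<close> the operator \<open>P\<^sub>S\<^sub>\<bottom> D\<close> becomes a connection on \<open>Q\<close> that is metric for \<open>h\<^sub>Q\<close>. Its
  \<open>(0,1)\<close>-part is \<open>d''\<close>: in a holomorphic frame of \<open>E\<close> whose first members span \<open>S\<close>, the lift of a
  section of \<open>Q\<close> has the same coefficients at the remaining members, and \<open>d''\<close> acts on
  coefficients. So it is a Chern connection of \<open>(Q, h\<^sub>Q)\<close> (\<open>quot_chern_connection\<close>), and Chern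
  connections are unique (\<open>chern_connection_unique\<close>). The Higgs field of \<open>Q\<close> corresponds to
  \<open>P\<^sub>S\<^sub>\<bottom> \<Phi>\<close> and its adjoint to the adjoint of \<open>\<Phi>\<close> (\<open>quot_higgs_eq\<close>, \<open>quot_higgs_adj\<close>), which turns
  the statement on Chern connections into that on Hitchin-Simpson connections.

  Two facts are used throughout. Global sections through a given vector exist because local
  sections can be cut off by a smooth bump function (\<open>bump_exists\<close>, \<open>extend_section\<close>). Smoothness of
  projections and of coefficients in arbitrary smooth frames comes from the Gram-Schmidt process
  with parameters (\<open>gs_proj_smooth_coeffs\<close>): a section is smooth iff its pairings with local
  frames are.
\<close>

section \<open>Calculus of functions of class \<open>C\<^sup>k\<close>\<close>

lemma frechet_derivative_eq:
  "(f has_derivative f') (at x) \<Longrightarrow> frechet_derivative f (at x) = f'"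
  by (metis frechet_derivative_at)

lemma Ck_on_subset: "Ck_on k f U \<Longrightarrow> V \<subseteq> U \<Longrightarrow> Ck_on k f V"
  by (induction k arbitrary: f) (auto intro: continuous_on_subset)

lemma Ck_on_Suc_imp: "Ck_on (Suc k) f U \<Longrightarrow> Ck_on k f U"
proof (induction k arbitrary: f)
  case 0
  then show ?case
    by (auto intro!: continuous_at_imp_continuous_on differentiable_imp_continuous_within)
next
  case (Suc k)
  from Suc.prems have "\<And>v. Ck_on (Suc k) (\<lambda>x. frechet_derivative f (at x) v) U"
    by simp
  from Suc.IH[OF this] Suc.prems show ?case by simp
qed

lemma Ck_on_cong:
  assumes "Ck_on k f U" "open U" "\<And>x. x \<in> U \<Longrightarrow> f x = g x"
  shows "Ck_on k g U"
  using assms(1,3)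
proof (induction k arbitrary: f g)
  case 0
  then show ?case using continuous_on_cong by fastforce
next
  case (Suc k)
  have D: "(g has_derivative frechet_derivative f (at x)) (at x)" if "x \<in> U" for x
  proof -
    have "(f has_derivative frechet_derivative f (at x)) (at x)"
      using Suc.prems(1) that frechet_derivative_works by auto
    then show ?thesis
      using has_derivative_transform_within_open[OF _ assms(2) that] Suc.prems(2) by blast
  qed
  have "Ck_on k (\<lambda>x. frechet_derivative g (at x) v) U" for v
  proof (rule Suc.IH)
    show "Ck_on k (\<lambda>x. frechet_derivative f (at x) v) U" using Suc.prems(1) by simp
    show "frechet_derivative f (at x) v = frechet_derivative g (at x) v" if "x \<in> U" for x
      using frechet_derivative_eq[OF D[OF that]] by simp
  qed
  with D show ?case unfolding Ck_on.simps differentiable_def by blast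
qed

text \<open>The induction step of all closure properties below: a function is \<open>C\<^sup>k\<^sup>+\<^sup>1\<close> as soon as it has a
  derivative all of whose directional values are \<open>C\<^sup>k\<close>.\<close>

lemma Ck_on_SucI:
  assumes "open U" "\<And>x. x \<in> U \<Longrightarrow> (f has_derivative f' x) (at x)"
    and "\<And>v. Ck_on k (\<lambda>x. f' x v) U"
  shows "Ck_on (Suc k) f U"
proof -
  have "Ck_on k (\<lambda>x. frechet_derivative f (at x) v) U" for v
    by (rule Ck_on_cong[OF assms(3)[of v] assms(1)]) (simp add: frechet_derivative_eq[OF assms(2)])
  with assms(2) show ?thesis unfolding Ck_on.simps differentiable_def by blast
qed

lemma Ck_on_SucD:
  assumes "Ck_on (Suc k) f U"
  shows "x \<in> U \<Longrightarrow> (f has_derivative frechet_derivative f (at x)) (at x)"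
    and "Ck_on k (\<lambda>x. frechet_derivative f (at x) v) U"
  using assms frechet_derivative_works by auto

lemma Ck_on_local:
  assumes "open U" "\<And>x. x \<in> U \<Longrightarrow> \<exists>N. open N \<and> x \<in> N \<and> Ck_on k f N"
  shows "Ck_on k f U"
  using assms(2)
proof (induction k arbitrary: f)
  case 0
  show ?case
    unfolding Ck_on.simps
  proof (rule continuous_at_imp_continuous_on, rule ballI)
    fix x assume "x \<in> U"
    with 0 obtain N where "open N" "x \<in> N" "continuous_on N f" by auto
    then show "isCont f x" by (simp add: continuous_on_eq_continuous_at)
  qed
next
  case (Suc k)
  have "Ck_on k (\<lambda>x. frechet_derivative f (at x) v) U" for v
    by (rule Suc.IH) (use Suc.prems in fastforce)
  with Suc.prems show ?case by fastforce
qed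

lemma Ck_on_const: "open U \<Longrightarrow> Ck_on k (\<lambda>_. c) U"
proof (induction k arbitrary: c)
  case (Suc k)
  show ?case by (rule Ck_on_SucI[OF Suc.prems has_derivative_const Suc.IH[OF Suc.prems]])
qed simp

lemma Ck_on_bounded_linear:
  assumes "bounded_linear T" "open U"
  shows "Ck_on k f U \<Longrightarrow> Ck_on k (\<lambda>x. T (f x)) U"
proof (induction k arbitrary: f)
  case 0
  then show ?case
    using bounded_linear.continuous_on[OF assms(1)] by simp
next
  case (Suc k)
  show ?case
    by (rule Ck_on_SucI[OF assms(2) bounded_linear.has_derivative[OF assms(1) Ck_on_SucD(1)[OF Suc.prems]]], assumption+)
      (intro Suc.IH Ck_on_SucD(2)[OF Suc.prems])
qed

lemma Ck_on_add:
  assumes "open U"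
  shows "Ck_on k f U \<Longrightarrow> Ck_on k g U \<Longrightarrow> Ck_on k (\<lambda>x. f x + g x) U"
proof (induction k arbitrary: f g)
  case 0
  then show ?case by (simp add: continuous_on_add)
next
  case (Suc k)
  show ?case
    by (rule Ck_on_SucI[OF assms has_derivative_add[OF Ck_on_SucD(1)[OF Suc.prems(1)] Ck_on_SucD(1)[OF Suc.prems(2)]]], assumption+)
      (intro Suc.IH Ck_on_SucD(2)[OF Suc.prems(1)] Ck_on_SucD(2)[OF Suc.prems(2)])
qed

lemma Ck_on_mult:
  fixes f g :: "'a::real_normed_vector \<Rightarrow> 'b::real_normed_algebra"
  assumes "open U"
  shows "Ck_on k f U \<Longrightarrow> Ck_on k g U \<Longrightarrow> Ck_on k (\<lambda>x. f x * g x) U"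
proof (induction k arbitrary: f g)
  case 0
  then show ?case by (simp add: continuous_on_mult)
next
  case (Suc k)
  show ?case
    by (rule Ck_on_SucI[OF assms has_derivative_mult[OF Ck_on_SucD(1)[OF Suc.prems(1)] Ck_on_SucD(1)[OF Suc.prems(2)]]], assumption+)
      (intro Suc.IH Ck_on_add[OF assms] Ck_on_SucD(2)[OF Suc.prems(1)] Ck_on_SucD(2)[OF Suc.prems(2)]
        Ck_on_Suc_imp[OF Suc.prems(1)] Ck_on_Suc_imp[OF Suc.prems(2)])
qed

lemma Ck_on_inverse:
  fixes f :: "'a::real_normed_vector \<Rightarrow> 'b::real_normed_field"
  assumes "open U" "\<And>x. x \<in> U \<Longrightarrow> f x \<noteq> 0"
  shows "Ck_on k f U \<Longrightarrow> Ck_on k (\<lambda>x. inverse (f x)) U"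
proof (induction k)
  case 0
  then show ?case using assms(2) by (auto intro!: continuous_on_inverse)
next
  case (Suc k)
  have IH: "Ck_on k (\<lambda>x. inverse (f x)) U"
    by (rule Suc.IH[OF Ck_on_Suc_imp[OF Suc.prems]])
  have D: "((\<lambda>x. inverse (f x)) has_derivative
      (\<lambda>v. - 1 * (inverse (f x) * frechet_derivative f (at x) v * inverse (f x)))) (at x)" if "x \<in> U" for x
    using Deriv.has_derivative_inverse[OF assms(2)[OF that] Ck_on_SucD(1)[OF Suc.prems that]] by simp
  show ?case
    by (rule Ck_on_SucI[OF assms(1) D], assumption+)
      (intro Ck_on_mult[OF assms(1)] IH Ck_on_const[OF assms(1)] Ck_on_SucD(2)[OF Suc.prems])
qed

lemma Ck_on_compose_real:
  fixes g :: "real \<Rightarrow> real" and r :: "'a::real_normed_vector \<Rightarrow> real"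
  assumes "open U"
  shows "Ck_on k g UNIV \<Longrightarrow> Ck_on k r U \<Longrightarrow> Ck_on k (\<lambda>x. g (r x)) U"
proof (induction k arbitrary: g)
  case 0
  then show ?case
    by (auto intro: continuous_on_compose2)
next
  case (Suc k)
  have D: "((\<lambda>x. g (r x)) has_derivative
      (\<lambda>v. frechet_derivative r (at x) v * frechet_derivative g (at (r x)) 1)) (at x)" if "x \<in> U" for x
  proof -
    have g: "(g has_derivative frechet_derivative g (at (r x))) (at (r x))"
      by (rule Ck_on_SucD(1)[OF Suc.prems(1)]) simp
    from g have "linear (frechet_derivative g (at (r x)))" by (rule has_derivative_linear)
    then have "frechet_derivative g (at (r x)) t = t * frechet_derivative g (at (r x)) 1" for t
      using linear_scale[of _ t 1] by (metis mult.right_neutral real_scaleR_def)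
    then have "(\<lambda>v. frechet_derivative g (at (r x)) (frechet_derivative r (at x) v)) =
        (\<lambda>v. frechet_derivative r (at x) v * frechet_derivative g (at (r x)) 1)"
      by (intro ext)
    from has_derivative_compose[OF Ck_on_SucD(1)[OF Suc.prems(2) that] g, unfolded this] show ?thesis .
  qed
  show ?case
    by (rule Ck_on_SucI[OF assms D], assumption+)
      (intro Ck_on_mult[OF assms] Ck_on_SucD(2)[OF Suc.prems(2)]
        Suc.IH[OF Ck_on_SucD(2)[OF Suc.prems(1)] Ck_on_Suc_imp[OF Suc.prems(2)]])
qed

text \<open>The flat function \<open>t\<^sup>-\<^sup>m exp (- 1 / t)\<close>, extended by zero to \<open>t \<le> 0\<close>. The exponent \<open>m\<close> makes
  the family closed under differentiation.\<close>

definition flat_fun :: "nat \<Rightarrow> real \<Rightarrow> real" where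
  "flat_fun m t = (if t > 0 then (1 / t) ^ m * exp (- 1 / t) else 0)"

lemma flat_fun_tendsto_0: "(flat_fun m \<longlongrightarrow> 0) (at 0)"
proof (rule filterlim_split_at)
  show "(flat_fun m \<longlongrightarrow> 0) (at_left 0)"
    by (rule tendsto_eventually) (auto simp: flat_fun_def eventually_at_filter)
  have "((\<lambda>t::real. (1 / t) ^ m * exp (- 1 / t)) \<longlongrightarrow> 0) (at_right 0)"
    by real_asymp
  then show "(flat_fun m \<longlongrightarrow> 0) (at_right 0)"
    by (rule Lim_transform_eventually) (auto simp: flat_fun_def eventually_at_filter)
qed

lemma flat_fun_has_derivative:
  "(flat_fun m has_real_derivative (flat_fun (m + 2) t - of_nat m * flat_fun (m + 1) t)) (at t)"
proof (cases t "0::real" rule: linorder_cases)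
  case less
  have "((\<lambda>_. 0) has_real_derivative 0) (at t)" by simp
  then have "(flat_fun m has_real_derivative 0) (at t)"
    by (rule has_field_derivative_transform_within_open[where S = "{..<0}"])
      (use less in \<open>auto simp: flat_fun_def\<close>)
  then show ?thesis using less by (simp add: flat_fun_def)
next
  case greater
  have "((\<lambda>t. (1 / t) ^ m * exp (- 1 / t)) has_real_derivative
      (1 / t) ^ (m + 2) * exp (- 1 / t) - of_nat m * ((1 / t) ^ (m + 1) * exp (- 1 / t))) (at t)"
  proof -
    have "((\<lambda>t. 1 / t) has_real_derivative - ((1 / t)\<^sup>2)) (at t)"
      using greater by (auto intro!: derivative_eq_intros simp: field_simps power2_eq_square)
    from DERIV_power[OF this, of m]
    have 1: "((\<lambda>t. (1 / t) ^ m) has_real_derivative - (of_nat m * (1 / t) ^ (m + 1))) (at t)"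
      by (cases m) (simp_all add: power2_eq_square)
    have 2: "((\<lambda>t. exp (- 1 / t)) has_real_derivative (1 / t)\<^sup>2 * exp (- 1 / t)) (at t)"
      using greater by (auto intro!: derivative_eq_intros simp: field_simps power2_eq_square)
    show ?thesis
      by (rule DERIV_cong[OF DERIV_mult[OF 1 2]]) (simp add: power2_eq_square algebra_simps)
  qed
  then have "(flat_fun m has_real_derivative
      (1 / t) ^ (m + 2) * exp (- 1 / t) - of_nat m * ((1 / t) ^ (m + 1) * exp (- 1 / t))) (at t)"
    by (rule has_field_derivative_transform_within_open[where S = "{0<..}"])
      (use greater in \<open>auto simp: flat_fun_def\<close>)
  then show ?thesis using greater by (simp add: flat_fun_def)
next
  case equal
  have "((\<lambda>y. (flat_fun m y - flat_fun m 0) / (y - 0)) \<longlongrightarrow> 0) (at 0)"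
    by (rule Lim_transform_eventually[OF flat_fun_tendsto_0[of "Suc m"]])
      (auto simp: flat_fun_def eventually_at_filter)
  then show ?thesis
    using equal by (simp add: has_field_derivative_iff flat_fun_def)
qed

lemma Ck_on_flat_fun: "Ck_on k (flat_fun m) UNIV"
proof (induction k arbitrary: m)
  case 0
  have "isCont (flat_fun m) t" for t
    by (rule DERIV_isCont[OF flat_fun_has_derivative])
  then show ?case by (simp add: continuous_at_imp_continuous_on)
next
  case (Suc k)
  have D: "(flat_fun m has_derivative
      (\<lambda>v. (flat_fun (m + 2) t + - of_nat m * flat_fun (m + 1) t) * v)) (at t)" for t
    using flat_fun_has_derivative[of m t] unfolding has_field_derivative_def by simp
  show ?case
    by (rule Ck_on_SucI[OF open_UNIV D])
      (intro Ck_on_mult Ck_on_add Ck_on_const Suc.IH open_UNIV)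
qed

text \<open>A smooth step, equal to \<open>1\<close> on \<open>t \<le> 1\<close> and to \<open>0\<close> on \<open>t \<ge> 2\<close>.\<close>

definition step_fun :: "real \<Rightarrow> real" where
  "step_fun t = flat_fun 0 (2 - t) * inverse (flat_fun 0 (2 - t) + flat_fun 0 (t - 1))"

lemma step_fun_eq_1: "t \<le> 1 \<Longrightarrow> step_fun t = 1"
  by (simp add: step_fun_def flat_fun_def)

lemma step_fun_eq_0: "t \<ge> 2 \<Longrightarrow> step_fun t = 0"
  by (simp add: step_fun_def flat_fun_def)

lemma Ck_on_id: "Ck_on k (\<lambda>t::real. t) UNIV"
proof (cases k)
  case (Suc j)
  show ?thesis unfolding Suc
    by (rule Ck_on_SucI[OF open_UNIV has_derivative_ident]) (rule Ck_on_const[OF open_UNIV])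
qed simp

lemma Ck_on_step_fun: "Ck_on k step_fun UNIV"
proof -
  have a: "Ck_on k (\<lambda>t::real. 2 + - 1 * t) UNIV" and b: "Ck_on k (\<lambda>t::real. t + - 1) UNIV"
    by (intro Ck_on_add Ck_on_mult Ck_on_const Ck_on_id open_UNIV)+
  have pos: "flat_fun 0 (2 - t) + flat_fun 0 (t - 1) \<noteq> 0" for t :: real
  proof (cases "t < 2")
    case True
    then have "flat_fun 0 (2 - t) > 0" "flat_fun 0 (t - 1) \<ge> 0" by (simp_all add: flat_fun_def)
    then show ?thesis by linarith
  qed (simp add: flat_fun_def)
  have "Ck_on k (\<lambda>t. flat_fun 0 (2 - t)) UNIV" "Ck_on k (\<lambda>t. flat_fun 0 (t - 1)) UNIV"
    using Ck_on_compose_real[OF open_UNIV Ck_on_flat_fun a] Ck_on_compose_real[OF open_UNIV Ck_on_flat_fun b]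
    by simp_all
  with pos have "Ck_on k (\<lambda>t. flat_fun 0 (2 - t) * inverse (flat_fun 0 (2 - t) + flat_fun 0 (t - 1))) UNIV"
    by (intro Ck_on_mult Ck_on_inverse Ck_on_add open_UNIV)
  then show ?thesis by (simp add: step_fun_def[abs_def])
qed


section \<open>Smooth functions on complex manifolds\<close>

locale complex_mfd =
  fixes M :: "('m::topological_space, 'n::finite) cmanifold"
  assumes complex_manifold: "complex_manifold M"
begin

lemma chart_homeomorphism:
  "c \<in> atlas M \<Longrightarrow> homeomorphism (fst c) (snd c ` fst c) (snd c) (chart_inv c)"
  and chart_domain_open: "c \<in> atlas M \<Longrightarrow> open (fst c)"
  and chart_range_open: "c \<in> atlas M \<Longrightarrow> open (snd c ` fst c)"
  and chart_at_atlas [simp]: "chart_at M p \<in> atlas M"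
  and chart_at_mem [simp]: "p \<in> fst (chart_at M p)"
  using complex_manifold unfolding complex_manifold_def by blast+

lemma chart_inv_chart: "c \<in> atlas M \<Longrightarrow> p \<in> fst c \<Longrightarrow> chart_inv c (snd c p) = p"
  using chart_homeomorphism homeomorphism_apply1 by blast

lemma chart_image_open:
  assumes "c \<in> atlas M" "open W"
  shows "open (snd c ` (fst c \<inter> W))"
proof -
  have "openin (top_of_set (snd c ` fst c)) (snd c ` (fst c \<inter> W))"
    by (rule homeomorphism_imp_open_map[OF chart_homeomorphism[OF assms(1)]])
      (use assms in \<open>auto intro: openin_open_Int\<close>)
  then show ?thesis using chart_range_open[OF assms(1)] openin_open_trans by blast
qed

lemma smooth_fun_onI:
  assumes "\<And>c k. c \<in> atlas M \<Longrightarrow> Ck_on k (f \<circ> chart_inv c) (snd c ` (fst c \<inter> W))"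
  shows "smooth_fun_on M W f"
  using assms by (simp add: smooth_fun_on_def smooth_on_def)

lemma smooth_fun_onD:
  "smooth_fun_on M W f \<Longrightarrow> c \<in> atlas M \<Longrightarrow> Ck_on k (\<lambda>x. f (chart_inv c x)) (snd c ` (fst c \<inter> W))"
  by (simp add: smooth_fun_on_def smooth_on_def o_def)

lemma smooth_fun_on_subset: "smooth_fun_on M W f \<Longrightarrow> V \<subseteq> W \<Longrightarrow> smooth_fun_on M V f"
  unfolding smooth_fun_on_def smooth_on_def by (blast intro: Ck_on_subset)

lemma smooth_fun_on_cong:
  assumes "smooth_fun_on M W f" "open W" "\<And>p. p \<in> W \<Longrightarrow> f p = g p"
  shows "smooth_fun_on M W g"
proof (rule smooth_fun_onI)
  fix c k assume c: "c \<in> atlas M"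
  show "Ck_on k (g \<circ> chart_inv c) (snd c ` (fst c \<inter> W))"
    by (rule Ck_on_cong[OF smooth_fun_onD[OF assms(1) c] chart_image_open[OF c assms(2)]])
      (auto simp: chart_inv_chart[OF c] assms(3))
qed

lemma smooth_fun_on_local:
  assumes "open W" "\<And>p. p \<in> W \<Longrightarrow> \<exists>N. open N \<and> p \<in> N \<and> smooth_fun_on M N f"
  shows "smooth_fun_on M W f"
proof (rule smooth_fun_onI)
  fix c k assume c: "c \<in> atlas M"
  show "Ck_on k (f \<circ> chart_inv c) (snd c ` (fst c \<inter> W))"
  proof (rule Ck_on_local[OF chart_image_open[OF c assms(1)]])
    fix x assume "x \<in> snd c ` (fst c \<inter> W)"
    then obtain p where p: "p \<in> fst c" "p \<in> W" "x = snd c p" by auto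
    with assms(2) obtain N where N: "open N" "p \<in> N" "smooth_fun_on M N f" by blast
    show "\<exists>N. open N \<and> x \<in> N \<and> Ck_on k (f \<circ> chart_inv c) N"
      using smooth_fun_onD[OF N(3) c] chart_image_open[OF c N(1)] p N(2) unfolding o_def by blast
  qed
qed

lemma smooth_fun_on_const [simp]: "open W \<Longrightarrow> smooth_fun_on M W (\<lambda>_. a)"
  by (rule smooth_fun_onI) (simp add: o_def Ck_on_const chart_image_open)

lemma smooth_fun_on_add:
  "open W \<Longrightarrow> smooth_fun_on M W f \<Longrightarrow> smooth_fun_on M W g \<Longrightarrow> smooth_fun_on M W (\<lambda>p. f p + g p)"
  by (rule smooth_fun_onI) (auto simp only: o_def intro!: Ck_on_add[OF chart_image_open smooth_fun_onD smooth_fun_onD])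

lemma smooth_fun_on_mult:
  "open W \<Longrightarrow> smooth_fun_on M W f \<Longrightarrow> smooth_fun_on M W g \<Longrightarrow> smooth_fun_on M W (\<lambda>p. f p * g p)"
  by (rule smooth_fun_onI) (auto simp only: o_def intro!: Ck_on_mult[OF chart_image_open smooth_fun_onD smooth_fun_onD])

lemma smooth_fun_on_cnj:
  "open W \<Longrightarrow> smooth_fun_on M W f \<Longrightarrow> smooth_fun_on M W (\<lambda>p. cnj (f p))"
  by (rule smooth_fun_onI)
    (auto simp only: o_def intro!: Ck_on_bounded_linear[OF bounded_linear_cnj chart_image_open smooth_fun_onD])

lemma smooth_fun_on_divide:
  assumes "open W" "smooth_fun_on M W f" "smooth_fun_on M W g" "\<And>p. p \<in> W \<Longrightarrow> g p \<noteq> 0"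
  shows "smooth_fun_on M W (\<lambda>p. f p / g p)"
proof -
  have "smooth_fun_on M W (\<lambda>p. inverse (g p))"
  proof (rule smooth_fun_onI)
    fix c k assume c: "c \<in> atlas M"
    show "Ck_on k ((\<lambda>p. inverse (g p)) \<circ> chart_inv c) (snd c ` (fst c \<inter> W))"
      unfolding o_def
      by (rule Ck_on_inverse[OF chart_image_open[OF c assms(1)] _ smooth_fun_onD[OF assms(3) c]])
        (auto simp: chart_inv_chart[OF c] assms(4))
  qed
  from smooth_fun_on_mult[OF assms(1,2) this] show ?thesis by (simp add: divide_inverse)
qed

lemma smooth_fun_on_diff:
  assumes "open W" "smooth_fun_on M W f" "smooth_fun_on M W g"
  shows "smooth_fun_on M W (\<lambda>p. f p - g p)"
  using smooth_fun_on_add[OF assms(1,2) smooth_fun_on_mult[OF assms(1) smooth_fun_on_const[OF assms(1), of "-1"] assms(3)]]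
  by simp

lemma smooth_fun_on_sum:
  "open W \<Longrightarrow> (\<And>i. i < n \<Longrightarrow> smooth_fun_on M W (f i)) \<Longrightarrow>
     smooth_fun_on M W (\<lambda>p. \<Sum>i<(n::nat). f i p)"
  by (induction n) (simp_all add: smooth_fun_on_add)

lemma holo_imp_smooth_fun_on: "holo_fun_on M W f \<Longrightarrow> smooth_fun_on M W f"
  by (simp add: holo_fun_on_def smooth_fun_on_def holo_on_def)


lemma dfun_has_derivative:
  assumes "open W" "p \<in> W" "smooth_fun_on M W f"
  shows "((\<lambda>x. f (chart_inv (chart_at M p) x)) has_derivative dfun M f p)
    (at (snd (chart_at M p) p))"
proof -
  have "Ck_on (Suc 0) (\<lambda>x. f (chart_inv (chart_at M p) x)) (snd (chart_at M p) ` (fst (chart_at M p) \<inter> W))"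
    by (rule smooth_fun_onD[OF assms(3)]) simp
  from Ck_on_SucD(1)[OF this, of "snd (chart_at M p) p"] show ?thesis
    using assms(2) by (auto simp: dfun_def[abs_def] o_def)
qed

lemma dfun_eqI:
  assumes "((\<lambda>x. f (chart_inv (chart_at M p) x)) has_derivative f') (at (snd (chart_at M p) p))"
  shows "dfun M f p v = f' v"
  using frechet_derivative_eq[OF assms] by (simp add: dfun_def o_def)

lemma dfun_cong:
  assumes "open W" "p \<in> W" "smooth_fun_on M W f" "\<And>q. q \<in> W \<Longrightarrow> f q = g q"
  shows "dfun M g p v = dfun M f p v"
proof -
  let ?c = "chart_at M p"
  have "((\<lambda>x. g (chart_inv ?c x)) has_derivative dfun M f p) (at (snd ?c p))"
    by (rule has_derivative_transform_within_open[OF dfun_has_derivative[OF assms(1-3)]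
          chart_image_open[OF chart_at_atlas assms(1)]])
      (use assms(2) in \<open>auto simp: chart_inv_chart assms(4)\<close>)
  then show ?thesis by (rule dfun_eqI)
qed

lemma dfun_add:
  assumes "open W" "p \<in> W" "smooth_fun_on M W f" "smooth_fun_on M W g"
  shows "dfun M (\<lambda>q. f q + g q) p v = dfun M f p v + dfun M g p v"
  by (rule dfun_eqI[OF has_derivative_add]) (rule dfun_has_derivative assms)+

lemma dfun_mult:
  assumes "open W" "p \<in> W" "smooth_fun_on M W f" "smooth_fun_on M W g"
  shows "dfun M (\<lambda>q. f q * g q) p v = f p * dfun M g p v + dfun M f p v * g p"
proof -
  have "dfun M (\<lambda>q. f q * g q) p v = f (chart_inv (chart_at M p) (snd (chart_at M p) p)) * dfun M g p v
      + dfun M f p v * g (chart_inv (chart_at M p) (snd (chart_at M p) p))"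
    by (rule dfun_eqI[OF has_derivative_mult]) (rule dfun_has_derivative assms)+
  then show ?thesis by (simp add: chart_inv_chart)
qed

lemma dfun_zero: "dfun M (\<lambda>_. 0) p v = 0"
  by (rule dfun_eqI[where f' = "\<lambda>_. 0"]) simp

lemma dbar_fun_holo:
  assumes "p \<in> W" "holo_fun_on M W f"
  shows "dbar_fun M f p v = 0"
proof -
  have "holo_on (f \<circ> chart_inv (chart_at M p)) (snd (chart_at M p) ` (fst (chart_at M p) \<inter> W))"
    using assms(2) by (simp add: holo_fun_on_def)
  then have "dfun M f p (\<i> *s v) = \<i> * dfun M f p v"
    using assms(1) unfolding holo_on_def dfun_def by auto
  then show ?thesis by (simp add: dbar_fun_def)
qed

lemma dbar_fun_add:
  assumes "open W" "p \<in> W" "smooth_fun_on M W f" "smooth_fun_on M W g"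
  shows "dbar_fun M (\<lambda>q. f q + g q) p v = dbar_fun M f p v + dbar_fun M g p v"
  by (simp add: dbar_fun_def dfun_add[OF assms] field_simps)

lemma dbar_fun_mult:
  assumes "open W" "p \<in> W" "smooth_fun_on M W f" "smooth_fun_on M W g"
  shows "dbar_fun M (\<lambda>q. f q * g q) p v = f p * dbar_fun M g p v + dbar_fun M f p v * g p"
  by (simp add: dbar_fun_def dfun_mult[OF assms] field_simps)

text \<open>Leibniz rule for \<open>dbar\<close>: holomorphic factors behave like constants.\<close>

lemma dbar_fun_holo_sum:
  assumes "open W" "p \<in> W" "\<And>i. i < n \<Longrightarrow> smooth_fun_on M W (a i)" "\<And>i. i < n \<Longrightarrow> holo_fun_on M W (b i)"
  shows "dbar_fun M (\<lambda>q. \<Sum>i<(n::nat). a i q * b i q) p v = (\<Sum>i<n. dbar_fun M (a i) p v * b i p)"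
  using assms(3,4)
proof (induction n)
  case 0
  then show ?case by (simp add: dbar_fun_def dfun_zero)
next
  case (Suc n)
  note b = holo_imp_smooth_fun_on[OF Suc.prems(2)]
  have "smooth_fun_on M W (\<lambda>q. \<Sum>i<n. a i q * b i q)" "smooth_fun_on M W (\<lambda>q. a n q * b n q)"
    by (auto intro!: smooth_fun_on_sum smooth_fun_on_mult assms(1) Suc.prems(1) b)
  moreover have "dbar_fun M (b n) p v = 0"
    by (rule dbar_fun_holo[OF assms(2) Suc.prems(2)]) simp
  ultimately show ?case
    using Suc by (simp add: dbar_fun_add[OF assms(1,2)] dbar_fun_mult[OF assms(1,2)] b)
qed

lemma dbar_fun_cong:
  assumes "open W" "p \<in> W" "smooth_fun_on M W f" "\<And>q. q \<in> W \<Longrightarrow> f q = g q"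
  shows "dbar_fun M g p v = dbar_fun M f p v"
  using dfun_cong[OF assms] by (simp add: dbar_fun_def)

lemma transition_Ck_on:
  assumes "c \<in> atlas M" "c' \<in> atlas M"
  shows "Ck_on k (\<lambda>x. snd c' (chart_inv c x) $ i) (snd c ` (fst c \<inter> fst c'))"
  using complex_manifold assms unfolding complex_manifold_def holo_on_def smooth_on_def by blast

end

lemma norm_vec_power2: "(norm (x :: complex^'n::finite))\<^sup>2 = (\<Sum>i\<in>UNIV. Re (x $ i * cnj (x $ i)))"
proof -
  have "Re (z * cnj z) = (norm z)\<^sup>2" for z :: complex
    using complex_norm_square[of z] by (metis Re_complex_of_real)
  then show ?thesis by (simp add: norm_vec_def L2_set_def sum_nonneg)
qed

lemma Ck_on_sum:
  assumes "open U"
  shows "finite I \<Longrightarrow> (\<And>i. i \<in> I \<Longrightarrow> Ck_on k (f i) U) \<Longrightarrow> Ck_on k (\<lambda>x. \<Sum>i\<in>I. f i x) U"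
  by (induction I rule: finite_induct) (auto intro: Ck_on_const Ck_on_add assms)

locale complex_mfd_t2 = complex_mfd M for M :: "('m::t2_space, 'n::finite) cmanifold"
begin

text \<open>Bump functions: \<open>K\<close> contains the support, and \<open>\<psi> = 1\<close> on \<open>N\<close>. The Hausdorff property makes the
  preimage of a closed coordinate ball closed in the whole manifold, so that extension by zero
  is smooth.\<close>

lemma bump_exists:
  assumes "open W" "p \<in> W"
  obtains \<psi> N K where "smooth_fun_on M UNIV \<psi>" "open N" "p \<in> N" "N \<subseteq> W" "\<And>q. q \<in> N \<Longrightarrow> \<psi> q = 1"
    "closed K" "K \<subseteq> W" "\<And>q. q \<notin> K \<Longrightarrow> \<psi> q = 0"
proof -
  define c where "c = chart_at M p"
  have c: "c \<in> atlas M" and pc: "p \<in> fst c" by (simp_all add: c_def)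
  define x0 where "x0 = snd c p"
  have "open (snd c ` (fst c \<inter> W))" "x0 \<in> snd c ` (fst c \<inter> W)"
    using chart_image_open[OF c assms(1)] pc assms(2) by (auto simp: x0_def)
  then obtain \<epsilon> where e: "\<epsilon> > 0" "cball x0 \<epsilon> \<subseteq> snd c ` (fst c \<inter> W)"
    using open_contains_cball by blast
  define r where "r = (\<lambda>x. 2 / \<epsilon>\<^sup>2 * (norm (x - x0))\<^sup>2)"
  define \<psi> where "\<psi> = (\<lambda>q. if q \<in> fst c then complex_of_real (step_fun (r (snd c q))) else 0)"
  define K where "K = chart_inv c ` cball x0 \<epsilon>"
  define N where "N = (fst c \<inter> snd c -` ball x0 (\<epsilon> / 2)) \<inter> W"
  have "continuous_on (cball x0 \<epsilon>) (chart_inv c)"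
    using chart_homeomorphism[OF c] e(2) unfolding homeomorphism_def
    by (meson continuous_on_subset image_mono inf_le1 subset_trans)
  then have "compact K" unfolding K_def by (intro compact_continuous_image) auto
  then have K: "closed K" by (rule compact_imp_closed)
  have KW: "K \<subseteq> W \<inter> fst c"
    using e(2) chart_inv_chart[OF c] unfolding K_def by fastforce
  have chi0: "\<psi> q = 0" if "q \<notin> K" for q
  proof (cases "q \<in> fst c")
    case True
    have "snd c q \<notin> cball x0 \<epsilon>"
      using that chart_inv_chart[OF c True] unfolding K_def by force
    then have "norm (snd c q - x0) > \<epsilon>" by (simp add: dist_norm norm_minus_commute)
    then have "(norm (snd c q - x0))\<^sup>2 \<ge> \<epsilon>\<^sup>2" using e(1) by (intro power_mono) auto
    then have "r (snd c q) \<ge> 2" using e(1) by (simp add: r_def field_simps)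
    then show ?thesis by (simp add: \<psi>_def step_fun_eq_0)
  qed (simp add: \<psi>_def)
  have chi1: "\<psi> q = 1" if "q \<in> N" for q
  proof -
    from that have q: "q \<in> fst c" and "norm (snd c q - x0) < \<epsilon> / 2"
      by (auto simp: N_def dist_norm norm_minus_commute)
    then have "(norm (snd c q - x0))\<^sup>2 \<le> (\<epsilon> / 2)\<^sup>2" by (intro power_mono) auto
    then have "4 * (norm (snd c q - x0))\<^sup>2 \<le> \<epsilon>\<^sup>2" by (simp add: power_divide)
    then have "2 * (norm (snd c q - x0))\<^sup>2 \<le> \<epsilon>\<^sup>2"
      using zero_le_power2[of "norm (snd c q - x0)"] by linarith
    then have "r (snd c q) \<le> 1" using e(1) by (simp add: r_def)
    with q show ?thesis by (simp add: \<psi>_def step_fun_eq_1)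
  qed
  have "open N"
  proof -
    have "continuous_on (fst c) (snd c)" using chart_homeomorphism[OF c] by (simp add: homeomorphism_def)
    then show ?thesis unfolding N_def
      using continuous_open_preimage[OF _ chart_domain_open[OF c]] assms(1) by blast
  qed
  have smooth: "smooth_fun_on M (fst c) \<psi>"
  proof (rule smooth_fun_onI)
    fix c' k assume c': "c' \<in> atlas M"
    let ?U = "snd c' ` (fst c' \<inter> fst c)"
    have U: "open ?U" by (rule chart_image_open[OF c' chart_domain_open[OF c]])
    let ?g = "\<lambda>i x. snd c (chart_inv c' x) $ i + - (x0 $ i)"
    have "Ck_on k (?g i) ?U" for i
      by (intro Ck_on_add Ck_on_const U transition_Ck_on c c')
    then have "Ck_on k (\<lambda>x. Re (?g i x * cnj (?g i x))) ?U" for i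
      by (intro Ck_on_bounded_linear[OF bounded_linear_Re U] Ck_on_mult[OF U]
          Ck_on_bounded_linear[OF bounded_linear_cnj U])
    then have "Ck_on k (\<lambda>x. 2 / \<epsilon>\<^sup>2 * (\<Sum>i\<in>UNIV. Re (?g i x * cnj (?g i x)))) ?U"
      by (intro Ck_on_mult Ck_on_const Ck_on_sum U finite)
    moreover have "r (snd c (chart_inv c' x)) = 2 / \<epsilon>\<^sup>2 * (\<Sum>i\<in>UNIV. Re (?g i x * cnj (?g i x)))" for x
      unfolding r_def norm_vec_power2 by simp
    ultimately have "Ck_on k (\<lambda>x. r (snd c (chart_inv c' x))) ?U" by simp
    then have "Ck_on k (\<lambda>x. complex_of_real (step_fun (r (snd c (chart_inv c' x))))) ?U"
      by (rule Ck_on_bounded_linear[OF bounded_linear_of_real U Ck_on_compose_real[OF U Ck_on_step_fun]])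
    then show "Ck_on k (\<psi> \<circ> chart_inv c') ?U"
      by (rule Ck_on_cong[OF _ U]) (auto simp: \<psi>_def chart_inv_chart[OF c'])
  qed
  have "smooth_fun_on M UNIV \<psi>"
  proof (rule smooth_fun_on_local)
    fix q :: 'm
    show "\<exists>N. open N \<and> q \<in> N \<and> smooth_fun_on M N \<psi>"
    proof (cases "q \<in> fst c")
      case True
      then show ?thesis using smooth chart_domain_open[OF c] by blast
    next
      case False
      have "open (- K)" using K by (rule open_Compl)
      have "smooth_fun_on M (- K) \<psi>"
        by (rule smooth_fun_on_cong[OF smooth_fun_on_const[OF \<open>open (- K)\<close>, of 0] \<open>open (- K)\<close>])
          (simp add: chi0)
      then show ?thesis using False KW \<open>open (- K)\<close> by blast
    qed
  qed simp
  moreover have "p \<in> N" using pc assms(2) e(1) by (simp add: N_def x0_def)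
  ultimately show thesis
    using that[of \<psi> N K] \<open>open N\<close> chi1 K KW chi0 by (auto simp: N_def)
qed

end


section \<open>Hermitian vector spaces\<close>

text \<open>A complex vector space in the sense of modules with explicit carrier.\<close>

locale complex_module = Module.module complex_ring V for V :: "(complex, 'v) module" (structure)
begin

lemma smult_mem [simp, intro]: "x \<in> carrier V \<Longrightarrow> a \<odot> x \<in> carrier V"
  using smult_closed[of a x] by simp

lemma smult_zero_left [simp]: "x \<in> carrier V \<Longrightarrow> 0 \<odot> x = \<zero>"
  using smult_l_null[of x] by simp

lemma smult_one_left [simp]: "x \<in> carrier V \<Longrightarrow> 1 \<odot> x = x"
  using smult_one[of x] by simp

lemma smult_zero_right [simp]: "a \<odot> \<zero> = \<zero>"
  using smult_r_null[of a] by simp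

lemma smult_add_left: "x \<in> carrier V \<Longrightarrow> (a + b) \<odot> x = a \<odot> x \<oplus> b \<odot> x"
  using smult_l_distr[of a b x] by simp

lemma smult_add_right: "x \<in> carrier V \<Longrightarrow> y \<in> carrier V \<Longrightarrow> a \<odot> (x \<oplus> y) = a \<odot> x \<oplus> a \<odot> y"
  using smult_r_distr[of a x y] by simp

lemma smult_smult: "x \<in> carrier V \<Longrightarrow> a \<odot> (b \<odot> x) = (a * b) \<odot> x"
  using smult_assoc1[of a b x] by simp

lemma neg_eq_smult: "x \<in> carrier V \<Longrightarrow> \<ominus> x = (- 1) \<odot> x"
proof -
  assume x: "x \<in> carrier V"
  have "(- 1) \<odot> x \<oplus> x = (- 1 + 1) \<odot> x" using x by (simp only: smult_add_left smult_one_left)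
  then have "(- 1) \<odot> x \<oplus> x = \<zero>" using x by simp
  then show ?thesis using x by (metis minus_equality smult_mem)
qed

lemma add_neg_smult: "x \<in> carrier V \<Longrightarrow> x \<oplus> (- 1) \<odot> x = \<zero>"
  by (simp add: neg_eq_smult[symmetric] r_neg)

lemma eq_if_minus_zero: "x \<in> carrier V \<Longrightarrow> y \<in> carrier V \<Longrightarrow> x \<ominus> y = \<zero> \<Longrightarrow> x = y"
  by (metis M.a_inv_closed M.minus_equality M.minus_minus a_comm a_minus_def)

lemma lincomb_closed [simp, intro]:
  "(\<And>i. i < n \<Longrightarrow> e i \<in> carrier V) \<Longrightarrow> lincomb V n a e \<in> carrier V"
  unfolding lincomb_def by (rule finsum_closed) auto

lemma lincomb_0 [simp]: "lincomb V 0 a e = \<zero>"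
  by (simp add: lincomb_def)

lemma lincomb_Suc:
  "(\<And>i. i \<le> n \<Longrightarrow> e i \<in> carrier V) \<Longrightarrow> lincomb V (Suc n) a e = lincomb V n a e \<oplus> a n \<odot> e n"
  unfolding lincomb_def lessThan_Suc
  by (subst finsum_insert) (auto simp: a_comm intro!: finsum_closed)

lemma lincomb_cong:
  assumes "\<And>i. i < n \<Longrightarrow> e' i \<in> carrier V" "\<And>i. i < n \<Longrightarrow> a i = a' i" "\<And>i. i < n \<Longrightarrow> e i = e' i"
  shows "lincomb V n a e = lincomb V n a' e'"
  unfolding lincomb_def by (rule finsum_cong') (use assms in auto)

lemma lincomb_split:
  "(\<And>i. i < s + m \<Longrightarrow> e i \<in> carrier V) \<Longrightarrow>
    lincomb V (s + m) a e = lincomb V s a e \<oplus> lincomb V m (\<lambda>i. a (s + i)) (\<lambda>i. e (s + i))"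
  by (induction m) (simp_all add: lincomb_Suc a_assoc)

lemma is_basis_mem: "is_basis V n e \<Longrightarrow> i < n \<Longrightarrow> e i \<in> carrier V"
  by (simp add: is_basis_def)

lemma is_basis_span: "is_basis V n e \<Longrightarrow> x \<in> carrier V \<Longrightarrow> \<exists>a. x = lincomb V n a e"
  unfolding is_basis_def by blast

lemma is_basis_inj:
  assumes "is_basis V n e" "lincomb V n a e = lincomb V n b e" "i < n"
  shows "a i = b i"
proof -
  have r: "lincomb V n (restrict a {..<n}) e = lincomb V n a e" for a
    by (rule lincomb_cong) (use is_basis_mem[OF assms(1)] in auto)
  have mem: "lincomb V n a e \<in> carrier V" by (rule lincomb_closed) (rule is_basis_mem[OF assms(1)])
  have "\<exists>!c. c \<in> {..<n} \<rightarrow>\<^sub>E UNIV \<and> lincomb V n a e = lincomb V n c e"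
    using assms(1) mem unfolding is_basis_def by blast
  moreover have "restrict c {..<n} \<in> {..<n} \<rightarrow>\<^sub>E UNIV" for c :: "nat \<Rightarrow> complex" by auto
  ultimately have "restrict a {..<n} = restrict b {..<n}"
    by (metis r assms(2))
  then show ?thesis using assms(3) by (metis lessThan_iff restrict_apply')
qed

lemma linear_between_zero:
  assumes "linear_between V (carrier V) (carrier V) T"
  shows "T \<zero> = \<zero>"
proof -
  have "T (0 \<odot> \<zero>) = 0 \<odot> T \<zero>" "T \<zero> \<in> carrier V"
    using assms unfolding linear_between_def by blast+
  then show ?thesis by simp
qed

lemma linear_between_lincomb:
  assumes T: "linear_between V (carrier V) (carrier V) T" and e: "\<And>i. i < n \<Longrightarrow> e i \<in> carrier V"
  shows "T (lincomb V n a e) = lincomb V n a (\<lambda>i. T (e i))"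
  using e
proof (induction n)
  case 0
  then show ?case by (simp add: linear_between_zero[OF T])
next
  case (Suc n)
  have T': "T x \<in> carrier V" "T (x \<oplus> y) = T x \<oplus> T y" "T (c \<odot> x) = c \<odot> T x"
    if "x \<in> carrier V" "y \<in> carrier V" for x y c
    using T that unfolding linear_between_def by blast+
  have "T (lincomb V n a e \<oplus> a n \<odot> e n) = lincomb V n a (\<lambda>i. T (e i)) \<oplus> a n \<odot> T (e n)"
    using Suc.IH Suc.prems T'(2)[of "lincomb V n a e" "a n \<odot> e n"] T'(3)[of "e n" "e n" "a n"] by simp
  then show ?case using Suc.prems by (simp add: lincomb_Suc T'(1)[OF _ M.zero_closed])
qed

lemma submodule_subset: "submodule H complex_ring V \<Longrightarrow> x \<in> H \<Longrightarrow> x \<in> carrier V"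
  using submoduleE(1) by blast

lemma submodule_smult: "submodule H complex_ring V \<Longrightarrow> x \<in> H \<Longrightarrow> a \<odot> x \<in> H"
  using submoduleE(4)[of H a x] by simp

lemma submodule_zero: "submodule H complex_ring V \<Longrightarrow> \<zero> \<in> H"
  using submoduleE(2)[of H] submodule_smult[of H _ 0] submodule_subset[of H] by fastforce

lemma submodule_lincomb:
  assumes H: "submodule H complex_ring V" and e: "\<And>i. i < n \<Longrightarrow> e i \<in> H"
  shows "lincomb V n a e \<in> H" and "lincomb (V\<lparr>carrier := H\<rparr>) n a e = lincomb V n a e"
proof -
  have "Module.module complex_ring V" by unfold_locales
  then have "Module.module complex_ring (V\<lparr>carrier := H\<rparr>)"
    by (rule submodule.submodule_is_module[OF H])
  then interpret W: complex_module "V\<lparr>carrier := H\<rparr>" by (simp add: complex_module_def)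
  note H' = submodule_subset[OF H] submodule_smult[OF H] submodule_zero[OF H] submoduleE(5)[OF H]
  have "lincomb V n a e \<in> H \<and> lincomb (V\<lparr>carrier := H\<rparr>) n a e = lincomb V n a e"
    using e
  proof (induction n)
    case 0
    show ?case using W.lincomb_0[of a e] H' by simp
  next
    case (Suc n)
    then show ?case using W.lincomb_Suc[of n e a] lincomb_Suc[of n e a] H' by simp
  qed
  then show "lincomb V n a e \<in> H" "lincomb (V\<lparr>carrier := H\<rparr>) n a e = lincomb V n a e" by auto
qed

end

text \<open>The Gram-Schmidt projection onto the span of \<open>e 0, \<dots>, e (k - 1)\<close>. No independence is
  required: a vanishing residue \<open>u\<close> contributes nothing, since \<open>x / 0 = 0\<close>.\<close>

primrec gs_proj :: "(complex, 'v) module \<Rightarrow> ('v \<Rightarrow> 'v \<Rightarrow> complex) \<Rightarrow> (nat \<Rightarrow> 'v) \<Rightarrow> nat \<Rightarrow> 'v \<Rightarrow> 'v" where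
  "gs_proj V h e 0 = (\<lambda>x. \<zero>\<^bsub>V\<^esub>)"
| "gs_proj V h e (Suc k) = (\<lambda>x. let u = e k \<ominus>\<^bsub>V\<^esub> gs_proj V h e k (e k)
     in gs_proj V h e k x \<oplus>\<^bsub>V\<^esub> (h x u / h u u) \<odot>\<^bsub>V\<^esub> u)"

text \<open>The form \<open>h\<close> is complex linear in the first argument. Finite dimension is not assumed; where it
  matters, a basis or a finite generating family is given.\<close>

locale hermitian_space = complex_module V for V :: "(complex, 'v) module" (structure) +
  fixes h :: "'v \<Rightarrow> 'v \<Rightarrow> complex"
  assumes h_add_left: "\<lbrakk>x \<in> carrier V; y \<in> carrier V; z \<in> carrier V\<rbrakk> \<Longrightarrow> h (x \<oplus> y) z = h x z + h y z"
    and h_smult_left: "\<lbrakk>x \<in> carrier V; z \<in> carrier V\<rbrakk> \<Longrightarrow> h (a \<odot> x) z = a * h x z"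
    and h_sym: "\<lbrakk>x \<in> carrier V; z \<in> carrier V\<rbrakk> \<Longrightarrow> h z x = cnj (h x z)"
    and h_pos: "\<lbrakk>x \<in> carrier V; x \<noteq> \<zero>\<rbrakk> \<Longrightarrow> Re (h x x) > 0"
begin

lemma h_add_right: "\<lbrakk>x \<in> carrier V; y \<in> carrier V; z \<in> carrier V\<rbrakk> \<Longrightarrow> h z (x \<oplus> y) = h z x + h z y"
  using h_sym[of "x \<oplus> y" z] h_sym[of x z] h_sym[of y z] by (simp add: h_add_left)

lemma h_smult_right: "\<lbrakk>x \<in> carrier V; z \<in> carrier V\<rbrakk> \<Longrightarrow> h z (a \<odot> x) = cnj a * h z x"
  using h_sym[of "a \<odot> x" z] h_sym[of x z] by (simp add: h_smult_left)

lemma h_zero_left [simp]: "z \<in> carrier V \<Longrightarrow> h \<zero> z = 0"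
  using h_smult_left[of z z 0] by simp

lemma h_zero_right [simp]: "z \<in> carrier V \<Longrightarrow> h z \<zero> = 0"
  using h_smult_right[of z z 0] by simp

lemma h_minus_left: "\<lbrakk>x \<in> carrier V; y \<in> carrier V; z \<in> carrier V\<rbrakk> \<Longrightarrow> h (x \<ominus> y) z = h x z - h y z"
  by (simp add: a_minus_def neg_eq_smult h_add_left h_smult_left)

lemma h_minus_right: "\<lbrakk>x \<in> carrier V; y \<in> carrier V; z \<in> carrier V\<rbrakk> \<Longrightarrow> h z (x \<ominus> y) = h z x - h z y"
  by (simp add: a_minus_def neg_eq_smult h_add_right h_smult_right)

lemmas h_left = h_add_left h_smult_left h_minus_left
lemmas h_right = h_add_right h_smult_right h_minus_right

lemma h_self_eq_0: "x \<in> carrier V \<Longrightarrow> h x x = 0 \<Longrightarrow> x = \<zero>"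
  using h_pos[of x] by fastforce

text \<open>Vectors are determined by their pairings. This reduces vector identities to identities
  between complex numbers.\<close>

lemma vec_eqI:
  assumes "x \<in> carrier V" "y \<in> carrier V" "\<And>z. z \<in> carrier V \<Longrightarrow> h x z = h y z"
  shows "x = y"
proof -
  have "h (x \<ominus> y) (x \<ominus> y) = 0" using assms by (simp add: h_left)
  then have "x \<ominus> y = \<zero>" using assms by (intro h_self_eq_0) auto
  then show ?thesis by (rule eq_if_minus_zero[OF assms(1,2)])
qed

lemma h_lincomb_left:
  "(\<And>i. i < n \<Longrightarrow> e i \<in> carrier V) \<Longrightarrow> z \<in> carrier V \<Longrightarrow>
     h (lincomb V n a e) z = (\<Sum>i<n. a i * h (e i) z)"
  by (induction n) (simp_all add: lincomb_Suc h_left)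

lemma h_lincomb_right:
  "(\<And>i. i < n \<Longrightarrow> e i \<in> carrier V) \<Longrightarrow> z \<in> carrier V \<Longrightarrow>
     h z (lincomb V n a e) = (\<Sum>i<n. cnj (a i) * h z (e i))"
  by (induction n) (simp_all add: lincomb_Suc h_right)

lemma lincomb_extend:
  assumes "k \<le> n" "\<And>i. i < n \<Longrightarrow> e i \<in> carrier V"
  shows "lincomb V k a e = lincomb V n (\<lambda>i. if i < k then a i else 0) e"
proof (rule vec_eqI)
  fix z assume z: "z \<in> carrier V"
  have "(\<Sum>i<k. a i * h (e i) z) = (\<Sum>i<n. (if i < k then a i else 0) * h (e i) z)"
    by (rule sum.mono_neutral_cong_left) (use assms(1) in auto)
  then show "h (lincomb V k a e) z = h (lincomb V n (\<lambda>i. if i < k then a i else 0) e) z"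
    using assms z by (simp add: h_lincomb_left)
qed (use assms in auto)

lemma lincomb_unit:
  assumes "k < n" "\<And>i. i < n \<Longrightarrow> e i \<in> carrier V"
  shows "e k = lincomb V n (\<lambda>i. if i = k then 1 else 0) e"
proof (rule vec_eqI)
  fix z assume z: "z \<in> carrier V"
  have "(\<Sum>i<n. (if i = k then 1 else 0) * h (e i) z) = (\<Sum>i<n. if i = k then h (e i) z else 0)"
    by (rule sum.cong) auto
  also have "\<dots> = h (e k) z" using assms(1) by simp
  finally show "h (e k) z = h (lincomb V n (\<lambda>i. if i = k then 1 else 0) e) z"
    using assms z by (simp add: h_lincomb_left)
qed (use assms in auto)

lemma gs_proj_closed [simp]:
  "(\<And>i. i < k \<Longrightarrow> e i \<in> carrier V) \<Longrightarrow> x \<in> carrier V \<Longrightarrow> gs_proj V h e k x \<in> carrier V"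
  by (induction k arbitrary: x) (simp_all add: Let_def)

lemma gs_step_lincomb:
  assumes e: "\<And>i. i \<le> k \<Longrightarrow> e i \<in> carrier V"
  shows "lincomb V k a e \<oplus> c \<odot> (e k \<ominus> lincomb V k b e) =
    lincomb V (Suc k) (\<lambda>i. if i < k then a i - c * b i else c) e"
proof (rule vec_eqI)
  have mem: "lincomb V k a e \<in> carrier V" for a using e by simp
  fix z assume z: "z \<in> carrier V"
  have "(\<Sum>i<k. (if i < k then a i - c * b i else c) * h (e i) z) =
      (\<Sum>i<k. a i * h (e i) z) - c * (\<Sum>i<k. b i * h (e i) z)"
    by (simp add: sum_distrib_left sum_subtractf[symmetric] algebra_simps)
  then show "h (lincomb V k a e \<oplus> c \<odot> (e k \<ominus> lincomb V k b e)) z =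
      h (lincomb V (Suc k) (\<lambda>i. if i < k then a i - c * b i else c) e) z"
    using e mem z by (simp add: h_left h_lincomb_left algebra_simps)
qed (use e in auto)

lemma gs_proj_lincomb:
  "(\<And>i. i < k \<Longrightarrow> e i \<in> carrier V) \<Longrightarrow> x \<in> carrier V \<Longrightarrow> \<exists>a. gs_proj V h e k x = lincomb V k a e"
proof (induction k arbitrary: x)
  case (Suc k)
  have e: "\<And>i. i \<le> k \<Longrightarrow> e i \<in> carrier V" using Suc.prems by simp
  obtain a b where ab: "gs_proj V h e k x = lincomb V k a e" "gs_proj V h e k (e k) = lincomb V k b e"
    using Suc.IH[of x] Suc.IH[of "e k"] Suc.prems by force
  have "\<exists>d. lincomb V k a e \<oplus> c \<odot> (e k \<ominus> lincomb V k b e) = lincomb V (Suc k) d e" for c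
    using gs_step_lincomb[of k e a c b] e by blast
  then show ?case by (simp add: Let_def ab)
qed simp

text \<open>The residue \<open>x - gs_proj x\<close> is orthogonal to the family.\<close>

lemma h_gs_proj:
  "(\<And>i. i < k \<Longrightarrow> e i \<in> carrier V) \<Longrightarrow> x \<in> carrier V \<Longrightarrow> i < k \<Longrightarrow>
     h (gs_proj V h e k x) (e i) = h x (e i)"
proof (induction k arbitrary: x i)
  case (Suc k)
  have e: "\<And>i. i < k \<Longrightarrow> e i \<in> carrier V" "e k \<in> carrier V" using Suc.prems by simp_all
  let ?P = "gs_proj V h e k"
  have P: "?P y \<in> carrier V" if "y \<in> carrier V" for y using that e by simp
  have hP: "h (?P y) (?P z) = h y (?P z)" if "y \<in> carrier V" "z \<in> carrier V" for y z
  proof -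
    obtain b where "?P z = lincomb V k b e" using gs_proj_lincomb[of k e z, OF e(1) \<open>z \<in> carrier V\<close>] by blast
    then show ?thesis using e that P Suc.IH[OF e(1)] by (simp add: h_lincomb_right)
  qed
  define u where "u = e k \<ominus> ?P (e k)"
  have u: "u \<in> carrier V" using e P by (simp add: u_def)
  have uP: "h u (?P z) = 0" if "z \<in> carrier V" for z
    using that e P by (simp add: u_def h_left hP)
  have ui: "h u (e j) = 0" if "j < k" for j
    using that e P Suc.IH[OF e(1)] by (simp add: u_def h_left)
  have "h u (e k) = h u u"
    using e P u uP[of "e k"] by (subst (3) u_def) (simp add: h_right)
  moreover have "h (?P x) (e k) = h x (?P (e k))"
  proof -
    have "h (?P x) u = 0" using uP[OF Suc.prems(2)] h_sym[OF u P[OF Suc.prems(2)]] by simp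
    then show ?thesis using e P Suc.prems(2) hP by (simp add: u_def h_right)
  qed
  moreover have "h x u = h x (e k) - h x (?P (e k))"
    using e P Suc.prems(2) by (simp add: u_def h_right)
  moreover have "h u u = 0 \<Longrightarrow> h x u = 0"
    using h_self_eq_0[OF u] Suc.prems(2) by auto
  ultimately have "h (?P x \<oplus> (h x u / h u u) \<odot> u) (e i) = h x (e i)"
    using Suc.prems(2,3) e P u ui Suc.IH[OF e(1) Suc.prems(2)]
    by (cases "i = k") (auto simp: h_left)
  then show ?case by (simp add: u_def Let_def)
qed simp

lemma gs_proj_eq_self:
  assumes "\<And>i. i < k \<Longrightarrow> e i \<in> carrier V" "x = lincomb V k a e"
  shows "gs_proj V h e k x = x"
proof -
  let ?P = "gs_proj V h e k x"
  have x: "x \<in> carrier V" and P: "?P \<in> carrier V" using assms by simp_all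
  obtain b where b: "?P = lincomb V k b e" using gs_proj_lincomb[of k e x] assms(1) x by blast
  have "h (x \<ominus> ?P) x = 0" "h (x \<ominus> ?P) ?P = 0"
    using assms(1) x P by (subst assms(2) b, simp add: h_left h_lincomb_right h_gs_proj)+
  then have "h (x \<ominus> ?P) (x \<ominus> ?P) = 0" using x P by (simp add: h_right)
  then have "x \<ominus> ?P = \<zero>" using x P by (intro h_self_eq_0) auto
  then show ?thesis using eq_if_minus_zero[OF x P] by simp
qed

lemma gs_residue_nonzero:
  assumes "is_basis V n e" "k < n"
  shows "h (e k \<ominus> gs_proj V h e k (e k)) (e k \<ominus> gs_proj V h e k (e k)) \<noteq> 0"
proof
  have e: "\<And>i. i < n \<Longrightarrow> e i \<in> carrier V" using is_basis_mem[OF assms(1)] .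
  then have P: "e k \<in> carrier V" "gs_proj V h e k (e k) \<in> carrier V" using assms(2) by simp_all
  assume "h (e k \<ominus> gs_proj V h e k (e k)) (e k \<ominus> gs_proj V h e k (e k)) = 0"
  then have "e k \<ominus> gs_proj V h e k (e k) = \<zero>" using P by (intro h_self_eq_0) auto
  then have "gs_proj V h e k (e k) = e k" using eq_if_minus_zero[OF P] by simp
  then obtain a where "e k = lincomb V k a e"
    using gs_proj_lincomb[of k e "e k"] e assms(2) by (metis less_trans)
  then have "lincomb V n (\<lambda>i. if i = k then 1 else 0) e = lincomb V n (\<lambda>i. if i < k then a i else 0) e"
    using lincomb_unit[of k n e] lincomb_extend[of k n e a] e assms(2) by simp
  from is_basis_inj[OF assms(1) this assms(2)] show False by simp
qed

text \<open>The adjoint vector is built up one basis vector at a time: a multiple of the \<open>k\<close>-th Gram-Schmidt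
  residue corrects the pairing with \<open>e k\<close> without affecting the earlier ones.\<close>

lemma adjoint_exists:
  assumes "is_basis V n e" and T: "linear_between V (carrier V) (carrier V) T" and x: "x \<in> carrier V"
  shows "\<exists>y\<in>carrier V. \<forall>z\<in>carrier V. h y z = h x (T z)"
proof -
  have e: "\<And>i. i < n \<Longrightarrow> e i \<in> carrier V" using is_basis_mem[OF assms(1)] .
  have T': "T z \<in> carrier V" if "z \<in> carrier V" for z using T that by (simp add: linear_between_def)
  have "k \<le> n \<Longrightarrow> \<exists>y\<in>carrier V. \<forall>i<k. h y (e i) = h x (T (e i))" for k
  proof (induction k)
    case (Suc k)
    then obtain y where y: "y \<in> carrier V" "\<And>i. i < k \<Longrightarrow> h y (e i) = h x (T (e i))" by auto
    have ek: "\<And>i. i < k \<Longrightarrow> e i \<in> carrier V" "e k \<in> carrier V" using Suc.prems e by simp_all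
    define u where "u = e k \<ominus> gs_proj V h e k (e k)"
    have u: "u \<in> carrier V" using ek by (simp add: u_def)
    have ui: "h u (e j) = 0" if "j < k" for j
      using that ek h_gs_proj[of k e "e k" j] by (simp add: u_def h_left)
    obtain b where b: "gs_proj V h e k (e k) = lincomb V k b e"
      using gs_proj_lincomb[of k e "e k"] ek by blast
    have "h u (gs_proj V h e k (e k)) = 0"
      unfolding b using ek u ui by (simp add: h_lincomb_right)
    then have "h u (e k) = h u u"
      using ek u by (subst (3) u_def) (simp add: h_right)
    moreover have "h u u \<noteq> 0" using gs_residue_nonzero[OF assms(1), of k] Suc.prems by (simp add: u_def)
    ultimately have "h (y \<oplus> ((h x (T (e k)) - h y (e k)) / h u u) \<odot> u) (e i) = h x (T (e i))" if "i < Suc k" for i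
      using that y ek u ui by (cases "i = k") (auto simp: h_left)
    then show ?case using y u by blast
  qed auto
  then obtain y where y: "y \<in> carrier V" "\<And>i. i < n \<Longrightarrow> h y (e i) = h x (T (e i))" by blast
  have "h y z = h x (T z)" if "z \<in> carrier V" for z
  proof -
    obtain a where a: "z = lincomb V n a e" using is_basis_span[OF assms(1) \<open>z \<in> carrier V\<close>] by blast
    show ?thesis unfolding a
      using e y x T' by (simp add: linear_between_lincomb[OF T] h_lincomb_right)
  qed
  with y(1) show ?thesis by blast
qed

end


section \<open>Orthogonal decomposition and quotients of hermitian vector spaces\<close>

text \<open>The quotient space with carrier the cosets of \<open>S\<close>, as it occurs in the fibres of a quotient
  bundle, and its inner product transported from the orthogonal complement.\<close>

definition quot_space :: "(complex, 'v) module \<Rightarrow> 'v set \<Rightarrow> (complex, 'v set) module" where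
  "quot_space V S = \<lparr>carrier = a_rcosets\<^bsub>V\<^esub> S, mult = undefined, one = undefined, zero = S,
     add = set_add V, smult = (\<lambda>a X. \<Union>x\<in>X. S +>\<^bsub>V\<^esub> (a \<odot>\<^bsub>V\<^esub> x))\<rparr>"

locale hermitian_subspace = hermitian_space V h
  for V :: "(complex, 'v) module" (structure) and h +
  fixes S :: "'v set"
  assumes submodule: "submodule S complex_ring V"
    and finitely_generated: "\<exists>n e. (\<forall>i<n. e i \<in> S) \<and> (\<forall>x\<in>S. \<exists>a. x = lincomb V n a e)"
begin

text \<open>The orthogonal complement of \<open>S\<close>. Below, \<open>prS\<close> and \<open>prO\<close> are the orthogonal projections to \<open>S\<close>
  and \<open>perp\<close>, \<open>q\<close> is the quotient map, and \<open>lift\<close> the inverse of its restriction to \<open>perp\<close>.\<close>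

definition perp :: "'v set" where
  "perp = {x \<in> carrier V. \<forall>y\<in>S. h x y = 0}"

abbreviation "prS \<equiv> proj_along V S perp"
abbreviation "prO \<equiv> proj_along V perp S"
abbreviation "q \<equiv> (\<lambda>x. S +> x)"
abbreviation "lift \<equiv> inv_into perp q"
abbreviation "Q \<equiv> quot_space V S"

lemma S_carrier [simp]: "x \<in> S \<Longrightarrow> x \<in> carrier V"
  by (rule submodule_subset[OF submodule])

lemma S_add [simp]: "x \<in> S \<Longrightarrow> y \<in> S \<Longrightarrow> x \<oplus> y \<in> S"
  using submoduleE(5)[OF submodule] by blast

lemma S_smult [simp]: "x \<in> S \<Longrightarrow> a \<odot> x \<in> S"
  by (rule submodule_smult[OF submodule])

lemma S_zero [simp]: "\<zero> \<in> S"
  by (rule submodule_zero[OF submodule])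

lemma S_minus [simp]: "x \<in> S \<Longrightarrow> y \<in> S \<Longrightarrow> x \<ominus> y \<in> S"
  by (simp add: a_minus_def neg_eq_smult)

lemma perp_carrier [simp]: "x \<in> perp \<Longrightarrow> x \<in> carrier V"
  unfolding perp_def by simp

lemma h_perp_S [simp]: "x \<in> perp \<Longrightarrow> y \<in> S \<Longrightarrow> h x y = 0"
  unfolding perp_def by simp

lemma h_S_perp [simp]: "x \<in> perp \<Longrightarrow> y \<in> S \<Longrightarrow> h y x = 0"
  using h_sym[of x y] by simp

lemma perp_zero [simp]: "\<zero> \<in> perp"
  unfolding perp_def by simp

lemma perp_add [simp]: "x \<in> perp \<Longrightarrow> y \<in> perp \<Longrightarrow> x \<oplus> y \<in> perp"
  unfolding perp_def by (simp add: h_left)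

lemma perp_smult [simp]: "x \<in> perp \<Longrightarrow> a \<odot> x \<in> perp"
  unfolding perp_def by (simp add: h_left)

lemma perp_minus [simp]: "x \<in> perp \<Longrightarrow> y \<in> perp \<Longrightarrow> x \<ominus> y \<in> perp"
  unfolding perp_def by (simp add: h_left)

lemma S_Int_perp: "x \<in> S \<Longrightarrow> x \<in> perp \<Longrightarrow> x = \<zero>"
  using h_self_eq_0[of x] by simp

lemma proj_eq:
  assumes "a \<in> S" "b \<in> perp"
  shows "prS (a \<oplus> b) = a" and "prO (a \<oplus> b) = b"
proof -
  have uniq: "a' = a \<and> b' = b" if "a' \<in> S" "b' \<in> perp" "a \<oplus> b = a' \<oplus> b'" for a' b'
  proof -
    have "h (a' \<ominus> a) z = h (b \<ominus> b') z" if "z \<in> carrier V" for z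
    proof -
      have "h (a \<oplus> b) z = h (a' \<oplus> b') z" using \<open>a \<oplus> b = a' \<oplus> b'\<close> by simp
      then show ?thesis using that assms \<open>a' \<in> S\<close> \<open>b' \<in> perp\<close> by (simp add: h_left algebra_simps)
    qed
    then have eq: "a' \<ominus> a = b \<ominus> b'" using assms that by (intro vec_eqI) auto
    have "a' \<ominus> a \<in> perp" unfolding eq using assms that by simp
    then have "a' \<ominus> a = \<zero>" using S_Int_perp[of "a' \<ominus> a"] assms that by simp
    with eq have "b \<ominus> b' = \<zero>" by simp
    with \<open>a' \<ominus> a = \<zero>\<close> show ?thesis
      using eq_if_minus_zero[of a' a] eq_if_minus_zero[of b b'] assms that by simp
  qed
  show "prS (a \<oplus> b) = a"
    unfolding proj_along_def by (rule the_equality) (use assms uniq in blast)+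
  have "a \<oplus> b = b \<oplus> a" using assms by (simp add: a_comm)
  moreover have "b' = b" if "b' \<in> perp" "a' \<in> S" "a \<oplus> b = b' \<oplus> a'" for a' b'
    using uniq[OF that(2,1)] that by (simp add: a_comm)
  ultimately show "prO (a \<oplus> b) = b"
    unfolding proj_along_def by (intro the_equality) (use assms in blast)+
qed

lemma gs_proj_decomp:
  assumes gen: "\<And>i. i < n \<Longrightarrow> e i \<in> S" "\<And>x. x \<in> S \<Longrightarrow> \<exists>a. x = lincomb V n a e"
    and x: "x \<in> carrier V"
  shows "prS x = gs_proj V h e n x" "prS x \<in> S" "prO x \<in> perp" "x = prS x \<oplus> prO x"
proof -
  have e: "\<And>i. i < n \<Longrightarrow> e i \<in> carrier V" using gen by simp
  let ?a = "gs_proj V h e n x"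
  obtain c where "?a = lincomb V n c e" using gs_proj_lincomb[of n e x, OF e x] by blast
  then have a: "?a \<in> S" using submodule_lincomb(1)[OF submodule, of n e c] gen by simp
  have "h (x \<ominus> ?a) y = 0" if "y \<in> S" for y
  proof -
    obtain d where d: "y = lincomb V n d e" using gen(2)[OF \<open>y \<in> S\<close>] by blast
    have "h (x \<ominus> ?a) (e i) = 0" if "i < n" for i
      using h_gs_proj[of n e x i, OF e x that] e that a x by (simp add: h_left)
    then show ?thesis unfolding d using e a x by (simp add: h_lincomb_right)
  qed
  then have b: "x \<ominus> ?a \<in> perp" using a x unfolding perp_def by simp
  have "x = ?a \<oplus> (x \<ominus> ?a)" using a x by (intro vec_eqI) (auto simp: h_left)
  then show "prS x = ?a" "prS x \<in> S" "prO x \<in> perp" "x = prS x \<oplus> prO x"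
    using proj_eq[OF a b] a b by auto
qed

lemma decomp:
  assumes "x \<in> carrier V"
  shows "prS x \<in> S" "prO x \<in> perp" "x = prS x \<oplus> prO x"
  using finitely_generated gs_proj_decomp[OF _ _ assms] by meson+

lemma proj_mem [simp]:
  "x \<in> carrier V \<Longrightarrow> prS x \<in> S" "x \<in> carrier V \<Longrightarrow> prO x \<in> perp"
  using decomp by auto

lemma proj_id:
  "x \<in> S \<Longrightarrow> prS x = x" "x \<in> S \<Longrightarrow> prO x = \<zero>" "x \<in> perp \<Longrightarrow> prS x = \<zero>" "x \<in> perp \<Longrightarrow> prO x = x"
  using proj_eq[of x \<zero>] proj_eq[of \<zero> x] by auto

lemma proj_add:
  assumes "x \<in> carrier V" "y \<in> carrier V"
  shows "prS (x \<oplus> y) = prS x \<oplus> prS y" "prO (x \<oplus> y) = prO x \<oplus> prO y"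
proof -
  have "x \<oplus> y = (prS x \<oplus> prO x) \<oplus> (prS y \<oplus> prO y)" using decomp(3) assms by simp
  also have "\<dots> = (prS x \<oplus> prS y) \<oplus> (prO x \<oplus> prO y)"
    using assms by (intro vec_eqI) (auto simp: h_left)
  finally show "prS (x \<oplus> y) = prS x \<oplus> prS y" "prO (x \<oplus> y) = prO x \<oplus> prO y"
    using proj_eq[of "prS x \<oplus> prS y" "prO x \<oplus> prO y"] assms by simp_all
qed

lemma proj_smult:
  assumes "x \<in> carrier V"
  shows "prS (a \<odot> x) = a \<odot> prS x" "prO (a \<odot> x) = a \<odot> prO x"
proof -
  have "a \<odot> x = a \<odot> (prS x \<oplus> prO x)" using decomp(3) assms by simp
  also have "\<dots> = a \<odot> prS x \<oplus> a \<odot> prO x" using assms by (simp add: smult_add_right)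
  finally show "prS (a \<odot> x) = a \<odot> prS x" "prO (a \<odot> x) = a \<odot> prO x"
    using proj_eq[of "a \<odot> prS x" "a \<odot> prO x"] assms by simp_all
qed

lemma prO_eq: "x \<in> carrier V \<Longrightarrow> prO x = x \<oplus> (- 1) \<odot> prS x"
proof (rule vec_eqI)
  fix z assume "x \<in> carrier V" "z \<in> carrier V"
  then have "h x z = h (prS x) z + h (prO x) z"
    by (subst decomp(3)) (simp_all add: h_left)
  then show "h (prO x) z = h (x \<oplus> (- 1) \<odot> prS x) z"
    using \<open>x \<in> carrier V\<close> \<open>z \<in> carrier V\<close> by (simp add: h_left)
qed auto

lemma mem_S_if_prO_zero:
  assumes "x \<in> carrier V" "prO x = \<zero>"
  shows "x \<in> S"
proof -
  have "x = prS x" using decomp(3)[OF assms(1)] decomp(1)[OF assms(1)] assms(2) by simp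
  then show ?thesis using decomp(1)[OF assms(1)] by simp
qed

lemma S_eqI:
  assumes "x \<in> S" "y \<in> S" "\<And>z. z \<in> S \<Longrightarrow> h x z = h y z"
  shows "x = y"
proof -
  have "x \<ominus> y \<in> perp" using assms unfolding perp_def by (simp add: h_left)
  then have "x \<ominus> y = \<zero>" using assms by (intro S_Int_perp) auto
  then show ?thesis by (rule eq_if_minus_zero[rotated 2]) (use assms in auto)
qed

lemma h_prO_left: "x \<in> carrier V \<Longrightarrow> y \<in> perp \<Longrightarrow> h (prO x) y = h x y"
  by (subst (2) decomp(3)) (simp_all add: h_left)

lemma h_prO_right: "x \<in> carrier V \<Longrightarrow> y \<in> perp \<Longrightarrow> h y (prO x) = h y x"
  using h_sym[of "prO x" y] h_sym[of x y] by (simp add: h_prO_left)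

lemma h_prS_left: "x \<in> carrier V \<Longrightarrow> y \<in> S \<Longrightarrow> h (prS x) y = h x y"
  by (subst (2) decomp(3)) (simp_all add: h_left)


lemma abelian_subgroup: "abelian_subgroup S V"
  by (intro abelian_subgroupI3 additive_subgroupI submodule.axioms(1)[OF submodule]) unfold_locales

lemma q_eq_iff:
  assumes "x \<in> carrier V" "y \<in> carrier V"
  shows "q x = q y \<longleftrightarrow> prO x = prO y"
proof -
  interpret abelian_subgroup S V by (rule abelian_subgroup)
  have "q x = q y \<longleftrightarrow> y \<in> q x"
    using a_repr_independence' a_repr_independenceD assms by metis
  also have "\<dots> \<longleftrightarrow> y \<ominus> x \<in> S"
    using a_rcos_module[OF assms] by (simp add: a_minus_def)
  also have "\<dots> \<longleftrightarrow> prO x = prO y"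
  proof
    assume a: "y \<ominus> x \<in> S"
    have "y = x \<oplus> (y \<ominus> x)" using assms by (intro vec_eqI) (auto simp: h_left)
    then have "prO y = prO x \<oplus> prO (y \<ominus> x)" using proj_add(2)[of x "y \<ominus> x"] assms by simp
    then show "prO x = prO y" using a assms by (simp add: proj_id)
  next
    assume a: "prO x = prO y"
    have "h (y \<ominus> x) z = h (prS y \<ominus> prS x) z" if "z \<in> carrier V" for z
      using assms that decomp(3)[of x] decomp(3)[of y] a
      by (metis (no_types, lifting) S_carrier add_diff_cancel_right perp_carrier h_add_left h_minus_left proj_mem)
    then have "y \<ominus> x = prS y \<ominus> prS x" using assms by (intro vec_eqI) auto
    then show "y \<ominus> x \<in> S" using assms by simp
  qed
  finally show ?thesis .
qed

lemma carrier_Q: "carrier Q = q ` carrier V"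
  by (auto simp: quot_space_def A_RCOSETS_def RCOSETS_def a_r_coset_def)

lemma q_closed [simp]: "x \<in> carrier V \<Longrightarrow> q x \<in> carrier Q"
  by (simp add: carrier_Q)

lemma q_self: "x \<in> carrier V \<Longrightarrow> x \<in> q x"
  using abelian_subgroup.a_rcos_self[OF abelian_subgroup] .

lemma q_prO: "x \<in> carrier V \<Longrightarrow> q (prO x) = q x"
  by (simp add: q_eq_iff proj_id)

lemma q_mem_eq: "x \<in> carrier V \<Longrightarrow> y \<in> q x \<Longrightarrow> y \<in> carrier V \<and> q y = q x"
  using abelian_subgroup.a_elemrcos_carrier[OF abelian_subgroup]
    abelian_subgroup.a_repr_independence'[OF abelian_subgroup] by metis

text \<open>A union of cosets which all coincide, as used to define operations on cosets.\<close>

lemma q_Union: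
  assumes "x \<in> carrier V" "\<And>y. y \<in> carrier V \<Longrightarrow> q y = q x \<Longrightarrow> q (f y) = q (f x)"
  shows "(\<Union>y\<in>q x. q (f y)) = q (f x)"
  using q_self[OF assms(1)] q_mem_eq[OF assms(1)] assms(2) by blast

lemma q_add: "x \<in> carrier V \<Longrightarrow> y \<in> carrier V \<Longrightarrow> q x \<oplus>\<^bsub>Q\<^esub> q y = q (x \<oplus> y)"
  using abelian_subgroup.a_rcos_sum[OF abelian_subgroup] by (simp add: quot_space_def)

lemma q_smult: "x \<in> carrier V \<Longrightarrow> a \<odot>\<^bsub>Q\<^esub> q x = q (a \<odot> x)"
  using q_Union[of x "\<lambda>y. a \<odot> y"] by (simp add: quot_space_def q_eq_iff proj_smult)

lemma q_zero: "\<zero>\<^bsub>Q\<^esub> = q \<zero>"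
  using abelian_subgroup.a_rcos_const[OF abelian_subgroup S_zero] by (simp add: quot_space_def)

lemma q_inj_on: "inj_on q perp"
  by (rule inj_onI) (simp add: q_eq_iff proj_id)

lemma lift_q: "x \<in> carrier V \<Longrightarrow> lift (q x) = prO x"
  using inv_into_f_f[OF q_inj_on, of "prO x"] by (simp add: q_prO)

lemma lift_mem [simp]: "X \<in> carrier Q \<Longrightarrow> lift X \<in> perp"
  by (auto simp: carrier_Q lift_q)

lemma q_lift: "X \<in> carrier Q \<Longrightarrow> q (lift X) = X"
  by (auto simp: carrier_Q lift_q q_prO)

lemma quot_complex_module: "complex_module Q"
proof -
  have el: "\<exists>x\<in>carrier V. X = q x" if "X \<in> carrier Q" for X using that by (auto simp: carrier_Q)
  have "abelian_group Q"
  proof (rule abelian_groupI)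
    fix X Y assume "X \<in> carrier Q" "Y \<in> carrier Q"
    with el obtain x y where "x \<in> carrier V" "y \<in> carrier V" "X = q x" "Y = q y" by meson
    then show "X \<oplus>\<^bsub>Q\<^esub> Y \<in> carrier Q" "X \<oplus>\<^bsub>Q\<^esub> Y = Y \<oplus>\<^bsub>Q\<^esub> X"
      by (auto simp: q_add a_comm)
  next
    fix X Y Z assume "X \<in> carrier Q" "Y \<in> carrier Q" "Z \<in> carrier Q"
    with el obtain x y z where "x \<in> carrier V" "y \<in> carrier V" "z \<in> carrier V" "X = q x" "Y = q y" "Z = q z"
      by meson
    then show "(X \<oplus>\<^bsub>Q\<^esub> Y) \<oplus>\<^bsub>Q\<^esub> Z = X \<oplus>\<^bsub>Q\<^esub> (Y \<oplus>\<^bsub>Q\<^esub> Z)"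
      by (auto simp: q_add a_assoc)
  next
    fix X assume "X \<in> carrier Q"
    with el obtain x where x: "x \<in> carrier V" "X = q x" by meson
    then show "\<zero>\<^bsub>Q\<^esub> \<oplus>\<^bsub>Q\<^esub> X = X" by (simp add: q_zero q_add)
    have "q (\<ominus> x) \<oplus>\<^bsub>Q\<^esub> X = \<zero>\<^bsub>Q\<^esub>" using x by (simp add: q_zero q_add l_neg)
    then show "\<exists>Y\<in>carrier Q. Y \<oplus>\<^bsub>Q\<^esub> X = \<zero>\<^bsub>Q\<^esub>" using x by (meson a_inv_closed q_closed)
  qed (simp add: q_zero)
  moreover have "cring complex_ring" by unfold_locales
  ultimately have "Module.module complex_ring Q"
  proof (intro moduleI)
    fix a b :: complex and X assume "X \<in> carrier Q"
    with el obtain x where "x \<in> carrier V" "X = q x" by meson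
    then show "a \<odot>\<^bsub>Q\<^esub> X \<in> carrier Q" "(a \<oplus>\<^bsub>complex_ring\<^esub> b) \<odot>\<^bsub>Q\<^esub> X = a \<odot>\<^bsub>Q\<^esub> X \<oplus>\<^bsub>Q\<^esub> b \<odot>\<^bsub>Q\<^esub> X"
      "(a \<otimes>\<^bsub>complex_ring\<^esub> b) \<odot>\<^bsub>Q\<^esub> X = a \<odot>\<^bsub>Q\<^esub> (b \<odot>\<^bsub>Q\<^esub> X)" "\<one>\<^bsub>complex_ring\<^esub> \<odot>\<^bsub>Q\<^esub> X = X"
      by (simp_all add: q_smult q_add smult_add_left smult_smult)
  next
    fix a :: complex and X Y assume "X \<in> carrier Q" "Y \<in> carrier Q"
    with el obtain x y where "x \<in> carrier V" "y \<in> carrier V" "X = q x" "Y = q y" by meson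
    then show "a \<odot>\<^bsub>Q\<^esub> (X \<oplus>\<^bsub>Q\<^esub> Y) = a \<odot>\<^bsub>Q\<^esub> X \<oplus>\<^bsub>Q\<^esub> a \<odot>\<^bsub>Q\<^esub> Y"
      by (simp add: q_smult q_add smult_add_right)
  qed
  then show ?thesis by (simp add: complex_module_def)
qed

lemma lift_add: "X \<in> carrier Q \<Longrightarrow> Y \<in> carrier Q \<Longrightarrow> lift (X \<oplus>\<^bsub>Q\<^esub> Y) = lift X \<oplus> lift Y"
  by (auto simp: carrier_Q q_add lift_q proj_add)

lemma lift_smult: "X \<in> carrier Q \<Longrightarrow> lift (a \<odot>\<^bsub>Q\<^esub> X) = a \<odot> lift X"
  by (auto simp: carrier_Q q_smult lift_q proj_smult)

lemma quot_hermitian_space: "hermitian_space Q (\<lambda>X Y. h (lift X) (lift Y))"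
proof -
  interpret Q: complex_module Q by (rule quot_complex_module)
  show ?thesis
  proof (unfold_locales, goal_cases)
    case (4 X)
    have "lift X \<noteq> \<zero>" using 4 q_lift[of X] q_zero by metis
    then show ?case using 4 h_pos[of "lift X"] by simp
  next
    case (3 X Y)
    then show ?case using h_sym[of "lift X" "lift Y"] by simp
  qed (simp_all add: lift_add lift_smult h_left)
qed

lemma q_lincomb:
  assumes "\<And>i. i < k \<Longrightarrow> f i \<in> carrier V"
  shows "q (lincomb V k a f) = lincomb Q k a (\<lambda>i. q (f i))"
proof -
  interpret Q: complex_module Q by (rule quot_complex_module)
  show ?thesis using assms
  proof (induction k)
    case (Suc k)
    then show ?case by (simp add: lincomb_Suc Q.lincomb_Suc q_add[symmetric] q_smult[symmetric])
  qed (simp add: q_zero)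
qed

text \<open>Members of the family that lie in \<open>S\<close> disappear in the quotient.\<close>

lemma q_lincomb_split:
  assumes "\<And>i. i < s \<Longrightarrow> f i \<in> S" "\<And>i. i < s + m \<Longrightarrow> f i \<in> carrier V"
  shows "q (lincomb V (s + m) a f) = lincomb Q m (\<lambda>i. a (s + i)) (\<lambda>i. q (f (s + i)))"
proof -
  have "lincomb V (s + m) a f = lincomb V s a f \<oplus> lincomb V m (\<lambda>i. a (s + i)) (\<lambda>i. f (s + i))"
    using assms(2) by (rule lincomb_split)
  moreover have "lincomb V s a f \<in> S" using submodule_lincomb(1)[OF submodule] assms(1) by blast
  ultimately have "q (lincomb V (s + m) a f) = q (lincomb V m (\<lambda>i. a (s + i)) (\<lambda>i. f (s + i)))"
    using assms(2) by (simp add: q_eq_iff proj_add proj_id)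
  then show ?thesis using assms(2) by (simp add: q_lincomb)
qed

end


section \<open>Smooth sections of a hermitian holomorphic bundle\<close>

locale hermitian_bundle = complex_mfd_t2 M for M :: "('m::t2_space, 'n::finite) cmanifold" +
  fixes E :: "('m, 'v) vbundle" and h :: "'m \<Rightarrow> 'v \<Rightarrow> 'v \<Rightarrow> complex"
  assumes holo_bundle: "holo_bundle M E" and hermitian_metric: "hermitian_metric M E h"
begin

lemma fibre_hermitian_space: "hermitian_space (fibre E p) (h p)"
proof -
  have "complex_module (fibre E p)"
    using holo_bundle by (simp add: holo_bundle_def complex_module_def)
  then interpret complex_module "fibre E p" .
  note H = hermitian_metric[unfolded hermitian_metric_def]
  note H1 = H[THEN conjunct1, rule_format] and H2 = H[THEN conjunct2, THEN conjunct1, rule_format]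
    and H3 = H[THEN conjunct2, THEN conjunct2, THEN conjunct1, rule_format]
    and H4 = H[THEN conjunct2, THEN conjunct2, THEN conjunct2, THEN conjunct1, rule_format]
  show ?thesis by unfold_locales (rule H1 H2 H3 H4; assumption)+
qed

sublocale F: hermitian_space "fibre E p" "h p" for p
  by (rule fibre_hermitian_space)

lemma frames_holo_frame: "(U, n, e) \<in> frames E \<Longrightarrow> holo_frame M E U n e"
  using holo_bundle by (auto simp: holo_bundle_def)

lemma frames_cover: "\<exists>U n e. (U, n, e) \<in> frames E \<and> p \<in> U"
proof -
  have "\<exists>(U, n, e)\<in>frames E. p \<in> U" using holo_bundle by (simp add: holo_bundle_def)
  then show ?thesis by blast
qed

lemma frame_gram:
  assumes "(U, n, e) \<in> frames E" "i < n" "j < n"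
  shows "smooth_fun_on M U (\<lambda>p. h p (e i p) (e j p))"
proof -
  have "\<forall>(U, n, e)\<in>frames E. \<forall>i<n. \<forall>j<n. smooth_fun_on M U (\<lambda>p. h p (e i p) (e j p))"
    using hermitian_metric unfolding hermitian_metric_def by (elim conjE)
  from bspec[OF this assms(1)] show ?thesis using assms(2,3) by simp
qed

lemma holo_frameD:
  assumes "holo_frame M E U n e"
  shows "open U" "i < n \<Longrightarrow> holo_section_on M E U (e i)" "p \<in> U \<Longrightarrow> is_basis (fibre E p) n (\<lambda>i. e i p)"
    "p \<in> U \<Longrightarrow> i < n \<Longrightarrow> e i p \<in> fib E p"
  using assms F.is_basis_mem unfolding holo_frame_def by blast+

lemma smooth_section_frame_coeffs:
  assumes "smooth_section_on M E W \<sigma>" "(U, n, e) \<in> frames E"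
  obtains a where "\<And>i. i < n \<Longrightarrow> smooth_fun_on M (U \<inter> W) (a i)"
    "\<And>p. p \<in> U \<Longrightarrow> p \<in> W \<Longrightarrow> \<sigma> p = lincomb (fibre E p) n (\<lambda>i. a i p) (\<lambda>i. e i p)"
proof -
  have "\<exists>a. (\<forall>i<n. smooth_fun_on M (U \<inter> W) (a i)) \<and>
      (\<forall>p\<in>U \<inter> W. \<sigma> p = lincomb (fibre E p) n (\<lambda>i. a i p) (\<lambda>i. e i p))"
    using bspec[OF assms(1)[unfolded smooth_section_on_def] assms(2)] by simp
  then show thesis using that by auto
qed

lemma smooth_section_mem:
  assumes "smooth_section_on M E W \<sigma>" "p \<in> W"
  shows "\<sigma> p \<in> fib E p"
proof -
  obtain U n e where U: "(U, n, e) \<in> frames E" "p \<in> U" using frames_cover by blast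
  obtain a where "\<sigma> p = lincomb (fibre E p) n (\<lambda>i. a i p) (\<lambda>i. e i p)"
    using smooth_section_frame_coeffs[OF assms(1) U(1)] U(2) assms(2) by metis
  then show ?thesis using holo_frameD(4)[OF frames_holo_frame[OF U(1)] U(2)] by simp
qed

lemma holo_section_imp_smooth: "holo_section_on M E W \<sigma> \<Longrightarrow> smooth_section_on M E W \<sigma>"
  unfolding holo_section_on_def smooth_section_on_def using holo_imp_smooth_fun_on by fast

text \<open>The Gram-Schmidt process with parameters: if all pairings are smooth, then so are the
  coefficients of the projection. It replaces the inversion of Gram and transition matrices.\<close>

lemma gs_proj_smooth_coeffs:
  assumes W: "open W"
    and basis: "\<And>p. p \<in> W \<Longrightarrow> is_basis (fibre E p) n (\<lambda>i. e i p)"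
    and gram: "\<And>i j. i < n \<Longrightarrow> j < n \<Longrightarrow> smooth_fun_on M W (\<lambda>p. h p (e i p) (e j p))"
  shows "k \<le> n \<Longrightarrow> (\<And>p. p \<in> W \<Longrightarrow> \<sigma> p \<in> fib E p) \<Longrightarrow>
    (\<And>i. i < k \<Longrightarrow> smooth_fun_on M W (\<lambda>p. h p (\<sigma> p) (e i p))) \<Longrightarrow>
    \<exists>a. (\<forall>i<k. smooth_fun_on M W (a i)) \<and>
      (\<forall>p\<in>W. gs_proj (fibre E p) (h p) (\<lambda>i. e i p) k (\<sigma> p) = lincomb (fibre E p) k (\<lambda>i. a i p) (\<lambda>i. e i p))"
proof (induction k arbitrary: \<sigma>)
  case 0
  then show ?case by simp
next
  case (Suc k)
  have e: "e i p \<in> fib E p" if "p \<in> W" "i \<le> k" for i p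
    using F.is_basis_mem[OF basis[OF that(1)]] that(2) Suc.prems(1) by simp
  have "\<exists>a. (\<forall>i<k. smooth_fun_on M W (a i)) \<and>
      (\<forall>p\<in>W. gs_proj (fibre E p) (h p) (\<lambda>i. e i p) k (\<sigma> p) = lincomb (fibre E p) k (\<lambda>i. a i p) (\<lambda>i. e i p))"
    by (rule Suc.IH) (use Suc.prems in auto)
  then obtain a where a: "\<And>i. i < k \<Longrightarrow> smooth_fun_on M W (a i)"
    "\<And>p. p \<in> W \<Longrightarrow> gs_proj (fibre E p) (h p) (\<lambda>i. e i p) k (\<sigma> p) = lincomb (fibre E p) k (\<lambda>i. a i p) (\<lambda>i. e i p)"
    by auto
  have "\<exists>b. (\<forall>i<k. smooth_fun_on M W (b i)) \<and>
      (\<forall>p\<in>W. gs_proj (fibre E p) (h p) (\<lambda>i. e i p) k (e k p) = lincomb (fibre E p) k (\<lambda>i. b i p) (\<lambda>i. e i p))"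
    by (rule Suc.IH) (use Suc.prems(1) e gram in auto)
  then obtain b where b: "\<And>i. i < k \<Longrightarrow> smooth_fun_on M W (b i)"
    "\<And>p. p \<in> W \<Longrightarrow> gs_proj (fibre E p) (h p) (\<lambda>i. e i p) k (e k p) = lincomb (fibre E p) k (\<lambda>i. b i p) (\<lambda>i. e i p)"
    by auto
  define u where "u = (\<lambda>p. e k p \<ominus>\<^bsub>fibre E p\<^esub> lincomb (fibre E p) k (\<lambda>i. b i p) (\<lambda>i. e i p))"
  have u: "u p \<in> fib E p" if "p \<in> W" for p using e that by (simp add: u_def)
  have pair_u: "smooth_fun_on M W (\<lambda>p. h p (\<tau> p) (u p))"
    if t: "\<And>p. p \<in> W \<Longrightarrow> \<tau> p \<in> fib E p" "\<And>i. i \<le> k \<Longrightarrow> smooth_fun_on M W (\<lambda>p. h p (\<tau> p) (e i p))" for \<tau>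
  proof (rule smooth_fun_on_cong[OF _ W])
    show "smooth_fun_on M W (\<lambda>p. h p (\<tau> p) (e k p) - (\<Sum>i<k. cnj (b i p) * h p (\<tau> p) (e i p)))"
      by (intro smooth_fun_on_diff smooth_fun_on_sum smooth_fun_on_mult smooth_fun_on_cnj W b t(2)) auto
    show "h p (\<tau> p) (e k p) - (\<Sum>i<k. cnj (b i p) * h p (\<tau> p) (e i p)) = h p (\<tau> p) (u p)" if "p \<in> W" for p
      using e[OF that] t(1)[OF that] by (simp add: u_def F.h_right F.h_lincomb_right)
  qed
  have "smooth_fun_on M W (\<lambda>p. h p (u p) (e i p))" if "i \<le> k" for i
  proof (rule smooth_fun_on_cong[OF _ W])
    show "smooth_fun_on M W (\<lambda>p. cnj (h p (e i p) (u p)))"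
      by (intro smooth_fun_on_cnj W pair_u) (use e gram that Suc.prems(1) in auto)
    show "cnj (h p (e i p) (u p)) = h p (u p) (e i p)" if "p \<in> W" for p
      using F.h_sym[OF e[OF that \<open>i \<le> k\<close>] u[OF that]] by simp
  qed
  then have uu: "smooth_fun_on M W (\<lambda>p. h p (u p) (u p))" by (intro pair_u u)
  have uu0: "h p (u p) (u p) \<noteq> 0" if "p \<in> W" for p
    using F.gs_residue_nonzero[OF basis[OF that], of k] Suc.prems(1) b(2)[OF that] by (simp add: u_def)
  define c where "c = (\<lambda>p. h p (\<sigma> p) (u p) / h p (u p) (u p))"
  have c: "smooth_fun_on M W c" unfolding c_def
    by (intro smooth_fun_on_divide W pair_u uu uu0) (use Suc.prems in auto)
  let ?d = "\<lambda>i p. if i < k then a i p - c p * b i p else c p"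
  have "smooth_fun_on M W (?d i)" if "i < Suc k" for i
    using that by (cases "i < k") (auto intro!: smooth_fun_on_diff smooth_fun_on_mult W a b c)
  moreover have "gs_proj (fibre E p) (h p) (\<lambda>i. e i p) (Suc k) (\<sigma> p) =
      lincomb (fibre E p) (Suc k) (\<lambda>i. ?d i p) (\<lambda>i. e i p)" if "p \<in> W" for p
    using F.gs_step_lincomb[of k "\<lambda>i. e i p" p "\<lambda>i. a i p" "c p" "\<lambda>i. b i p"] e[OF that] a(2)[OF that] b(2)[OF that]
    by (simp add: Let_def c_def u_def)
  ultimately show ?case by (intro exI[of _ ?d]) blast
qed

lemma smooth_section_pair_frame:
  assumes "open W" "smooth_section_on M E W \<sigma>" "(U, n, e) \<in> frames E" "i < n"
  shows "smooth_fun_on M (U \<inter> W) (\<lambda>p. h p (\<sigma> p) (e i p))"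
proof -
  note fr = holo_frameD[OF frames_holo_frame[OF assms(3)]]
  obtain a where a: "\<And>i. i < n \<Longrightarrow> smooth_fun_on M (U \<inter> W) (a i)"
    "\<And>p. p \<in> U \<Longrightarrow> p \<in> W \<Longrightarrow> \<sigma> p = lincomb (fibre E p) n (\<lambda>i. a i p) (\<lambda>i. e i p)"
    using smooth_section_frame_coeffs[OF assms(2,3)] by blast
  have g: "smooth_fun_on M (U \<inter> W) (\<lambda>p. h p (e j p) (e i p))" if "j < n" for j
    using smooth_fun_on_subset[OF frame_gram[OF assms(3) that assms(4)]] by blast
  have UW: "open (U \<inter> W)" using fr(1) assms(1) by blast
  show ?thesis
  proof (rule smooth_fun_on_cong[OF _ UW])
    show "smooth_fun_on M (U \<inter> W) (\<lambda>p. \<Sum>j<n. a j p * h p (e j p) (e i p))"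
      by (intro smooth_fun_on_sum smooth_fun_on_mult UW a g)
    show "(\<Sum>j<n. a j p * h p (e j p) (e i p)) = h p (\<sigma> p) (e i p)" if "p \<in> U \<inter> W" for p
      using that a(2)[of p] fr(4)[of p] assms(4) by (simp add: F.h_lincomb_left)
  qed
qed

lemma smooth_section_pair:
  assumes "open W" "smooth_section_on M E W \<sigma>" "smooth_section_on M E W \<tau>"
  shows "smooth_fun_on M W (\<lambda>p. h p (\<sigma> p) (\<tau> p))"
proof (rule smooth_fun_on_local[OF assms(1)])
  fix p assume "p \<in> W"
  obtain U n e where U: "(U, n, e) \<in> frames E" "p \<in> U" using frames_cover by blast
  note fr = holo_frameD[OF frames_holo_frame[OF U(1)]]
  have UW: "open (U \<inter> W)" using fr(1) assms(1) by blast
  obtain a where a: "\<And>i. i < n \<Longrightarrow> smooth_fun_on M (U \<inter> W) (a i)"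
    "\<And>p. p \<in> U \<Longrightarrow> p \<in> W \<Longrightarrow> \<tau> p = lincomb (fibre E p) n (\<lambda>i. a i p) (\<lambda>i. e i p)"
    using smooth_section_frame_coeffs[OF assms(3) U(1)] by blast
  have "smooth_fun_on M (U \<inter> W) (\<lambda>p. h p (\<sigma> p) (\<tau> p))"
  proof (rule smooth_fun_on_cong[OF _ UW])
    show "smooth_fun_on M (U \<inter> W) (\<lambda>p. \<Sum>j<n. cnj (a j p) * h p (\<sigma> p) (e j p))"
      by (intro smooth_fun_on_sum smooth_fun_on_mult smooth_fun_on_cnj UW a
          smooth_section_pair_frame[OF assms(1,2) U(1)])
    show "(\<Sum>j<n. cnj (a j p) * h p (\<sigma> p) (e j p)) = h p (\<sigma> p) (\<tau> p)" if "p \<in> U \<inter> W" for p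
      using that a(2)[of p] fr(4)[of p] smooth_section_mem[OF assms(2), of p] by (simp add: F.h_lincomb_right)
  qed
  with UW \<open>p \<in> W\<close> U(2) show "\<exists>N. open N \<and> p \<in> N \<and> smooth_fun_on M N (\<lambda>p. h p (\<sigma> p) (\<tau> p))" by blast
qed

text \<open>Smoothness of a section can be tested by pairing with the local frames. All closure properties
  of smooth sections follow from this.\<close>

lemma smooth_section_onI:
  assumes W: "open W" and mem: "\<And>p. p \<in> W \<Longrightarrow> \<sigma> p \<in> fib E p"
    and pair: "\<And>U n e i. (U, n, e) \<in> frames E \<Longrightarrow> i < n \<Longrightarrow> smooth_fun_on M (U \<inter> W) (\<lambda>p. h p (\<sigma> p) (e i p))"
  shows "smooth_section_on M E W \<sigma>"
  unfolding smooth_section_on_def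
proof clarify
  fix U n e assume U: "(U, n, e) \<in> frames E"
  note fr = holo_frameD[OF frames_holo_frame[OF U]]
  have UW: "open (U \<inter> W)" using fr(1) W by blast
  have gram: "smooth_fun_on M (U \<inter> W) (\<lambda>p. h p (e i p) (e j p))" if "i < n" "j < n" for i j
    using smooth_fun_on_subset[OF frame_gram[OF U that]] by blast
  have "\<exists>a. (\<forall>i<n. smooth_fun_on M (U \<inter> W) (a i)) \<and> (\<forall>p\<in>U \<inter> W.
      gs_proj (fibre E p) (h p) (\<lambda>i. e i p) n (\<sigma> p) = lincomb (fibre E p) n (\<lambda>i. a i p) (\<lambda>i. e i p))"
    by (rule gs_proj_smooth_coeffs[OF UW, where n = n]) (use fr(3) gram mem pair[OF U] in auto)
  moreover have "gs_proj (fibre E p) (h p) (\<lambda>i. e i p) n (\<sigma> p) = \<sigma> p" if "p \<in> U \<inter> W" for p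
  proof -
    have "is_basis (fibre E p) n (\<lambda>i. e i p)" using fr(3) that by simp
    from F.is_basis_span[OF this mem] that obtain c where "\<sigma> p = lincomb (fibre E p) n c (\<lambda>i. e i p)" by auto
    then show ?thesis using F.gs_proj_eq_self[of n "\<lambda>i. e i p" p] fr(4)[of p] that by simp
  qed
  ultimately show "\<exists>a. (\<forall>i<n. smooth_fun_on M (U \<inter> W) (a i)) \<and>
      (\<forall>p\<in>U \<inter> W. \<sigma> p = lincomb (fibre E p) n (\<lambda>i. a i p) (\<lambda>i. e i p))" by auto
qed

lemma smooth_section_subset:
  assumes "smooth_section_on M E W \<sigma>" "V \<subseteq> W"
  shows "smooth_section_on M E V \<sigma>"
  unfolding smooth_section_on_def
proof clarify
  fix U n e assume U: "(U, n, e) \<in> frames E"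
  obtain a where a: "\<And>i. i < n \<Longrightarrow> smooth_fun_on M (U \<inter> W) (a i)"
    "\<And>p. p \<in> U \<Longrightarrow> p \<in> W \<Longrightarrow> \<sigma> p = lincomb (fibre E p) n (\<lambda>i. a i p) (\<lambda>i. e i p)"
    using smooth_section_frame_coeffs[OF assms(1) U] by blast
  have "smooth_fun_on M (U \<inter> V) (a i)" if "i < n" for i
    by (rule smooth_fun_on_subset[OF a(1)[OF that]]) (use assms(2) in blast)
  with a(2) assms(2) show "\<exists>a. (\<forall>i<n. smooth_fun_on M (U \<inter> V) (a i)) \<and>
      (\<forall>p\<in>U \<inter> V. \<sigma> p = lincomb (fibre E p) n (\<lambda>i. a i p) (\<lambda>i. e i p))" by blast
qed

lemma smooth_section_local:
  assumes "open W" "\<And>p. p \<in> W \<Longrightarrow> \<exists>N. open N \<and> p \<in> N \<and> smooth_section_on M E N \<sigma>"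
  shows "smooth_section_on M E W \<sigma>"
proof (rule smooth_section_onI[OF assms(1)])
  show "\<sigma> p \<in> fib E p" if "p \<in> W" for p using assms(2)[OF that] smooth_section_mem by blast
  fix U n e i assume U: "(U, n, e) \<in> frames E" "i < n"
  have "open U" using holo_frameD(1)[OF frames_holo_frame[OF U(1)]] .
  show "smooth_fun_on M (U \<inter> W) (\<lambda>p. h p (\<sigma> p) (e i p))"
  proof (rule smooth_fun_on_local)
    fix p assume p: "p \<in> U \<inter> W"
    then obtain N where N: "open N" "p \<in> N" "smooth_section_on M E N \<sigma>" using assms(2) by blast
    then show "\<exists>N. open N \<and> p \<in> N \<and> smooth_fun_on M N (\<lambda>p. h p (\<sigma> p) (e i p))"
      using smooth_section_pair_frame[OF N(1,3) U] p \<open>open U\<close> by (intro exI[of _ "U \<inter> N"]) auto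
  qed (use \<open>open U\<close> assms(1) in auto)
qed

lemma smooth_section_cong:
  "smooth_section_on M E W \<sigma> \<Longrightarrow> (\<And>p. p \<in> W \<Longrightarrow> \<sigma> p = \<tau> p) \<Longrightarrow> smooth_section_on M E W \<tau>"
  unfolding smooth_section_on_def by simp

lemma smooth_section_add:
  assumes "open W" "smooth_section_on M E W \<sigma>" "smooth_section_on M E W \<tau>"
  shows "smooth_section_on M E W (\<lambda>p. \<sigma> p \<oplus>\<^bsub>fibre E p\<^esub> \<tau> p)"
proof (rule smooth_section_onI[OF assms(1)])
  note mem = smooth_section_mem[OF assms(2)] smooth_section_mem[OF assms(3)]
  show "\<sigma> p \<oplus>\<^bsub>fibre E p\<^esub> \<tau> p \<in> fib E p" if "p \<in> W" for p using mem that by simp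
  fix U n e i assume U: "(U, n, e) \<in> frames E" "i < n"
  note fr = holo_frameD[OF frames_holo_frame[OF U(1)]]
  have UW: "open (U \<inter> W)" using fr(1) assms(1) by blast
  show "smooth_fun_on M (U \<inter> W) (\<lambda>p. h p (\<sigma> p \<oplus>\<^bsub>fibre E p\<^esub> \<tau> p) (e i p))"
    by (rule smooth_fun_on_cong[OF smooth_fun_on_add[OF UW smooth_section_pair_frame[OF assms(1,2) U]
          smooth_section_pair_frame[OF assms(1,3) U]] UW])
      (use mem fr(4) U(2) in \<open>simp add: F.h_left\<close>)
qed

lemma smooth_section_smult:
  assumes "open W" "smooth_fun_on M W f" "smooth_section_on M E W \<sigma>"
  shows "smooth_section_on M E W (\<lambda>p. f p \<odot>\<^bsub>fibre E p\<^esub> \<sigma> p)"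
proof (rule smooth_section_onI[OF assms(1)])
  note mem = smooth_section_mem[OF assms(3)]
  show "f p \<odot>\<^bsub>fibre E p\<^esub> \<sigma> p \<in> fib E p" if "p \<in> W" for p using mem that by simp
  fix U n e i assume U: "(U, n, e) \<in> frames E" "i < n"
  note fr = holo_frameD[OF frames_holo_frame[OF U(1)]]
  have UW: "open (U \<inter> W)" using fr(1) assms(1) by blast
  have f: "smooth_fun_on M (U \<inter> W) f" using smooth_fun_on_subset[OF assms(2)] by blast
  show "smooth_fun_on M (U \<inter> W) (\<lambda>p. h p (f p \<odot>\<^bsub>fibre E p\<^esub> \<sigma> p) (e i p))"
    by (rule smooth_fun_on_cong[OF smooth_fun_on_mult[OF UW f smooth_section_pair_frame[OF assms(1,3) U]] UW])
      (use mem fr(4) U(2) in \<open>simp add: F.h_left\<close>)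
qed

lemma smooth_section_zero: "open W \<Longrightarrow> smooth_section_on M E W (\<lambda>p. \<zero>\<^bsub>fibre E p\<^esub>)"
proof (rule smooth_section_onI)
  assume W: "open W"
  fix U n e i assume U: "(U, n, e) \<in> frames E" "i < n"
  note fr = holo_frameD[OF frames_holo_frame[OF U(1)]]
  have UW: "open (U \<inter> W)" using fr(1) W by blast
  show "smooth_fun_on M (U \<inter> W) (\<lambda>p. h p \<zero>\<^bsub>fibre E p\<^esub> (e i p))"
    by (rule smooth_fun_on_cong[OF smooth_fun_on_const[OF UW, of 0] UW]) (use fr(4) U(2) in simp)
qed auto

lemma smooth_section_lincomb:
  assumes "open W"
  shows "(\<And>i. i < k \<Longrightarrow> smooth_fun_on M W (a i)) \<Longrightarrow> (\<And>i. i < k \<Longrightarrow> smooth_section_on M E W (e i)) \<Longrightarrow>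
    smooth_section_on M E W (\<lambda>p. lincomb (fibre E p) k (\<lambda>i. a i p) (\<lambda>i. e i p))"
proof (induction k)
  case 0
  show ?case using smooth_section_zero[OF assms] by simp
next
  case (Suc k)
  have "smooth_section_on M E W (\<lambda>p. lincomb (fibre E p) k (\<lambda>i. a i p) (\<lambda>i. e i p) \<oplus>\<^bsub>fibre E p\<^esub> a k p \<odot>\<^bsub>fibre E p\<^esub> e k p)"
    by (intro smooth_section_add smooth_section_smult assms Suc) auto
  then show ?case
    by (rule smooth_section_cong) (simp add: F.lincomb_Suc smooth_section_mem[OF Suc.prems(2)])
qed

text \<open>Smooth sections have smooth coefficients in an arbitrary smooth local frame, in fact the
  projections to the span of its first members do.\<close>

lemma gs_proj_smooth_frame:
  assumes "open U" "\<And>i. i < n \<Longrightarrow> smooth_section_on M E U (e i)"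
    and "\<And>p. p \<in> U \<Longrightarrow> is_basis (fibre E p) n (\<lambda>i. e i p)"
    and "open W" "smooth_section_on M E W \<sigma>" "k \<le> n"
  obtains a where "\<And>i. i < k \<Longrightarrow> smooth_fun_on M (U \<inter> W) (a i)"
    "\<And>p. p \<in> U \<Longrightarrow> p \<in> W \<Longrightarrow>
      gs_proj (fibre E p) (h p) (\<lambda>i. e i p) k (\<sigma> p) = lincomb (fibre E p) k (\<lambda>i. a i p) (\<lambda>i. e i p)"
proof -
  have UW: "open (U \<inter> W)" using assms(1,4) by blast
  have e: "smooth_section_on M E (U \<inter> W) (e i)" if "i < n" for i
    using smooth_section_subset[OF assms(2)[OF that]] by blast
  have s: "smooth_section_on M E (U \<inter> W) \<sigma>"
    using smooth_section_subset[OF assms(5)] by blast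
  have "\<exists>a. (\<forall>i<k. smooth_fun_on M (U \<inter> W) (a i)) \<and> (\<forall>p\<in>U \<inter> W.
      gs_proj (fibre E p) (h p) (\<lambda>i. e i p) k (\<sigma> p) = lincomb (fibre E p) k (\<lambda>i. a i p) (\<lambda>i. e i p))"
  proof (rule gs_proj_smooth_coeffs[OF UW, where n = n])
    show "smooth_fun_on M (U \<inter> W) (\<lambda>p. h p (e i p) (e j p))" if "i < n" "j < n" for i j
      using smooth_section_pair[OF UW e e] that by blast
    show "smooth_fun_on M (U \<inter> W) (\<lambda>p. h p (\<sigma> p) (e i p))" if "i < k" for i
      using smooth_section_pair[OF UW s e] that assms(6) by auto
  qed (use assms(3,6) smooth_section_mem[OF assms(5)] in auto)
  then show thesis using that by blast
qed

lemma smooth_frame_coeffs: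
  assumes "open U" "\<And>i. i < n \<Longrightarrow> smooth_section_on M E U (e i)"
    and "\<And>p. p \<in> U \<Longrightarrow> is_basis (fibre E p) n (\<lambda>i. e i p)"
    and "open W" "smooth_section_on M E W \<sigma>"
  obtains a where "\<And>i. i < n \<Longrightarrow> smooth_fun_on M (U \<inter> W) (a i)"
    "\<And>p. p \<in> U \<Longrightarrow> p \<in> W \<Longrightarrow> \<sigma> p = lincomb (fibre E p) n (\<lambda>i. a i p) (\<lambda>i. e i p)"
proof -
  obtain a where a: "\<And>i. i < n \<Longrightarrow> smooth_fun_on M (U \<inter> W) (a i)"
    "\<And>p. p \<in> U \<Longrightarrow> p \<in> W \<Longrightarrow>
      gs_proj (fibre E p) (h p) (\<lambda>i. e i p) n (\<sigma> p) = lincomb (fibre E p) n (\<lambda>i. a i p) (\<lambda>i. e i p)"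
    using gs_proj_smooth_frame[OF assms, of n] by blast
  have "gs_proj (fibre E p) (h p) (\<lambda>i. e i p) n (\<sigma> p) = \<sigma> p" if "p \<in> U" "p \<in> W" for p
  proof -
    obtain c where "\<sigma> p = lincomb (fibre E p) n c (\<lambda>i. e i p)"
      using F.is_basis_span[OF assms(3)[OF \<open>p \<in> U\<close>] smooth_section_mem[OF assms(5) \<open>p \<in> W\<close>]] by blast
    then show ?thesis
      using F.gs_proj_eq_self[of n "\<lambda>i. e i p" p] F.is_basis_mem[OF assms(3)[OF that(1)]] by simp
  qed
  then show thesis using that[of a] a by metis
qed

lemma holo_frame_smooth: "holo_frame M E U n e \<Longrightarrow> i < n \<Longrightarrow> smooth_section_on M E U (e i)"
  by (rule holo_section_imp_smooth[OF holo_frameD(2)])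


subsection \<open>Global extension of local sections\<close>

text \<open>A local section agrees near \<open>p\<close> with a global one. The last property guarantees that the
  extension stays in every fibrewise subspace that contains the values of \<open>\<sigma>\<close>.\<close>

lemma extend_section:
  assumes "open W" "p \<in> W" "smooth_section_on M E W \<sigma>"
  obtains \<tau> N where "smooth_section_on M E UNIV \<tau>" "open N" "p \<in> N" "N \<subseteq> W" "\<And>q. q \<in> N \<Longrightarrow> \<tau> q = \<sigma> q"
    "\<And>q. \<tau> q = \<zero>\<^bsub>fibre E q\<^esub> \<or> q \<in> W \<and> (\<exists>c. \<tau> q = c \<odot>\<^bsub>fibre E q\<^esub> \<sigma> q)"
proof -
  obtain \<psi> N K where b: "smooth_fun_on M UNIV \<psi>" "open N" "p \<in> N" "N \<subseteq> W" "\<And>q. q \<in> N \<Longrightarrow> \<psi> q = 1"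
    "closed K" "K \<subseteq> W" "\<And>q. q \<notin> K \<Longrightarrow> \<psi> q = 0"
    using bump_exists[OF assms(1,2)] by metis
  define \<tau> where "\<tau> = (\<lambda>q. if q \<in> W then \<psi> q \<odot>\<^bsub>fibre E q\<^esub> \<sigma> q else \<zero>\<^bsub>fibre E q\<^esub>)"
  have K: "open (- K)" using b(6) by (rule open_Compl)
  have "smooth_section_on M E W (\<lambda>q. \<psi> q \<odot>\<^bsub>fibre E q\<^esub> \<sigma> q)"
    by (rule smooth_section_smult[OF assms(1) smooth_fun_on_subset[OF b(1)] assms(3)]) simp
  then have 1: "smooth_section_on M E W \<tau>" by (rule smooth_section_cong) (simp add: \<tau>_def)
  have 2: "smooth_section_on M E (- K) \<tau>"
    by (rule smooth_section_cong[OF smooth_section_zero[OF K]])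
      (simp add: \<tau>_def b(8) smooth_section_mem[OF assms(3)])
  have "smooth_section_on M E UNIV \<tau>"
    by (rule smooth_section_local) (use 1 2 K b(7) assms(1) in blast)+
  moreover have "\<tau> q = \<sigma> q" if "q \<in> N" for q
    using that b(4,5) smooth_section_mem[OF assms(3), of q] by (auto simp: \<tau>_def)
  moreover have "\<tau> q = \<zero>\<^bsub>fibre E q\<^esub> \<or> q \<in> W \<and> (\<exists>c. \<tau> q = c \<odot>\<^bsub>fibre E q\<^esub> \<sigma> q)" for q
    unfolding \<tau>_def by auto
  ultimately show thesis using that[of \<tau> N] b(2-4) by blast
qed

lemma sections_iff: "\<sigma> \<in> sections M E (fib E) \<longleftrightarrow> smooth_section_on M E UNIV \<sigma>"
  using smooth_section_mem by (auto simp: sections_def)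

lemma section_through:
  assumes "x \<in> fib E p"
  obtains \<xi> where "\<xi> \<in> sections M E (fib E)" "\<xi> p = x"
proof -
  obtain U n e where U: "(U, n, e) \<in> frames E" "p \<in> U" using frames_cover by blast
  note fr = holo_frameD[OF frames_holo_frame[OF U(1)]]
  obtain a where a: "x = lincomb (fibre E p) n a (\<lambda>i. e i p)"
    using F.is_basis_span[OF fr(3)[OF U(2)] assms] by blast
  have "smooth_section_on M E U (\<lambda>p. lincomb (fibre E p) n a (\<lambda>i. e i p))"
    using smooth_section_lincomb[OF fr(1), of n "\<lambda>i _. a i" e] holo_frame_smooth[OF frames_holo_frame[OF U(1)]]
      smooth_fun_on_const[OF fr(1)] by blast
  from extend_section[OF fr(1) U(2) this] show thesis using that a sections_iff by metis
qed


subsection \<open>The operator \<open>d''\<close> in holomorphic frames\<close>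

text \<open>The definition of \<open>d''\<close> refers to the frames that come with the bundle. As transition functions
  to them are holomorphic, the same formula holds in any holomorphic frame.\<close>

lemma dbar_in_holo_frame:
  assumes e: "holo_frame M E U n e" and \<eta>: "smooth_section_on M E UNIV \<eta>" and dbar: "is_dbar_of M E \<eta> \<omega>"
    and c: "\<And>i. i < n \<Longrightarrow> smooth_fun_on M U (c i)"
    and \<eta>_eq: "\<And>p. p \<in> U \<Longrightarrow> \<eta> p = lincomb (fibre E p) n (\<lambda>i. c i p) (\<lambda>i. e i p)"
    and p: "p \<in> U"
  shows "\<omega> p v = lincomb (fibre E p) n (\<lambda>i. dbar_fun M (c i) p v) (\<lambda>i. e i p)"
proof -
  obtain U' m f where U': "(U', m, f) \<in> frames E" "p \<in> U'" using frames_cover by blast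
  note fr = holo_frameD[OF frames_holo_frame[OF U'(1)]] and er = holo_frameD[OF e]
  have W: "open (U' \<inter> U)" "p \<in> U' \<inter> U" using fr(1) er(1) U'(2) p by auto
  obtain a where a: "\<And>j. j < m \<Longrightarrow> smooth_fun_on M U' (a j)"
    "\<And>q. q \<in> U' \<Longrightarrow> \<eta> q = lincomb (fibre E q) m (\<lambda>j. a j q) (\<lambda>j. f j q)"
    using smooth_section_frame_coeffs[OF \<eta> U'(1)] by auto
  have "\<forall>i<n. \<exists>g. (\<forall>j<m. holo_fun_on M (U' \<inter> U) (g j)) \<and>
      (\<forall>q\<in>U' \<inter> U. e i q = lincomb (fibre E q) m (\<lambda>j. g j q) (\<lambda>j. f j q))"
    using bspec[OF er(2)[unfolded holo_section_on_def] U'(1)] by simp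
  then obtain g where g: "\<And>i j. i < n \<Longrightarrow> j < m \<Longrightarrow> holo_fun_on M (U' \<inter> U) (g i j)"
    "\<And>i q. i < n \<Longrightarrow> q \<in> U' \<inter> U \<Longrightarrow> e i q = lincomb (fibre E q) m (\<lambda>j. g i j q) (\<lambda>j. f j q)"
    by metis
  have subst: "lincomb (fibre E q) n d (\<lambda>i. e i q) =
      lincomb (fibre E q) m (\<lambda>j. \<Sum>i<n. d i * g i j q) (\<lambda>j. f j q)" if q: "q \<in> U' \<inter> U" for q d
  proof (rule F.vec_eqI)
    have f: "f j q \<in> fib E q" if "j < m" for j using fr(4) q that by blast
    have eq: "e i q \<in> fib E q" if "i < n" for i using er(4) q that by blast
    show "lincomb (fibre E q) n d (\<lambda>i. e i q) \<in> fib E q"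
      "lincomb (fibre E q) m (\<lambda>j. \<Sum>i<n. d i * g i j q) (\<lambda>j. f j q) \<in> fib E q"
      using f eq by auto
    fix z assume z: "z \<in> fib E q"
    have "h q (lincomb (fibre E q) n d (\<lambda>i. e i q)) z = (\<Sum>i<n. d i * h q (e i q) z)"
      using eq z by (simp add: F.h_lincomb_left)
    also have "\<dots> = (\<Sum>i<n. \<Sum>j<m. d i * g i j q * h q (f j q) z)"
      using f z q by (intro sum.cong) (auto simp: g(2) F.h_lincomb_left sum_distrib_left mult.assoc)
    also have "\<dots> = (\<Sum>j<m. \<Sum>i<n. d i * g i j q * h q (f j q) z)" by (rule sum.swap)
    also have "\<dots> = h q (lincomb (fibre E q) m (\<lambda>j. \<Sum>i<n. d i * g i j q) (\<lambda>j. f j q)) z"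
      using f z by (simp add: F.h_lincomb_left sum_distrib_right)
    finally show "h q (lincomb (fibre E q) n d (\<lambda>i. e i q)) z =
      h q (lincomb (fibre E q) m (\<lambda>j. \<Sum>i<n. d i * g i j q) (\<lambda>j. f j q)) z" .
  qed
  have coeff: "a j q = (\<Sum>i<n. c i q * g i j q)" if "j < m" "q \<in> U' \<inter> U" for j q
    using F.is_basis_inj[OF fr(3), of q "\<lambda>j. a j q" "\<lambda>j. \<Sum>i<n. c i q * g i j q" j] that
      a(2)[of q] \<eta>_eq[of q] subst[OF that(2), of "\<lambda>i. c i q"] by auto
  have "dbar_fun M (a j) p v = (\<Sum>i<n. dbar_fun M (c i) p v * g i j p)" if j: "j < m" for j
  proof -
    have c': "smooth_fun_on M (U' \<inter> U) (c i)" if "i < n" for i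
      using smooth_fun_on_subset[OF c[OF that]] by blast
    have "smooth_fun_on M (U' \<inter> U) (\<lambda>q. \<Sum>i<n. c i q * g i j q)"
      by (intro smooth_fun_on_sum smooth_fun_on_mult W(1) c' holo_imp_smooth_fun_on g(1) j)
    from dbar_fun_cong[OF W this, of "a j"]
    have "dbar_fun M (a j) p v = dbar_fun M (\<lambda>q. \<Sum>i<n. c i q * g i j q) p v"
      using coeff[OF j] by simp
    also have "\<dots> = (\<Sum>i<n. dbar_fun M (c i) p v * g i j p)"
      by (rule dbar_fun_holo_sum[OF W c']) (use g(1) j in auto)
    finally show ?thesis .
  qed
  then have "lincomb (fibre E p) m (\<lambda>j. dbar_fun M (a j) p v) (\<lambda>j. f j p) =
      lincomb (fibre E p) m (\<lambda>j. \<Sum>i<n. dbar_fun M (c i) p v * g i j p) (\<lambda>j. f j p)"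
    by (intro F.lincomb_cong fr(4) U'(2)) auto
  moreover have "\<omega> p v = lincomb (fibre E p) m (\<lambda>j. dbar_fun M (a j) p v) (\<lambda>j. f j p)"
    using bspec[OF dbar[unfolded is_dbar_of_def] U'(1)] U'(2) a by simp
  ultimately show ?thesis using subst[OF W(2)] by simp
qed

end


section \<open>Uniqueness of the Chern connection\<close>

lemma chern_connectionD:
  assumes D: "chern_connection M E h D" and \<xi>: "\<xi> \<in> sections M E (fib E)"
  shows "D \<xi> \<in> forms M E (fib E)" "D \<xi> p v \<in> fib E p" "real_linear_into (fibre E p) (D \<xi> p)"
    "c \<in> atlas M \<Longrightarrow> smooth_section_on M E (fst c) (\<lambda>p. D \<xi> p (coord_vec M c p w))"
    "is_dbar_of M E \<xi> (part01 E (D \<xi>))"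
    "\<eta> \<in> sections M E (fib E) \<Longrightarrow>
      D (\<lambda>p. \<xi> p \<oplus>\<^bsub>fibre E p\<^esub> \<eta> p) = (\<lambda>p v. D \<xi> p v \<oplus>\<^bsub>fibre E p\<^esub> D \<eta> p v)"
    "smooth_fun_on M UNIV f \<Longrightarrow> D (\<lambda>p. f p \<odot>\<^bsub>fibre E p\<^esub> \<xi> p) =
      (\<lambda>p v. dfun M f p v \<odot>\<^bsub>fibre E p\<^esub> \<xi> p \<oplus>\<^bsub>fibre E p\<^esub> f p \<odot>\<^bsub>fibre E p\<^esub> D \<xi> p v)"
    "\<eta> \<in> sections M E (fib E) \<Longrightarrow>
      dfun M (\<lambda>q. h q (\<xi> q) (\<eta> q)) p v = h p (D \<xi> p v) (\<eta> p) + h p (\<xi> p) (D \<eta> p v)"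
proof -
  have c: "connection M E D" using D unfolding chern_connection_def by blast
  show f: "D \<xi> \<in> forms M E (fib E)" using c \<xi> unfolding connection_def by blast
  then show "D \<xi> p v \<in> fib E p" "real_linear_into (fibre E p) (D \<xi> p)"
    "c \<in> atlas M \<Longrightarrow> smooth_section_on M E (fst c) (\<lambda>p. D \<xi> p (coord_vec M c p w))"
    unfolding forms_def by blast+
  show "is_dbar_of M E \<xi> (part01 E (D \<xi>))" using D \<xi> unfolding chern_connection_def by blast
  show "\<eta> \<in> sections M E (fib E) \<Longrightarrow>
      D (\<lambda>p. \<xi> p \<oplus>\<^bsub>fibre E p\<^esub> \<eta> p) = (\<lambda>p v. D \<xi> p v \<oplus>\<^bsub>fibre E p\<^esub> D \<eta> p v)"
    using c \<xi> unfolding connection_def by blast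
  show "smooth_fun_on M UNIV f \<Longrightarrow> D (\<lambda>p. f p \<odot>\<^bsub>fibre E p\<^esub> \<xi> p) =
      (\<lambda>p v. dfun M f p v \<odot>\<^bsub>fibre E p\<^esub> \<xi> p \<oplus>\<^bsub>fibre E p\<^esub> f p \<odot>\<^bsub>fibre E p\<^esub> D \<xi> p v)"
    using c \<xi> unfolding connection_def by blast
  show "\<eta> \<in> sections M E (fib E) \<Longrightarrow>
      dfun M (\<lambda>q. h q (\<xi> q) (\<eta> q)) p v = h p (D \<xi> p v) (\<eta> p) + h p (\<xi> p) (D \<eta> p v)"
    using D \<xi> unfolding chern_connection_def by blast
qed

text \<open>The difference \<open>\<theta>\<close> of two Chern connections is skew-adjoint because both are metric, and
  \<open>\<theta> (\<i> v) = \<i> \<theta> v\<close> because both have the same \<open>(0,1)\<close>-part. Comparing the two conditions at \<open>v\<close>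
  and \<open>\<i> v\<close> gives \<open>\<theta> = 0\<close>. Tensoriality of \<open>\<theta>\<close> is not needed, only that every
  vector is the value of a global section.\<close>

lemma chern_connection_unique:
  fixes M :: "('m, 'n::finite) cmanifold"
  assumes herm: "\<And>p. hermitian_space (fibre E p) (h p)"
    and cover: "\<And>p. \<exists>U n e. (U, n, e) \<in> frames E \<and> p \<in> U"
    and through: "\<And>p x. x \<in> fib E p \<Longrightarrow> \<exists>\<xi>\<in>sections M E (fib E). \<xi> p = x"
    and D: "chern_connection M E h D" and D': "chern_connection M E h D'"
    and \<eta>: "\<eta> \<in> sections M E (fib E)"
  shows "D \<eta> = D' \<eta>"
proof (intro ext)
  fix p and v :: "complex^'n"
  interpret F: hermitian_space "fibre E p" "h p" by (rule herm)
  have mem: "D \<xi> p w \<in> fib E p" "D' \<xi> p w \<in> fib E p" "\<xi> p \<in> fib E p"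
    if "\<xi> \<in> sections M E (fib E)" for \<xi> w
    using chern_connectionD(2)[OF D that] chern_connectionD(2)[OF D' that] that by (auto simp: sections_def)
  have p01: "part01 E (D \<xi>) p v = part01 E (D' \<xi>) p v" if \<xi>: "\<xi> \<in> sections M E (fib E)" for \<xi>
  proof -
    obtain U n e where U: "(U, n, e) \<in> frames E" "p \<in> U" using cover by blast
    have sm: "smooth_section_on M E UNIV \<xi>" using \<xi> by (simp add: sections_def)
    from bspec[OF sm[unfolded smooth_section_on_def] U(1)]
    obtain a where a: "\<forall>i<n. smooth_fun_on M U (a i)"
      "\<forall>q\<in>U. \<xi> q = lincomb (fibre E q) n (\<lambda>i. a i q) (\<lambda>i. e i q)" by auto
    have "\<omega> p v = lincomb (fibre E p) n (\<lambda>i. dbar_fun M (a i) p v) (\<lambda>i. e i p)"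
      if "is_dbar_of M E \<xi> \<omega>" for \<omega>
      using bspec[OF that[unfolded is_dbar_of_def] U(1)] a U(2) by simp
    from this[OF chern_connectionD(5)[OF D \<xi>]] this[OF chern_connectionD(5)[OF D' \<xi>]]
    show ?thesis by simp
  qed
  have pair: "h p (D \<xi> p v) z + \<i> * h p (D \<xi> p (\<i> *s v)) z = h p (D' \<xi> p v) z + \<i> * h p (D' \<xi> p (\<i> *s v)) z"
    if "\<xi> \<in> sections M E (fib E)" "z \<in> fib E p" for \<xi> z
  proof -
    have "h p (D \<xi> p v) z * 2 + \<i> * h p (D \<xi> p (\<i> *s v)) z * 2 =
        h p (D' \<xi> p v) z * 2 + \<i> * h p (D' \<xi> p (\<i> *s v)) z * 2"
      using arg_cong[OF p01[OF that(1)], of "\<lambda>x. h p x z"] mem that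
      by (simp add: part01_def F.h_left)
    then have "2 * (h p (D \<xi> p v) z + \<i> * h p (D \<xi> p (\<i> *s v)) z) =
        2 * (h p (D' \<xi> p v) z + \<i> * h p (D' \<xi> p (\<i> *s v)) z)"
      by (simp only: algebra_simps)
    then show ?thesis by (metis mult_left_cancel zero_neq_numeral)
  qed
  have metric: "h p (D \<xi> p w) (\<eta> p) + h p (\<xi> p) (D \<eta> p w) = h p (D' \<xi> p w) (\<eta> p) + h p (\<xi> p) (D' \<eta> p w)"
    if "\<xi> \<in> sections M E (fib E)" for \<xi> w
    using chern_connectionD(8)[OF D that \<eta>, of p w] chern_connectionD(8)[OF D' that \<eta>, of p w] by simp
  have skew: "B = 0" if "A + B = 0" "A' + B' = 0" "A = - \<i> * A'" "B = \<i> * B'" for A A' B B' :: complex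
  proof -
    have "\<i> * (B' - A') = 0" using that(1,3,4) by (simp add: algebra_simps)
    then have "B' = A'" by simp
    with that(2) have "2 * B' = 0" by simp
    with that(4) show ?thesis by simp
  qed
  show "D \<eta> p v = D' \<eta> p v"
  proof (rule F.vec_eqI)
    fix z assume z: "z \<in> fib E p"
    then obtain \<xi> where \<xi>: "\<xi> \<in> sections M E (fib E)" "\<xi> p = z" using through by blast
    let ?A = "h p (D \<xi> p v) (\<eta> p) - h p (D' \<xi> p v) (\<eta> p)"
    let ?A' = "h p (D \<xi> p (\<i> *s v)) (\<eta> p) - h p (D' \<xi> p (\<i> *s v)) (\<eta> p)"
    let ?B = "cnj (h p (D \<eta> p v) z) - cnj (h p (D' \<eta> p v) z)"
    let ?B' = "cnj (h p (D \<eta> p (\<i> *s v)) z) - cnj (h p (D' \<eta> p (\<i> *s v)) z)"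
    have cnjs: "h p z (D \<eta> p w) = cnj (h p (D \<eta> p w) z)" "h p z (D' \<eta> p w) = cnj (h p (D' \<eta> p w) z)" for w
      using F.h_sym mem[OF \<eta>] z by blast+
    have "?A + ?B = 0" "?A' + ?B' = 0"
      using metric[OF \<xi>(1)] by (simp_all add: \<xi>(2) cnjs algebra_simps)
    moreover have "?A = - \<i> * ?A'"
      using pair[OF \<xi>(1) mem(3)[OF \<eta>]] by (simp add: algebra_simps)
    moreover have "?B = \<i> * ?B'"
      using arg_cong[OF pair[OF \<eta> z], of cnj] by (simp add: algebra_simps)
    ultimately have "?B = 0" by (rule skew)
    then show "h p (D \<eta> p v) z = h p (D' \<eta> p v) z" by (metis complex_cnj_cnj eq_iff_diff_eq_0)
  qed (use mem[OF \<eta>] in auto)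
qed


section \<open>Subbundles, orthogonal complements and quotient bundles\<close>

locale hermitian_subbundle = hermitian_bundle M E h
  for M :: "('m::t2_space, 'n::finite) cmanifold" and E :: "('m, 'v) vbundle" and h +
  fixes S :: "'m \<Rightarrow> 'v set"
  assumes holo_subbundle: "holo_subbundle M E S"
begin

abbreviation "Q \<equiv> quot_bundle M E S"
abbreviation "hQ \<equiv> quot_metric E h S"

lemma adapted_frame_exists: "\<exists>U n s e. p \<in> U \<and> adapted_frame M E S U n s e"
  using holo_subbundle by (simp add: holo_subbundle_def)

lemma submodule: "submodule (S p) complex_ring (fibre E p)"
  using holo_subbundle by (simp add: holo_subbundle_def)

lemma adapted_frameD:
  assumes "adapted_frame M E S U n s e"
  shows "holo_frame M E U n e" "s \<le> n" "p \<in> U \<Longrightarrow> i < s \<Longrightarrow> e i p \<in> S p"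
    "p \<in> U \<Longrightarrow> x \<in> S p \<Longrightarrow> \<exists>a. x = lincomb (fibre E p) s a (\<lambda>i. e i p)"
proof -
  show "holo_frame M E U n e" "s \<le> n" using assms by (simp_all add: adapted_frame_def)
  have b: "is_basis (fibre E p\<lparr>carrier := S p\<rparr>) s (\<lambda>i. e i p)" if "p \<in> U" for p
    using assms that by (simp add: adapted_frame_def)
  show mem: "e i p \<in> S p" if "p \<in> U" "i < s" for i p
    using b[OF that(1)] that(2) by (simp add: is_basis_def)
  assume p: "p \<in> U" and "x \<in> S p"
  then obtain a where "x = lincomb (fibre E p\<lparr>carrier := S p\<rparr>) s a (\<lambda>i. e i p)"
    using b[OF p] unfolding is_basis_def by auto
  then show "\<exists>a. x = lincomb (fibre E p) s a (\<lambda>i. e i p)"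
    using F.submodule_lincomb(2)[OF submodule[of p], of s "\<lambda>i. e i p" a] mem[OF p] by auto
qed

lemma fibre_hermitian_subspace: "hermitian_subspace (fibre E p) (h p) (S p)"
proof (intro hermitian_subspace.intro hermitian_subspace_axioms.intro fibre_hermitian_space submodule)
  obtain U n s e where U: "p \<in> U" "adapted_frame M E S U n s e" using adapted_frame_exists by blast
  then have "(\<forall>i<s. e i p \<in> S p) \<and> (\<forall>x\<in>S p. \<exists>a. x = lincomb (fibre E p) s a (\<lambda>i. e i p))"
    using adapted_frameD(3,4)[OF U(2,1)] by blast
  then show "\<exists>n e. (\<forall>i<n. e i \<in> S p) \<and> (\<forall>x\<in>S p. \<exists>a. x = lincomb (fibre E p) n a e)"
    by (intro exI[of _ s] exI[of _ "\<lambda>i. e i p"])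
qed

text \<open>Fibrewise linear algebra, with the rewrite equations translating its projections, quotient map
  and quotient space into those of the bundle.\<close>

sublocale G: hermitian_subspace "fibre E p" "h p" "S p"
  rewrites "hermitian_subspace.perp (fibre E p) (h p) (S p) = orth E h S p"
    and "proj_along (fibre E p) (S p) (orth E h S p) = proj_S E h S p"
    and "proj_along (fibre E p) (orth E h S p) (S p) = proj_orth E h S p"
    and "a_r_coset (fibre E p) (S p) = quot_map E S p"
    and "inv_into (orth E h S p) (quot_map E S p) = quot_lift E h S p"
    and "quot_space (fibre E p) (S p) = fibre Q p"
  for p
proof -
  show *: "hermitian_subspace (fibre E p) (h p) (S p)" by (rule fibre_hermitian_subspace)
  show "hermitian_subspace.perp (fibre E p) (h p) (S p) = orth E h S p"
    by (simp add: hermitian_subspace.perp_def[OF *] orth_def)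
  show q: "a_r_coset (fibre E p) (S p) = quot_map E S p"
    by (rule ext) (simp add: quot_map_def)
  show "quot_space (fibre E p) (S p) = fibre Q p"
    by (simp add: quot_space_def quot_bundle_def quot_smult_def[abs_def] q)
qed (simp_all add: proj_S_def proj_orth_def quot_lift_def)

lemma orth_fib: "x \<in> orth E h S p \<Longrightarrow> x \<in> fib E p"
  by simp

lemma orth_sections_fib: "\<eta> \<in> sections M E (orth E h S) \<Longrightarrow> \<eta> \<in> sections M E (fib E)"
  unfolding sections_def using orth_fib by blast

lemma orth_sectionsD:
  assumes "\<eta> \<in> sections M E (orth E h S)"
  shows "\<eta> p \<in> orth E h S p" "smooth_section_on M E UNIV \<eta>"
  using assms by (auto simp: sections_def)

lemma proj_S_smooth:
  assumes W: "open W" and \<sigma>: "smooth_section_on M E W \<sigma>"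
  shows "smooth_section_on M E W (\<lambda>p. proj_S E h S p (\<sigma> p))"
proof (rule smooth_section_local[OF W])
  fix p assume "p \<in> W"
  obtain U n s e where U: "p \<in> U" "adapted_frame M E S U n s e" using adapted_frame_exists by blast
  note ad = adapted_frameD[OF U(2)] and fr = holo_frameD[OF adapted_frameD(1)[OF U(2)]]
  have UW: "open (U \<inter> W)" using fr(1) W by blast
  obtain a where a: "\<And>i. i < s \<Longrightarrow> smooth_fun_on M (U \<inter> W) (a i)"
    "\<And>q. q \<in> U \<Longrightarrow> q \<in> W \<Longrightarrow>
      gs_proj (fibre E q) (h q) (\<lambda>i. e i q) s (\<sigma> q) = lincomb (fibre E q) s (\<lambda>i. a i q) (\<lambda>i. e i q)"
    using gs_proj_smooth_frame[OF fr(1) holo_frame_smooth[OF ad(1)] fr(3) W \<sigma> ad(2)] by blast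
  have e: "smooth_section_on M E (U \<inter> W) (e i)" if "i < s" for i
    using smooth_section_subset[OF holo_frame_smooth[OF ad(1)], of i "U \<inter> W"] that ad(2) by auto
  have "smooth_section_on M E (U \<inter> W) (\<lambda>q. proj_S E h S q (\<sigma> q))"
  proof (rule smooth_section_cong[OF smooth_section_lincomb[OF UW a(1) e]])
    show "lincomb (fibre E q) s (\<lambda>i. a i q) (\<lambda>i. e i q) = proj_S E h S q (\<sigma> q)" if "q \<in> U \<inter> W" for q
      using G.gs_proj_decomp(1)[of s "\<lambda>i. e i q" q "\<sigma> q"] ad(3,4)[of q] a(2)[of q] that
        smooth_section_mem[OF \<sigma>, of q] by simp
  qed
  then show "\<exists>N. open N \<and> p \<in> N \<and> smooth_section_on M E N (\<lambda>p. proj_S E h S p (\<sigma> p))"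
    using UW U(1) \<open>p \<in> W\<close> by blast
qed

lemma proj_orth_smooth:
  assumes W: "open W" and \<sigma>: "smooth_section_on M E W \<sigma>"
  shows "smooth_section_on M E W (\<lambda>p. proj_orth E h S p (\<sigma> p))"
  by (rule smooth_section_cong[OF smooth_section_add[OF W \<sigma> smooth_section_smult[OF W
          smooth_fun_on_const[OF W, of "- 1"] proj_S_smooth[OF W \<sigma>]]]])
    (simp add: G.prO_eq smooth_section_mem[OF \<sigma>])

lemma S_section_through:
  assumes "x \<in> S p"
  obtains \<xi> where "\<xi> \<in> sections M E (fib E)" "\<And>q. \<xi> q \<in> S q" "\<xi> p = x"
proof -
  obtain \<tau> where t: "\<tau> \<in> sections M E (fib E)" "\<tau> p = x" using section_through[OF G.S_carrier[OF assms]] by blast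
  have "smooth_section_on M E UNIV (\<lambda>q. proj_S E h S q (\<tau> q))"
    using t(1) by (intro proj_S_smooth) (simp_all add: sections_iff)
  then show thesis
    using that[of "\<lambda>q. proj_S E h S q (\<tau> q)"] t assms by (simp add: sections_iff G.proj_id sections_def)
qed

lemma orth_section_through:
  assumes "x \<in> orth E h S p"
  obtains \<eta> where "\<eta> \<in> sections M E (orth E h S)" "\<eta> p = x"
proof -
  obtain \<tau> where t: "\<tau> \<in> sections M E (fib E)" "\<tau> p = x"
    using section_through[OF orth_fib[OF assms]] by blast
  have "smooth_section_on M E UNIV (\<lambda>q. proj_orth E h S q (\<tau> q))"
    using t(1) by (intro proj_orth_smooth) (simp_all add: sections_iff)
  then show thesis
    using that[of "\<lambda>q. proj_orth E h S q (\<tau> q)"] t assms by (simp add: G.proj_id sections_def)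
qed


subsection \<open>The quotient bundle\<close>

lemma quot_fibre_hermitian_space: "hermitian_space (fibre Q p) (hQ p)"
  using G.quot_hermitian_space[of p] by (simp add: quot_metric_def[abs_def])

sublocale FQ: hermitian_space "fibre Q p" "hQ p" for p
  by (rule quot_fibre_hermitian_space)

lemma hQ_quot: "x \<in> fib E p \<Longrightarrow> y \<in> orth E h S p \<Longrightarrow> hQ p (quot_map E S p x) (quot_map E S p y) = h p x y"
  by (simp add: quot_metric_def G.lift_q G.proj_id G.h_prO_left)

lemma frames_quot: "frames Q = {(U, n - s, \<lambda>i p. quot_map E S p (e (s + i) p)) | U n s e. adapted_frame M E S U n s e}"
  by (simp add: quot_bundle_def)

lemma quot_section_smooth:
  assumes W: "open W" and \<sigma>: "smooth_section_on M E W \<sigma>"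
  shows "smooth_section_on M Q W (\<lambda>p. quot_map E S p (\<sigma> p))"
  unfolding smooth_section_on_def frames_quot
proof clarsimp
  fix U n s e assume U: "adapted_frame M E S U n s e"
  note ad = adapted_frameD[OF U] and fr = holo_frameD[OF adapted_frameD(1)[OF U]]
  obtain a where a: "\<And>i. i < n \<Longrightarrow> smooth_fun_on M (U \<inter> W) (a i)"
    "\<And>q. q \<in> U \<Longrightarrow> q \<in> W \<Longrightarrow> \<sigma> q = lincomb (fibre E q) n (\<lambda>i. a i q) (\<lambda>i. e i q)"
    using smooth_frame_coeffs[OF fr(1) holo_frame_smooth[OF ad(1)] fr(3) W \<sigma>] by blast
  have "quot_map E S q (\<sigma> q) =
      lincomb (fibre Q q) (n - s) (\<lambda>i. a (s + i) q) (\<lambda>i. quot_map E S q (e (s + i) q))" if "q \<in> U" "q \<in> W" for q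
    using G.q_lincomb_split[of s "\<lambda>i. e i q" q "n - s" "\<lambda>i. a i q"] ad(2) ad(3)[OF that(1)] fr(4)[OF that(1)]
      a(2)[OF that] by simp
  then show "\<exists>a. (\<forall>i<n - s. smooth_fun_on M (U \<inter> W) (a i)) \<and> (\<forall>p\<in>U \<inter> W. quot_map E S p (\<sigma> p) =
      lincomb (fibre Q p) (n - s) (\<lambda>i. a i p) (\<lambda>i. quot_map E S p (e (s + i) p)))"
    by (intro exI[of _ "\<lambda>i. a (s + i)"]) (auto intro: a(1))
qed

lemma quot_sections_mem:
  assumes "\<zeta> \<in> sections M Q (fib Q)"
  shows "\<zeta> p \<in> fib Q p" "quot_lift E h S p (\<zeta> p) \<in> orth E h S p" "quot_lift E h S p (\<zeta> p) \<in> fib E p"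
proof -
  show 1: "\<zeta> p \<in> fib Q p" using assms by (simp add: sections_def)
  then show 2: "quot_lift E h S p (\<zeta> p) \<in> orth E h S p" by simp
  then show "quot_lift E h S p (\<zeta> p) \<in> fib E p" by simp
qed

lemma lift_section:
  assumes \<zeta>: "\<zeta> \<in> sections M Q (fib Q)"
  shows "(\<lambda>p. quot_lift E h S p (\<zeta> p)) \<in> sections M E (orth E h S)"
proof -
  have "smooth_section_on M E UNIV (\<lambda>p. quot_lift E h S p (\<zeta> p))"
  proof (rule smooth_section_local)
    fix p :: 'm
    obtain U n s e where U: "p \<in> U" "adapted_frame M E S U n s e" using adapted_frame_exists by blast
    note ad = adapted_frameD[OF U(2)] and fr = holo_frameD[OF adapted_frameD(1)[OF U(2)]]
    have sm: "smooth_section_on M Q UNIV \<zeta>" using \<zeta> by (simp add: sections_def)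
    have fm: "(U, n - s, \<lambda>i p. quot_map E S p (e (s + i) p)) \<in> frames Q"
      unfolding frames_quot using U(2) by blast
    from bspec[OF sm[unfolded smooth_section_on_def] fm]
    obtain a where a: "\<And>i. i < n - s \<Longrightarrow> smooth_fun_on M U (a i)"
      "\<And>q. q \<in> U \<Longrightarrow> \<zeta> q = lincomb (fibre Q q) (n - s) (\<lambda>i. a i q) (\<lambda>i. quot_map E S q (e (s + i) q))"
      by auto
    let ?\<sigma> = "\<lambda>q. lincomb (fibre E q) (n - s) (\<lambda>i. a i q) (\<lambda>i. e (s + i) q)"
    have "smooth_section_on M E U ?\<sigma>"
      by (rule smooth_section_lincomb[OF fr(1) a(1), where e = "\<lambda>i. e (s + i)"])
        (auto intro!: holo_frame_smooth[OF ad(1)])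
    then have "smooth_section_on M E U (\<lambda>q. proj_orth E h S q (?\<sigma> q))" by (rule proj_orth_smooth[OF fr(1)])
    then have "smooth_section_on M E U (\<lambda>p. quot_lift E h S p (\<zeta> p))"
    proof (rule smooth_section_cong)
      fix q assume q: "q \<in> U"
      have e: "e (s + i) q \<in> fib E q" if "i < n - s" for i using fr(4)[OF q] that by simp
      show "proj_orth E h S q (?\<sigma> q) = quot_lift E h S q (\<zeta> q)"
        unfolding a(2)[OF q] by (subst G.q_lincomb[symmetric], rule e, assumption) (simp add: G.lift_q e)
    qed
    then show "\<exists>N. open N \<and> p \<in> N \<and> smooth_section_on M E N (\<lambda>p. quot_lift E h S p (\<zeta> p))"
      using fr(1) U(1) by blast
  qed simp
  then show ?thesis using quot_sections_mem[OF \<zeta>] by (simp add: sections_def)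
qed

lemma quot_section_through:
  assumes "X \<in> fib Q p"
  shows "\<exists>\<zeta>\<in>sections M Q (fib Q). \<zeta> p = X"
proof -
  obtain x where x: "x \<in> fib E p" "X = quot_map E S p x" using assms by (auto simp: G.carrier_Q)
  obtain \<xi> where xi: "\<xi> \<in> sections M E (fib E)" "\<xi> p = x" using section_through[OF x(1)] by blast
  have "(\<lambda>q. quot_map E S q (\<xi> q)) \<in> sections M Q (fib Q)"
    using xi(1) quot_section_smooth[of UNIV \<xi>] by (simp add: sections_def)
  then show ?thesis by (rule bexI[rotated]) (simp add: xi(2) x(2))
qed

lemma quot_frames_cover: "\<exists>U n e. (U, n, e) \<in> frames Q \<and> p \<in> U"
  unfolding frames_quot using adapted_frame_exists[of p] by blast

end


section \<open>The induced Chern connection on the quotient bundle\<close>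

locale chern_subbundle = hermitian_subbundle M E h S
  for M :: "('m::t2_space, 'n::finite) cmanifold" and E :: "('m, 'v) vbundle" and h S +
  fixes D :: "('m, 'n, 'v) operator"
  assumes chern: "chern_connection M E h D"
begin

lemmas D_mem = chern_connectionD(2)[OF chern]
  and D_real_linear = chern_connectionD(3)[OF chern]
  and D_smooth = chern_connectionD(4)[OF chern]
  and D_dbar = chern_connectionD(5)[OF chern]
  and D_add = chern_connectionD(6)[OF chern]
  and D_smult = chern_connectionD(7)[OF chern]
  and D_metric = chern_connectionD(8)[OF chern]

lemma D_orth_mem: "\<eta> \<in> sections M E (orth E h S) \<Longrightarrow> D \<eta> p v \<in> fib E p"
  by (rule D_mem[OF orth_sections_fib])

lemma B_op_forms:
  assumes \<eta>: "\<eta> \<in> sections M E (orth E h S)"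
  shows "B_op E h S D \<eta> \<in> forms M E S"
  unfolding forms_def mem_Collect_eq B_op_def[abs_def]
proof (intro conjI allI ballI)
  note \<eta>' = orth_sections_fib[OF \<eta>]
  show "proj_S E h S p (D \<eta> p v) \<in> S p" for p v using D_mem[OF \<eta>'] by simp
  show "real_linear_into (fibre E p) (\<lambda>v. proj_S E h S p (D \<eta> p v))" for p
    using D_real_linear[OF \<eta>', of p] D_mem[OF \<eta>']
    by (simp add: real_linear_into_def G.proj_add G.proj_smult)
  show "smooth_section_on M E (fst c) (\<lambda>p. proj_S E h S p (D \<eta> p (coord_vec M c p v)))" if "c \<in> atlas M" for c v
    by (rule proj_S_smooth[OF chart_domain_open[OF that] D_smooth[OF \<eta>' that]])
qed

lemma D_orth_op_forms:
  assumes \<eta>: "\<eta> \<in> sections M E (orth E h S)"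
  shows "D_orth_op E h S D \<eta> \<in> forms M E (orth E h S)"
  unfolding forms_def mem_Collect_eq D_orth_op_def[abs_def]
proof (intro conjI allI ballI)
  note \<eta>' = orth_sections_fib[OF \<eta>]
  show "proj_orth E h S p (D \<eta> p v) \<in> orth E h S p" for p v using D_mem[OF \<eta>'] by simp
  show "real_linear_into (fibre E p) (\<lambda>v. proj_orth E h S p (D \<eta> p v))" for p
    using D_real_linear[OF \<eta>', of p] D_mem[OF \<eta>']
    by (simp add: real_linear_into_def G.proj_add G.proj_smult)
  show "smooth_section_on M E (fst c) (\<lambda>p. proj_orth E h S p (D \<eta> p (coord_vec M c p v)))" if "c \<in> atlas M" for c v
    by (rule proj_orth_smooth[OF chart_domain_open[OF that] D_smooth[OF \<eta>' that]])
qed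

lemma D_decomp:
  assumes \<eta>: "\<eta> \<in> sections M E (orth E h S)"
  shows "D \<eta> p v = B_op E h S D \<eta> p v \<oplus>\<^bsub>fibre E p\<^esub> D_orth_op E h S D \<eta> p v"
  unfolding B_op_def D_orth_op_def by (rule G.decomp(3)[OF D_orth_mem[OF \<eta>]])

text \<open>The second fundamental form is the negative adjoint of the \<open>S\<close>-to-\<open>S\<^sup>\<bottom>\<close> part of \<open>D\<close>. Hence
  its value at \<open>p\<close> depends on \<open>\<eta> p\<close> only.\<close>

lemma h_B_op:
  assumes \<eta>: "\<eta> \<in> sections M E (orth E h S)" and \<xi>: "\<xi> \<in> sections M E (fib E)" "\<And>q. \<xi> q \<in> S q"
  shows "h p (B_op E h S D \<eta> p v) (\<xi> p) = - h p (\<eta> p) (D \<xi> p v)"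
proof -
  have "(\<lambda>q. h q (\<eta> q) (\<xi> q)) = (\<lambda>_. 0)"
    using orth_sectionsD(1)[OF \<eta>] \<xi>(2) by simp
  then have "h p (D \<eta> p v) (\<xi> p) + h p (\<eta> p) (D \<xi> p v) = 0"
    using D_metric[OF orth_sections_fib[OF \<eta>] \<xi>(1), of p v] by (simp add: dfun_zero)
  then show ?thesis
    unfolding B_op_def using D_orth_mem[OF \<eta>] \<xi>(2) by (simp add: G.h_prS_left eq_neg_iff_add_eq_0)
qed

lemma B_op_pointwise:
  assumes \<eta>: "\<eta> \<in> sections M E (orth E h S)" and \<eta>': "\<eta>' \<in> sections M E (orth E h S)"
    and eq: "\<eta> p = \<eta>' p"
  shows "B_op E h S D \<eta> p v = B_op E h S D \<eta>' p v"
proof (rule G.S_eqI)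
  show "B_op E h S D \<eta> p v \<in> S p" "B_op E h S D \<eta>' p v \<in> S p"
    using D_orth_mem \<eta> \<eta>' by (simp_all add: B_op_def)
  fix z assume "z \<in> S p"
  then obtain \<xi> where "\<xi> \<in> sections M E (fib E)" "\<And>q. \<xi> q \<in> S q" "\<xi> p = z"
    using S_section_through by blast
  then show "h p (B_op E h S D \<eta> p v) z = h p (B_op E h S D \<eta>' p v) z"
    using h_B_op[OF \<eta>, of \<xi> p v] h_B_op[OF \<eta>', of \<xi> p v] eq by simp
qed

text \<open>The operator \<open>P\<^sub>S\<^sub>\<bottom> D\<close> transported to the quotient bundle.\<close>

definition quot_connection :: "('m, 'n, 'v set) operator" where
  "quot_connection \<zeta> p v = quot_map E S p (D_orth_op E h S D (\<lambda>q. quot_lift E h S q (\<zeta> q)) p v)"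

text \<open>The projection to \<open>S\<^sup>\<bottom>\<close> may be omitted, since the quotient map annihilates \<open>S\<close>.\<close>

lemma quot_connection_eq:
  assumes \<zeta>: "\<zeta> \<in> sections M Q (fib Q)"
  shows "quot_connection \<zeta> p v = quot_map E S p (D (\<lambda>q. quot_lift E h S q (\<zeta> q)) p v)"
  using D_orth_mem[OF lift_section[OF \<zeta>]] by (simp add: quot_connection_def D_orth_op_def G.q_prO)

text \<open>If \<open>\<zeta>\<close> has coefficients \<open>a\<close> in the frame induced by an adapted frame \<open>e\<close>, its lift differs from
  \<open>\<Sum>\<^sub>i a\<^sub>i e\<^sub>s\<^sub>+\<^sub>i\<close> by a smooth section of \<open>S\<close>. Hence the lift has coefficients \<open>a\<close> at the last members
  of \<open>e\<close>, and the terms of \<open>d''\<close> at the first \<open>s\<close> members vanish in the quotient.\<close>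

lemma quot_connection_dbar:
  assumes \<zeta>: "\<zeta> \<in> sections M Q (fib Q)"
  shows "is_dbar_of M Q \<zeta> (part01 Q (quot_connection \<zeta>))"
proof -
  let ?\<eta> = "\<lambda>q. quot_lift E h S q (\<zeta> q)"
  note \<eta> = lift_section[OF \<zeta>]
  have eta_smooth: "smooth_section_on M E UNIV ?\<eta>" by (rule orth_sectionsD(2)[OF \<eta>])
  have mem: "D ?\<eta> p v \<in> fib E p" for p v by (rule D_orth_mem[OF \<eta>])
  have p01: "part01 Q (quot_connection \<zeta>) p v = quot_map E S p (part01 E (D ?\<eta>) p v)" for p v
    using mem by (simp add: part01_def quot_connection_eq[OF \<zeta>] G.q_add G.q_smult)
  have "part01 Q (quot_connection \<zeta>) p v =
      lincomb (fibre Q p) (n - s) (\<lambda>i. dbar_fun M (a i) p v) (\<lambda>i. quot_map E S p (e (s + i) p))"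
    if ad': "adapted_frame M E S U n s e" and a: "\<forall>i<n - s. smooth_fun_on M U (a i)"
      and \<zeta>_eq: "\<forall>p\<in>U. \<zeta> p = lincomb (fibre Q p) (n - s) (\<lambda>i. a i p) (\<lambda>i. quot_map E S p (e (s + i) p))"
      and p: "p \<in> U" for U n s e a p v
  proof -
    note ad = adapted_frameD[OF ad'] and fr = holo_frameD[OF adapted_frameD(1)[OF ad']]
    define \<sigma> where "\<sigma> = (\<lambda>q. lincomb (fibre E q) (n - s) (\<lambda>i. a i q) (\<lambda>i. e (s + i) q))"
    define \<rho> where "\<rho> = (\<lambda>q. ?\<eta> q \<oplus>\<^bsub>fibre E q\<^esub> (- 1) \<odot>\<^bsub>fibre E q\<^esub> \<sigma> q)"
    have \<sigma>: "smooth_section_on M E U \<sigma>"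
      unfolding \<sigma>_def using a
      by (intro smooth_section_lincomb[OF fr(1)] holo_frame_smooth[OF ad(1)]) auto
    have \<rho>: "smooth_section_on M E U \<rho>"
      unfolding \<rho>_def
      by (intro smooth_section_add smooth_section_smult smooth_fun_on_const fr(1) \<sigma>
          smooth_section_subset[OF eta_smooth] subset_UNIV)
    have rho_S: "\<rho> q \<in> S q" if q: "q \<in> U" for q
    proof -
      have e: "e (s + i) q \<in> fib E q" if "i < n - s" for i using fr(4)[OF q] that by simp
      have \<sigma>q: "\<sigma> q \<in> fib E q" by (rule smooth_section_mem[OF \<sigma> q])
      have "quot_map E S q (\<sigma> q) = \<zeta> q"
        unfolding \<sigma>_def using \<zeta>_eq q e by (simp add: G.q_lincomb)
      then have "proj_orth E h S q (\<sigma> q) = ?\<eta> q" using G.lift_q[OF \<sigma>q] by simp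
      moreover have "proj_orth E h S q (?\<eta> q) = ?\<eta> q" using quot_sections_mem[OF \<zeta>] by (simp add: G.proj_id)
      ultimately have "proj_orth E h S q (\<rho> q) = \<zero>\<^bsub>fibre E q\<^esub>"
        using \<sigma>q quot_sections_mem(3)[OF \<zeta>, of q]
        by (simp add: \<rho>_def G.proj_add G.proj_smult F.add_neg_smult)
      then show ?thesis by (rule G.mem_S_if_prO_zero[OF smooth_section_mem[OF \<rho> q]])
    qed
    obtain b where b: "\<And>i. i < s \<Longrightarrow> smooth_fun_on M (U \<inter> U) (b i)"
      "\<And>q. q \<in> U \<Longrightarrow> q \<in> U \<Longrightarrow>
        gs_proj (fibre E q) (h q) (\<lambda>i. e i q) s (\<rho> q) = lincomb (fibre E q) s (\<lambda>i. b i q) (\<lambda>i. e i q)"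
      using gs_proj_smooth_frame[OF fr(1) holo_frame_smooth[OF ad(1)] fr(3) fr(1) \<rho> ad(2)] by blast
    define d where "d = (\<lambda>i. if i < s then b i else a (i - s))"
    have d: "smooth_fun_on M U (d i)" if "i < n" for i
      using b(1)[of i] a that by (auto simp: d_def)
    have eta_d: "?\<eta> q = lincomb (fibre E q) n (\<lambda>i. d i q) (\<lambda>i. e i q)" if q: "q \<in> U" for q
    proof -
      have e: "e i q \<in> fib E q" if "i < n" for i using fr(4)[OF q that] .
      have "gs_proj (fibre E q) (h q) (\<lambda>i. e i q) s (\<rho> q) = \<rho> q"
        using ad(4)[OF q rho_S[OF q]] F.gs_proj_eq_self[of s "\<lambda>i. e i q" q] e ad(2) by auto
      then have "\<rho> q = lincomb (fibre E q) s (\<lambda>i. b i q) (\<lambda>i. e i q)" using b(2)[OF q q] by simp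
      moreover have "lincomb (fibre E q) n (\<lambda>i. d i q) (\<lambda>i. e i q) =
          lincomb (fibre E q) s (\<lambda>i. d i q) (\<lambda>i. e i q) \<oplus>\<^bsub>fibre E q\<^esub>
          lincomb (fibre E q) (n - s) (\<lambda>i. d (s + i) q) (\<lambda>i. e (s + i) q)"
        using F.lincomb_split[of s "n - s" "\<lambda>i. e i q" q "\<lambda>i. d i q"] e ad(2) by simp
      moreover have "lincomb (fibre E q) s (\<lambda>i. d i q) (\<lambda>i. e i q) = lincomb (fibre E q) s (\<lambda>i. b i q) (\<lambda>i. e i q)"
        by (rule F.lincomb_cong) (use e ad(2) in \<open>auto simp: d_def\<close>)
      ultimately have "lincomb (fibre E q) n (\<lambda>i. d i q) (\<lambda>i. e i q) = \<rho> q \<oplus>\<^bsub>fibre E q\<^esub> \<sigma> q"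
        by (simp add: d_def \<sigma>_def)
      also have "\<dots> = ?\<eta> q"
        by (rule F.vec_eqI)
          (use smooth_section_mem[OF \<sigma> q] quot_sections_mem(3)[OF \<zeta>, of q] in \<open>auto simp: \<rho>_def F.h_left\<close>)
      finally show ?thesis by simp
    qed
    have "part01 E (D ?\<eta>) p v = lincomb (fibre E p) n (\<lambda>i. dbar_fun M (d i) p v) (\<lambda>i. e i p)"
      by (rule dbar_in_holo_frame[OF ad(1) eta_smooth D_dbar[OF orth_sections_fib[OF \<eta>]] d eta_d p])
    then show ?thesis
      using G.q_lincomb_split[of s "\<lambda>i. e i p" p "n - s" "\<lambda>i. dbar_fun M (d i) p v"] ad(2) ad(3)[OF p] fr(4)[OF p]
      by (simp add: p01 d_def)
  qed
  then show ?thesis unfolding is_dbar_of_def frames_quot by clarsimp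
qed

lemma lift_add_fun:
  assumes "\<zeta> \<in> sections M Q (fib Q)" "\<xi> \<in> sections M Q (fib Q)"
  shows "(\<lambda>q. quot_lift E h S q (\<zeta> q \<oplus>\<^bsub>fibre Q q\<^esub> \<xi> q)) =
    (\<lambda>q. quot_lift E h S q (\<zeta> q) \<oplus>\<^bsub>fibre E q\<^esub> quot_lift E h S q (\<xi> q))"
  using quot_sections_mem(1)[OF assms(1)] quot_sections_mem(1)[OF assms(2)] by (simp add: G.lift_add)

lemma lift_smult_fun:
  assumes "\<zeta> \<in> sections M Q (fib Q)"
  shows "(\<lambda>q. quot_lift E h S q (f q \<odot>\<^bsub>fibre Q q\<^esub> \<zeta> q)) =
    (\<lambda>q. f q \<odot>\<^bsub>fibre E q\<^esub> quot_lift E h S q (\<zeta> q))"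
  using quot_sections_mem(1)[OF assms] by (simp add: G.lift_smult)

lemma quot_section_of_lift:
  assumes "\<eta> \<in> sections M E (fib E)" "\<And>p. \<zeta> p = quot_map E S p (\<eta> p)"
  shows "\<zeta> \<in> sections M Q (fib Q)"
proof -
  have "smooth_section_on M E UNIV \<eta>" and mem: "\<And>p. \<eta> p \<in> fib E p"
    using assms(1) by (auto simp: sections_def)
  then have "smooth_section_on M Q UNIV (\<lambda>p. quot_map E S p (\<eta> p))" by (intro quot_section_smooth) auto
  moreover have "\<zeta> = (\<lambda>p. quot_map E S p (\<eta> p))" using assms(2) by auto
  ultimately show ?thesis using mem by (simp add: sections_def)
qed

lemma quot_section_add:
  assumes \<zeta>: "\<zeta> \<in> sections M Q (fib Q)" and \<xi>: "\<xi> \<in> sections M Q (fib Q)"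
  shows "(\<lambda>q. \<zeta> q \<oplus>\<^bsub>fibre Q q\<^esub> \<xi> q) \<in> sections M Q (fib Q)"
proof (rule quot_section_of_lift)
  note s = orth_sections_fib[OF lift_section[OF \<zeta>]] orth_sections_fib[OF lift_section[OF \<xi>]]
  show "(\<lambda>q. quot_lift E h S q (\<zeta> q) \<oplus>\<^bsub>fibre E q\<^esub> quot_lift E h S q (\<xi> q)) \<in> sections M E (fib E)"
    using s by (simp add: sections_iff smooth_section_add)
  show "\<zeta> p \<oplus>\<^bsub>fibre Q p\<^esub> \<xi> p = quot_map E S p (quot_lift E h S p (\<zeta> p) \<oplus>\<^bsub>fibre E p\<^esub> quot_lift E h S p (\<xi> p))" for p
    using quot_sections_mem[OF \<zeta>, of p] quot_sections_mem[OF \<xi>, of p] by (simp add: G.q_add[symmetric] G.q_lift)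
qed

lemma quot_section_smult:
  assumes \<zeta>: "\<zeta> \<in> sections M Q (fib Q)" and f: "smooth_fun_on M UNIV f"
  shows "(\<lambda>q. f q \<odot>\<^bsub>fibre Q q\<^esub> \<zeta> q) \<in> sections M Q (fib Q)"
proof (rule quot_section_of_lift)
  show "(\<lambda>q. f q \<odot>\<^bsub>fibre E q\<^esub> quot_lift E h S q (\<zeta> q)) \<in> sections M E (fib E)"
    using orth_sections_fib[OF lift_section[OF \<zeta>]] f by (simp add: sections_iff smooth_section_smult)
  show "f p \<odot>\<^bsub>fibre Q p\<^esub> \<zeta> p = quot_map E S p (f p \<odot>\<^bsub>fibre E p\<^esub> quot_lift E h S p (\<zeta> p))" for p
    using quot_sections_mem[OF \<zeta>, of p] by (simp add: G.q_smult[symmetric] G.q_lift)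
qed

lemma quot_connection_forms:
  assumes \<zeta>: "\<zeta> \<in> sections M Q (fib Q)"
  shows "quot_connection \<zeta> \<in> forms M Q (fib Q)"
  unfolding forms_def mem_Collect_eq
proof (intro conjI allI ballI)
  note \<eta> = orth_sections_fib[OF lift_section[OF \<zeta>]]
  let ?\<eta> = "\<lambda>q. quot_lift E h S q (\<zeta> q)"
  show "quot_connection \<zeta> p v \<in> fib Q p" for p v
    using D_mem[OF \<eta>] by (simp add: quot_connection_eq[OF \<zeta>])
  have eq: "quot_connection \<zeta> p = (\<lambda>v. quot_map E S p (D ?\<eta> p v))" for p
    by (rule ext) (rule quot_connection_eq[OF \<zeta>])
  show "real_linear_into (fibre Q p) (quot_connection \<zeta> p)" for p
    using D_real_linear[OF \<eta>, of p] D_mem[OF \<eta>]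
    by (simp add: eq real_linear_into_def G.q_add G.q_smult)
  show "smooth_section_on M Q (fst c) (\<lambda>p. quot_connection \<zeta> p (coord_vec M c p v))" if "c \<in> atlas M" for c v
    unfolding quot_connection_eq[OF \<zeta>]
    by (rule quot_section_smooth[OF chart_domain_open[OF that] D_smooth[OF \<eta> that]])
qed

lemma quot_chern_connection: "chern_connection M Q hQ quot_connection"
  unfolding chern_connection_def connection_def
proof (intro conjI ballI allI impI)
  fix \<zeta> assume \<zeta>: "\<zeta> \<in> sections M Q (fib Q)"
  let ?\<eta> = "\<lambda>q. quot_lift E h S q (\<zeta> q)"
  note \<eta> = orth_sections_fib[OF lift_section[OF \<zeta>]]
  show "quot_connection \<zeta> \<in> forms M Q (fib Q)" by (rule quot_connection_forms[OF \<zeta>])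
  show "is_dbar_of M Q \<zeta> (part01 Q (quot_connection \<zeta>))" by (rule quot_connection_dbar[OF \<zeta>])
  show "quot_connection (\<lambda>p. f p \<odot>\<^bsub>fibre Q p\<^esub> \<zeta> p) =
      (\<lambda>p v. dfun M f p v \<odot>\<^bsub>fibre Q p\<^esub> \<zeta> p \<oplus>\<^bsub>fibre Q p\<^esub> f p \<odot>\<^bsub>fibre Q p\<^esub> quot_connection \<zeta> p v)"
    if f: "smooth_fun_on M UNIV f" for f
  proof (intro ext)
    fix p v
    have "quot_connection (\<lambda>p. f p \<odot>\<^bsub>fibre Q p\<^esub> \<zeta> p) p v =
        quot_map E S p (dfun M f p v \<odot>\<^bsub>fibre E p\<^esub> ?\<eta> p \<oplus>\<^bsub>fibre E p\<^esub> f p \<odot>\<^bsub>fibre E p\<^esub> D ?\<eta> p v)"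
      using D_smult[OF \<eta> f] by (simp add: quot_connection_eq[OF quot_section_smult[OF \<zeta> f]] lift_smult_fun[OF \<zeta>])
    also have "\<dots> = dfun M f p v \<odot>\<^bsub>fibre Q p\<^esub> \<zeta> p \<oplus>\<^bsub>fibre Q p\<^esub> f p \<odot>\<^bsub>fibre Q p\<^esub> quot_connection \<zeta> p v"
      using quot_sections_mem[OF \<zeta>, of p] D_mem[OF \<eta>, of p v]
      by (simp add: quot_connection_eq[OF \<zeta>] G.q_add[symmetric] G.q_smult[symmetric] G.q_lift)
    finally show "quot_connection (\<lambda>p. f p \<odot>\<^bsub>fibre Q p\<^esub> \<zeta> p) p v =
      dfun M f p v \<odot>\<^bsub>fibre Q p\<^esub> \<zeta> p \<oplus>\<^bsub>fibre Q p\<^esub> f p \<odot>\<^bsub>fibre Q p\<^esub> quot_connection \<zeta> p v" .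
  qed
  fix \<xi> assume \<xi>: "\<xi> \<in> sections M Q (fib Q)"
  let ?\<theta> = "\<lambda>q. quot_lift E h S q (\<xi> q)"
  note \<theta> = orth_sections_fib[OF lift_section[OF \<xi>]]
  show "quot_connection (\<lambda>p. \<zeta> p \<oplus>\<^bsub>fibre Q p\<^esub> \<xi> p) =
      (\<lambda>p v. quot_connection \<zeta> p v \<oplus>\<^bsub>fibre Q p\<^esub> quot_connection \<xi> p v)"
  proof (intro ext)
    fix p v
    show "quot_connection (\<lambda>p. \<zeta> p \<oplus>\<^bsub>fibre Q p\<^esub> \<xi> p) p v =
      quot_connection \<zeta> p v \<oplus>\<^bsub>fibre Q p\<^esub> quot_connection \<xi> p v"
      using D_mem[OF \<eta>, of p v] D_mem[OF \<theta>, of p v] D_add[OF \<eta> \<theta>]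
      by (simp add: quot_connection_eq[OF quot_section_add[OF \<zeta> \<xi>]] lift_add_fun[OF \<zeta> \<xi>]
          quot_connection_eq[OF \<zeta>] quot_connection_eq[OF \<xi>] G.q_add)
  qed
  fix p v
  have "hQ p (quot_connection \<zeta> p v) (\<xi> p) = h p (D ?\<eta> p v) (?\<theta> p)"
    using hQ_quot[OF D_mem[OF \<eta>] quot_sections_mem(2)[OF \<xi>], of p v] quot_sections_mem(1)[OF \<xi>, of p]
    by (simp add: quot_connection_eq[OF \<zeta>] G.q_lift)
  moreover have "hQ p (\<zeta> p) (quot_connection \<xi> p v) = h p (?\<eta> p) (D ?\<theta> p v)"
  proof -
    have m: "D ?\<theta> p v \<in> fib E p" "?\<eta> p \<in> orth E h S p" "\<zeta> p \<in> fib Q p"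
      using D_mem[OF \<theta>] quot_sections_mem[OF \<zeta>] by blast+
    then show ?thesis by (simp add: quot_connection_eq[OF \<xi>] quot_metric_def G.lift_q G.h_prO_right)
  qed
  ultimately show "dfun M (\<lambda>q. hQ q (\<zeta> q) (\<xi> q)) p v =
      hQ p (quot_connection \<zeta> p v) (\<xi> p) + hQ p (\<zeta> p) (quot_connection \<xi> p v)"
    using D_metric[OF \<eta> \<theta>, of p v] by (simp add: quot_metric_def)
qed

lemma quot_chern_connection_unique:
  assumes "chern_connection M Q hQ D'" "\<zeta> \<in> sections M Q (fib Q)"
  shows "D' \<zeta> = quot_connection \<zeta>"
  using chern_connection_unique[OF quot_fibre_hermitian_space quot_frames_cover quot_section_through
      assms(1) quot_chern_connection assms(2)] .

end


section \<open>Higgs fields\<close>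

locale higgs_subbundle_setting = chern_subbundle M E h S D
  for M :: "('m::t2_space, 'n::finite) cmanifold" and E :: "('m, 'v) vbundle" and h S D +
  fixes \<Phi> :: "('m, 'n, 'v) hom_form"
  assumes higgs: "higgs_field M E \<Phi>"
    and invariant: "x \<in> S p \<Longrightarrow> \<Phi> p v x \<in> S p"
begin

abbreviation "adj \<equiv> higgs_adj E h \<Phi>"

lemma higgs_linear: "linear_between (fibre E p) (fib E p) (fib E p) (\<Phi> p v)"
  and higgs_real_linear: "x \<in> fib E p \<Longrightarrow> real_linear_into (fibre E p) (\<lambda>v. \<Phi> p v x)"
proof -
  have "\<Phi> \<in> hom_forms M E (fib E) (fib E)" using higgs unfolding higgs_field_def by (elim conjE)
  then show "linear_between (fibre E p) (fib E p) (fib E p) (\<Phi> p v)"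
    "x \<in> fib E p \<Longrightarrow> real_linear_into (fibre E p) (\<lambda>v. \<Phi> p v x)"
    unfolding hom_forms_def by blast+
qed

lemma higgs_mem [simp]: "x \<in> fib E p \<Longrightarrow> \<Phi> p v x \<in> fib E p"
  and higgs_add: "x \<in> fib E p \<Longrightarrow> y \<in> fib E p \<Longrightarrow> \<Phi> p v (x \<oplus>\<^bsub>fibre E p\<^esub> y) = \<Phi> p v x \<oplus>\<^bsub>fibre E p\<^esub> \<Phi> p v y"
  and higgs_smult: "x \<in> fib E p \<Longrightarrow> \<Phi> p v (a \<odot>\<^bsub>fibre E p\<^esub> x) = a \<odot>\<^bsub>fibre E p\<^esub> \<Phi> p v x"
  using higgs_linear[of p v] unfolding linear_between_def by blast+

lemma higgs_smooth:
  assumes c: "c \<in> atlas M" and W: "open W" and \<sigma>: "smooth_section_on M E W \<sigma>"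
  shows "smooth_section_on M E (fst c \<inter> W) (\<lambda>p. \<Phi> p (coord_vec M c p v) (\<sigma> p))"
proof (rule smooth_section_local)
  show "open (fst c \<inter> W)" using chart_domain_open[OF c] W by blast
  fix p assume p: "p \<in> fst c \<inter> W"
  obtain U n e where U: "(U, n, e) \<in> frames E" "p \<in> U" using frames_cover by blast
  note fr = holo_frameD[OF frames_holo_frame[OF U(1)]]
  obtain a where a: "\<And>i. i < n \<Longrightarrow> smooth_fun_on M (U \<inter> W) (a i)"
    "\<And>q. q \<in> U \<Longrightarrow> q \<in> W \<Longrightarrow> \<sigma> q = lincomb (fibre E q) n (\<lambda>i. a i q) (\<lambda>i. e i q)"
    using smooth_section_frame_coeffs[OF \<sigma> U(1)] by blast
  define N where "N = fst c \<inter> U \<inter> W"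
  have N: "open N" "p \<in> N" "N \<subseteq> U \<inter> W" "N \<subseteq> fst c \<inter> U"
    using chart_domain_open[OF c] W fr(1) p U(2) by (auto simp: N_def)
  have "\<forall>c\<in>atlas M. \<forall>v. \<forall>(U, n, e)\<in>frames E. \<forall>j<n.
      holo_section_on M E (fst c \<inter> U) (\<lambda>p. \<Phi> p (coord_vec M c p v) (e j p))"
    using higgs unfolding higgs_field_def by (elim conjE)
  from bspec[OF spec[OF bspec[OF this c]] U(1)]
  have "\<And>j. j < n \<Longrightarrow> holo_section_on M E (fst c \<inter> U) (\<lambda>p. \<Phi> p (coord_vec M c p v) (e j p))" by simp
  then have \<Phi>e: "smooth_section_on M E N (\<lambda>p. \<Phi> p (coord_vec M c p v) (e j p))" if "j < n" for j
    using smooth_section_subset[OF holo_section_imp_smooth N(4)] that by blast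
  have "smooth_section_on M E N (\<lambda>q. lincomb (fibre E q) n (\<lambda>i. a i q) (\<lambda>i. \<Phi> q (coord_vec M c q v) (e i q)))"
    using smooth_section_lincomb[OF N(1), where e = "\<lambda>i q. \<Phi> q (coord_vec M c q v) (e i q)"]
      smooth_fun_on_subset[OF a(1) N(3)] \<Phi>e by blast
  then have "smooth_section_on M E N (\<lambda>p. \<Phi> p (coord_vec M c p v) (\<sigma> p))"
  proof (rule smooth_section_cong)
    fix q assume "q \<in> N"
    then have q: "q \<in> U" "q \<in> W" by (auto simp: N_def)
    show "lincomb (fibre E q) n (\<lambda>i. a i q) (\<lambda>i. \<Phi> q (coord_vec M c q v) (e i q)) = \<Phi> q (coord_vec M c q v) (\<sigma> q)"
      unfolding a(2)[OF q] by (rule F.linear_between_lincomb[OF higgs_linear fr(4)[OF q(1)], symmetric])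
  qed
  with N(1,2) show "\<exists>N. open N \<and> p \<in> N \<and> smooth_section_on M E N (\<lambda>p. \<Phi> p (coord_vec M c p v) (\<sigma> p))"
    by blast
qed

lemma adj_spec:
  assumes "x \<in> fib E p"
  shows "adj p v x \<in> fib E p" "z \<in> fib E p \<Longrightarrow> h p (adj p v x) z = h p x (\<Phi> p v z)"
proof -
  obtain U n e where U: "(U, n, e) \<in> frames E" "p \<in> U" using frames_cover by blast
  obtain y where y: "y \<in> fib E p" "\<forall>z\<in>fib E p. h p y z = h p x (\<Phi> p v z)"
    using F.adjoint_exists[OF holo_frameD(3)[OF frames_holo_frame[OF U(1)] U(2)] higgs_linear assms] by blast
  have "y' = y" if "y' \<in> fib E p" "\<forall>z\<in>fib E p. h p y' z = h p x (\<Phi> p v z)" for y'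
    using that y by (intro F.vec_eqI) auto
  then have "adj p v x = y"
    unfolding higgs_adj_def using y by (intro the_equality) blast+
  then show "adj p v x \<in> fib E p" "z \<in> fib E p \<Longrightarrow> h p (adj p v x) z = h p x (\<Phi> p v z)"
    using y by auto
qed

lemma hs_decomp:
  assumes \<eta>: "\<eta> \<in> sections M E (orth E h S)"
  shows "hs_operator E \<Phi> h D \<eta> p v =
    hs_B_op E \<Phi> h S D \<eta> p v \<oplus>\<^bsub>fibre E p\<^esub> hs_orth_op E \<Phi> h S D \<eta> p v"
proof -
  have \<eta>p: "\<eta> p \<in> fib E p" and Dp: "D \<eta> p v \<in> fib E p"
    using orth_sectionsD(1)[OF \<eta>] D_orth_mem[OF \<eta>] by auto
  have B: "B_op E h S D \<eta> p v \<in> fib E p" "D_orth_op E h S D \<eta> p v \<in> fib E p"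
    using Dp by (simp_all add: B_op_def D_orth_op_def)
  have P: "proj_S E h S p (\<Phi> p v (\<eta> p)) \<in> fib E p" "proj_orth E h S p (\<Phi> p v (\<eta> p)) \<in> fib E p"
    using \<eta>p by simp_all
  have "hs_operator E \<Phi> h D \<eta> p v =
      (B_op E h S D \<eta> p v \<oplus>\<^bsub>fibre E p\<^esub> D_orth_op E h S D \<eta> p v) \<oplus>\<^bsub>fibre E p\<^esub>
      (proj_S E h S p (\<Phi> p v (\<eta> p)) \<oplus>\<^bsub>fibre E p\<^esub> proj_orth E h S p (\<Phi> p v (\<eta> p))) \<oplus>\<^bsub>fibre E p\<^esub> adj p v (\<eta> p)"
    using G.decomp(3)[OF higgs_mem[OF \<eta>p]] D_decomp[OF \<eta>] by (simp add: hs_operator_def)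
  also have "\<dots> = hs_B_op E \<Phi> h S D \<eta> p v \<oplus>\<^bsub>fibre E p\<^esub> hs_orth_op E \<Phi> h S D \<eta> p v"
    unfolding hs_B_op_def hs_orth_op_def
    by (rule F.vec_eqI) (use B P adj_spec(1)[OF \<eta>p] in \<open>auto simp: F.h_left\<close>)
  finally show ?thesis .
qed


subsection \<open>The Hitchin-Simpson connection of the quotient\<close>

text \<open>The cosets united in \<open>quot_higgs\<close> coincide because \<open>\<Phi>\<close> maps \<open>S\<close> to itself.\<close>

lemma quot_higgs_eq:
  assumes "x \<in> fib E p"
  shows "quot_higgs E \<Phi> S p v (quot_map E S p x) = quot_map E S p (\<Phi> p v x)"
  unfolding quot_higgs_def
proof (rule G.q_Union[OF assms])
  fix y assume y: "y \<in> fib E p" "quot_map E S p y = quot_map E S p x"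
  then have eq: "proj_orth E h S p y = proj_orth E h S p x" using assms by (simp add: G.q_eq_iff)
  have "proj_orth E h S p (\<Phi> p v z) = proj_orth E h S p (\<Phi> p v (proj_orth E h S p z))" if z: "z \<in> fib E p" for z
  proof -
    have "\<Phi> p v z = \<Phi> p v (proj_S E h S p z) \<oplus>\<^bsub>fibre E p\<^esub> \<Phi> p v (proj_orth E h S p z)"
      using G.decomp[OF z] higgs_add[of "proj_S E h S p z" p "proj_orth E h S p z" v] by simp
    then show ?thesis
      using z G.proj_add(2)[of "\<Phi> p v (proj_S E h S p z)" p "\<Phi> p v (proj_orth E h S p z)"]
        G.proj_id(2)[OF invariant[of "proj_S E h S p z" p v]] by simp
  qed
  then have "proj_orth E h S p (\<Phi> p v y) = proj_orth E h S p (\<Phi> p v x)" using y(1) assms eq by metis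
  then show "quot_map E S p (\<Phi> p v y) = quot_map E S p (\<Phi> p v x)" using y(1) assms by (simp add: G.q_eq_iff)
qed

text \<open>The adjoint of \<open>\<Phi>\<close> preserves \<open>S\<^sup>\<bottom>\<close>, and there it is adjoint to \<open>P\<^sub>S\<^sub>\<bottom> \<Phi>\<close>, which represents
  the Higgs field of the quotient.\<close>

lemma quot_higgs_adj:
  assumes x: "x \<in> orth E h S p"
  shows "higgs_adj Q hQ (quot_higgs E \<Phi> S) p v (quot_map E S p x) = quot_map E S p (adj p v x)"
proof -
  let ?Y = "quot_map E S p (adj p v x)"
  have x': "x \<in> fib E p" using x by simp
  have Y: "?Y \<in> fib Q p" using adj_spec(1)[OF x'] by simp
  have hY: "hQ p ?Y Z = hQ p (quot_map E S p x) (quot_higgs E \<Phi> S p v Z)" if "Z \<in> fib Q p" for Z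
  proof -
    define z where "z = quot_lift E h S p Z"
    have z: "z \<in> orth E h S p" "Z = quot_map E S p z" using that G.q_lift[OF that] by (simp_all add: z_def)
    have "hQ p ?Y Z = h p (adj p v x) z"
      unfolding z(2) by (rule hQ_quot[OF adj_spec(1)[OF x'] z(1)])
    also have "\<dots> = h p x (\<Phi> p v z)" using adj_spec(2)[OF x'] z(1) by simp
    also have "\<dots> = hQ p (quot_map E S p x) (quot_map E S p (\<Phi> p v z))"
      using x z(1) by (simp add: quot_metric_def G.lift_q G.proj_id G.h_prO_right)
    finally show ?thesis using z by (simp add: quot_higgs_eq)
  qed
  show ?thesis
    unfolding higgs_adj_def[of Q]
  proof (rule the_equality)
    fix Y' assume Y': "Y' \<in> fib Q p \<and>
      (\<forall>z\<in>fib Q p. hQ p Y' z = hQ p (quot_map E S p x) (quot_higgs E \<Phi> S p v z))"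
    then show "Y' = ?Y" using Y hY by (intro FQ.vec_eqI) auto
  qed (use Y hY in blast)
qed

lemma hs_quot_op_eq:
  assumes \<zeta>: "\<zeta> \<in> sections M Q (fib Q)"
  shows "hs_quot_op E \<Phi> h S D \<zeta> = hs_operator Q (quot_higgs E \<Phi> S) hQ quot_connection \<zeta>"
proof (intro ext)
  fix p v
  let ?\<eta> = "\<lambda>q. quot_lift E h S q (\<zeta> q)"
  let ?x = "?\<eta> p"
  have x: "?x \<in> orth E h S p" "?x \<in> fib E p" "\<zeta> p = quot_map E S p ?x"
    using quot_sections_mem[OF \<zeta>] G.q_lift by auto
  have Dx: "D_orth_op E h S D ?\<eta> p v \<in> fib E p"
    using D_orth_mem[OF lift_section[OF \<zeta>], of p v] by (simp add: D_orth_op_def)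
  have "hs_quot_op E \<Phi> h S D \<zeta> p v = quot_map E S p (D_orth_op E h S D ?\<eta> p v) \<oplus>\<^bsub>fibre Q p\<^esub>
      quot_map E S p (\<Phi> p v ?x) \<oplus>\<^bsub>fibre Q p\<^esub> quot_map E S p (adj p v ?x)"
    using x(2) Dx adj_spec(1)[OF x(2)]
    by (simp add: hs_quot_op_def hs_orth_op_def G.q_add[symmetric] G.q_prO)
  also have "\<dots> = hs_operator Q (quot_higgs E \<Phi> S) hQ quot_connection \<zeta> p v"
    using quot_higgs_eq[OF x(2)] quot_higgs_adj[OF x(1)]
    by (simp add: hs_operator_def quot_connection_def x(3)[symmetric])
  finally show "hs_quot_op E \<Phi> h S D \<zeta> p v = hs_operator Q (quot_higgs E \<Phi> S) hQ quot_connection \<zeta> p v" .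
qed

lemma hs_quot_op_hitchin_simpson:
  "hitchin_simpson_connection M Q (quot_higgs E \<Phi> S) hQ (hs_quot_op E \<Phi> h S D)"
  unfolding hitchin_simpson_connection_def using quot_chern_connection hs_quot_op_eq by blast

lemma hs_quot_op_unique:
  assumes "hitchin_simpson_connection M Q (quot_higgs E \<Phi> S) hQ \<D>" "\<zeta> \<in> sections M Q (fib Q)"
  shows "hs_quot_op E \<Phi> h S D \<zeta> = \<D> \<zeta>"
proof -
  obtain D' where "chern_connection M Q hQ D'" "\<D> \<zeta> = hs_operator Q (quot_higgs E \<Phi> S) hQ D' \<zeta>"
    using assms unfolding hitchin_simpson_connection_def by blast
  then show ?thesis
    using quot_chern_connection_unique[OF _ assms(2), of D'] hs_quot_op_eq[OF assms(2)]
    by (auto simp: hs_operator_def[abs_def])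
qed


subsection \<open>The second fundamental form\<close>

text \<open>The \<open>Hom(S\<^sup>\<bottom>, S)\<close>-valued form representing \<open>\<B>\<^sub>h\<close>. A vector of \<open>S\<^sup>\<bottom>\<close> is extended to an arbitrary global section in order to apply the
  operator \<open>\<B>\<^sub>h\<close>; by pointwise dependence, the choice is irrelevant.\<close>

definition second_fundamental_form :: "('m, 'n, 'v) hom_form" where
  "second_fundamental_form p v x =
     B_op E h S D (SOME \<eta>. \<eta> \<in> sections M E (orth E h S) \<and> \<eta> p = x) p v \<oplus>\<^bsub>fibre E p\<^esub>
       proj_S E h S p (\<Phi> p v x)"

lemma hs_B_op_eq:
  assumes \<eta>: "\<eta> \<in> sections M E (orth E h S)"
  shows "hs_B_op E \<Phi> h S D \<eta> p v = second_fundamental_form p v (\<eta> p)"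
proof -
  let ?\<theta> = "SOME \<theta>. \<theta> \<in> sections M E (orth E h S) \<and> \<theta> p = \<eta> p"
  have "?\<theta> \<in> sections M E (orth E h S) \<and> ?\<theta> p = \<eta> p"
    using someI[of "\<lambda>\<theta>. \<theta> \<in> sections M E (orth E h S) \<and> \<theta> p = \<eta> p" \<eta>] \<eta> by blast
  then have "B_op E h S D ?\<theta> p v = B_op E h S D \<eta> p v" using B_op_pointwise[OF _ \<eta>] by blast
  then show ?thesis by (simp add: hs_B_op_def second_fundamental_form_def)
qed

lemma hs_B_op_mem: "\<eta> \<in> sections M E (orth E h S) \<Longrightarrow> hs_B_op E \<Phi> h S D \<eta> p v \<in> S p"
  using D_orth_mem orth_sectionsD(1) by (simp add: hs_B_op_def B_op_def)

lemma second_fundamental_form_linear: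
  "linear_between (fibre E p) (orth E h S p) (S p) (second_fundamental_form p v)"
  unfolding linear_between_def
proof (intro conjI ballI allI)
  fix x assume x: "x \<in> orth E h S p"
  obtain \<eta> where \<eta>: "\<eta> \<in> sections M E (orth E h S)" "\<eta> p = x" using orth_section_through[OF x] .
  note \<eta>' = orth_sections_fib[OF \<eta>(1)]
  have D\<eta>: "D \<eta> p v \<in> fib E p" by (rule D_orth_mem[OF \<eta>(1)])
  show "second_fundamental_form p v x \<in> S p"
    using hs_B_op_mem[OF \<eta>(1), of p v] hs_B_op_eq[OF \<eta>(1), of p v] \<eta>(2) by simp
  {
    fix a :: complex
    have s: "(\<lambda>q. a \<odot>\<^bsub>fibre E q\<^esub> \<eta> q) \<in> sections M E (orth E h S)"
      using orth_sectionsD[OF \<eta>(1)] smooth_section_smult[of UNIV "\<lambda>_. a" \<eta>] by (simp add: sections_def)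
    have "hs_B_op E \<Phi> h S D (\<lambda>q. a \<odot>\<^bsub>fibre E q\<^esub> \<eta> q) p v = a \<odot>\<^bsub>fibre E p\<^esub> hs_B_op E \<Phi> h S D \<eta> p v"
      using D_smult[OF \<eta>', of "\<lambda>_. a"] D\<eta> x \<eta>(2)
      by (simp add: hs_B_op_def B_op_def G.proj_add G.proj_smult G.proj_id higgs_smult F.smult_add_right)
    then show "second_fundamental_form p v (a \<odot>\<^bsub>fibre E p\<^esub> x) = a \<odot>\<^bsub>fibre E p\<^esub> second_fundamental_form p v x"
      using hs_B_op_eq[OF s, of p v] hs_B_op_eq[OF \<eta>(1), of p v] \<eta>(2) by simp
  }
  fix y assume y: "y \<in> orth E h S p"
  obtain \<theta> where \<theta>: "\<theta> \<in> sections M E (orth E h S)" "\<theta> p = y" using orth_section_through[OF y] .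
  have D\<theta>: "D \<theta> p v \<in> fib E p" by (rule D_orth_mem[OF \<theta>(1)])
  have s: "(\<lambda>q. \<eta> q \<oplus>\<^bsub>fibre E q\<^esub> \<theta> q) \<in> sections M E (orth E h S)"
    using orth_sectionsD[OF \<eta>(1)] orth_sectionsD[OF \<theta>(1)] by (simp add: sections_def smooth_section_add)
  have "B_op E h S D (\<lambda>q. \<eta> q \<oplus>\<^bsub>fibre E q\<^esub> \<theta> q) p v = B_op E h S D \<eta> p v \<oplus>\<^bsub>fibre E p\<^esub> B_op E h S D \<theta> p v"
    using D_add[OF \<eta>' orth_sections_fib[OF \<theta>(1)]] D\<eta> D\<theta> by (simp add: B_op_def G.proj_add)
  moreover have "proj_S E h S p (\<Phi> p v (x \<oplus>\<^bsub>fibre E p\<^esub> y)) =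
      proj_S E h S p (\<Phi> p v x) \<oplus>\<^bsub>fibre E p\<^esub> proj_S E h S p (\<Phi> p v y)"
    using x y by (simp add: higgs_add G.proj_add)
  moreover have "B_op E h S D \<eta> p v \<in> fib E p" "B_op E h S D \<theta> p v \<in> fib E p"
    "proj_S E h S p (\<Phi> p v x) \<in> fib E p" "proj_S E h S p (\<Phi> p v y) \<in> fib E p"
    using D\<eta> D\<theta> x y by (simp_all add: B_op_def)
  ultimately have "hs_B_op E \<Phi> h S D (\<lambda>q. \<eta> q \<oplus>\<^bsub>fibre E q\<^esub> \<theta> q) p v =
      hs_B_op E \<Phi> h S D \<eta> p v \<oplus>\<^bsub>fibre E p\<^esub> hs_B_op E \<Phi> h S D \<theta> p v"
    using \<eta>(2) \<theta>(2) by (intro F.vec_eqI) (auto simp: hs_B_op_def F.h_left)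
  then show "second_fundamental_form p v (x \<oplus>\<^bsub>fibre E p\<^esub> y) =
      second_fundamental_form p v x \<oplus>\<^bsub>fibre E p\<^esub> second_fundamental_form p v y"
    using hs_B_op_eq[OF s, of p v] hs_B_op_eq[OF \<eta>(1), of p v] hs_B_op_eq[OF \<theta>(1), of p v] \<eta>(2) \<theta>(2) by simp
qed

lemma second_fundamental_form_real_linear:
  assumes x: "x \<in> orth E h S p"
  shows "real_linear_into (fibre E p) (\<lambda>v. second_fundamental_form p v x)"
proof -
  obtain \<eta> where \<eta>: "\<eta> \<in> sections M E (orth E h S)" "\<eta> p = x" using orth_section_through[OF x] .
  have eq: "second_fundamental_form p v x = proj_S E h S p (D \<eta> p v \<oplus>\<^bsub>fibre E p\<^esub> \<Phi> p v x)" for v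
    using hs_B_op_eq[OF \<eta>(1), of p v] \<eta>(2) x D_orth_mem[OF \<eta>(1), of p v]
    by (simp add: hs_B_op_def B_op_def G.proj_add)
  have mem: "D \<eta> p v \<in> fib E p" "\<Phi> p v x \<in> fib E p" for v using D_orth_mem[OF \<eta>(1)] x by simp_all
  have D: "D \<eta> p (u + v) = D \<eta> p u \<oplus>\<^bsub>fibre E p\<^esub> D \<eta> p v" "D \<eta> p (r *\<^sub>R v) = complex_of_real r \<odot>\<^bsub>fibre E p\<^esub> D \<eta> p v"
    and P: "\<Phi> p (u + v) x = \<Phi> p u x \<oplus>\<^bsub>fibre E p\<^esub> \<Phi> p v x" "\<Phi> p (r *\<^sub>R v) x = complex_of_real r \<odot>\<^bsub>fibre E p\<^esub> \<Phi> p v x"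
    for u v r
    using D_real_linear[OF orth_sections_fib[OF \<eta>(1)], of p] higgs_real_linear[OF orth_fib[OF x]]
    by (simp_all add: real_linear_into_def)
  have "D \<eta> p (u + v) \<oplus>\<^bsub>fibre E p\<^esub> \<Phi> p (u + v) x =
      (D \<eta> p u \<oplus>\<^bsub>fibre E p\<^esub> \<Phi> p u x) \<oplus>\<^bsub>fibre E p\<^esub> (D \<eta> p v \<oplus>\<^bsub>fibre E p\<^esub> \<Phi> p v x)" for u v
    by (rule F.vec_eqI) (use mem in \<open>auto simp: D P F.h_left\<close>)
  moreover have "D \<eta> p (r *\<^sub>R v) \<oplus>\<^bsub>fibre E p\<^esub> \<Phi> p (r *\<^sub>R v) x =
      complex_of_real r \<odot>\<^bsub>fibre E p\<^esub> (D \<eta> p v \<oplus>\<^bsub>fibre E p\<^esub> \<Phi> p v x)" for r v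
    using mem by (simp add: D P F.smult_add_right)
  ultimately show ?thesis
    unfolding real_linear_into_def eq using mem by (simp add: G.proj_add(1) G.proj_smult(1))
qed

lemma second_fundamental_form_smooth:
  assumes c: "c \<in> atlas M" and e: "smooth_frame M E (orth E h S) U n e" and j: "j < n"
  shows "smooth_section_on M E (fst c \<inter> U) (\<lambda>p. second_fundamental_form p (coord_vec M c p v) (e j p))"
proof (rule smooth_section_local)
  have U: "open U" and ej: "smooth_section_on M E U (e j)" and ej_orth: "\<And>q. q \<in> U \<Longrightarrow> e j q \<in> orth E h S q"
    using e j by (auto simp: smooth_frame_def is_basis_def)
  show "open (fst c \<inter> U)" using chart_domain_open[OF c] U by blast
  fix p assume p: "p \<in> fst c \<inter> U"
  \<comment> \<open>Near \<open>p\<close> the local section \<open>e j\<close> agrees with a global one, to which \<open>D\<close> can be applied.\<close>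
  obtain \<tau> N where \<tau>: "smooth_section_on M E UNIV \<tau>" "open N" "p \<in> N" "N \<subseteq> U" "\<And>q. q \<in> N \<Longrightarrow> \<tau> q = e j q"
    "\<And>q. \<tau> q = \<zero>\<^bsub>fibre E q\<^esub> \<or> q \<in> U \<and> (\<exists>a. \<tau> q = a \<odot>\<^bsub>fibre E q\<^esub> e j q)"
    using extend_section[OF U _ ej, of p] p by blast
  have "\<tau> q \<in> orth E h S q" for q using \<tau>(6)[of q] ej_orth[of q] by auto
  with \<tau>(1) have \<tau>s: "\<tau> \<in> sections M E (orth E h S)" by (simp add: sections_def)
  have cN: "open (fst c \<inter> N)" using chart_domain_open[OF c] \<tau>(2) by blast
  have "smooth_section_on M E (fst c \<inter> N) (\<lambda>q. proj_S E h S q (D \<tau> q (coord_vec M c q v)))"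
    using smooth_section_subset[OF D_smooth[OF orth_sections_fib[OF \<tau>s] c]] by (intro proj_S_smooth cN) blast
  moreover have "smooth_section_on M E (fst c \<inter> N) (\<lambda>q. proj_S E h S q (\<Phi> q (coord_vec M c q v) (\<tau> q)))"
    by (intro proj_S_smooth cN higgs_smooth c \<tau>(2) smooth_section_subset[OF \<tau>(1)] subset_UNIV)
  ultimately have "smooth_section_on M E (fst c \<inter> N) (\<lambda>q. hs_B_op E \<Phi> h S D \<tau> q (coord_vec M c q v))"
    unfolding hs_B_op_def B_op_def by (rule smooth_section_add[OF cN])
  then have "smooth_section_on M E (fst c \<inter> N) (\<lambda>q. second_fundamental_form q (coord_vec M c q v) (e j q))"
    by (rule smooth_section_cong) (simp add: hs_B_op_eq[OF \<tau>s] \<tau>(5))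
  with cN p \<tau>(3) show "\<exists>N. open N \<and> p \<in> N \<and>
      smooth_section_on M E N (\<lambda>p. second_fundamental_form p (coord_vec M c p v) (e j p))" by blast
qed

lemma second_fundamental_form_hom_forms: "second_fundamental_form \<in> hom_forms M E (orth E h S) S"
  unfolding hom_forms_def
  using second_fundamental_form_linear second_fundamental_form_real_linear second_fundamental_form_smooth
  by blast

end

theorem proposition6:
  fixes M :: "('m::{t2_space,second_countable_topology}, 'n::finite) cmanifold"
    and E :: "('m, 'v) vbundle"
    and \<Phi> :: "('m, 'n, 'v) hom_form"
    and h :: "'m \<Rightarrow> 'v \<Rightarrow> 'v \<Rightarrow> complex"
    and D :: "('m, 'n, 'v) operator"
    and S :: "'m \<Rightarrow> 'v set"
  assumes "compact_kaehler_manifold M"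
    and "hermitian_higgs_bundle M E \<Phi> h"
    and "chern_connection M E h D"
    and "higgs_subbundle M E \<Phi> S"
  shows
    "(\<forall>\<eta>\<in>sections M E (orth E h S).
        B_op E h S D \<eta> \<in> forms M E S \<and>
        D_orth_op E h S D \<eta> \<in> forms M E (orth E h S) \<and>
        D \<eta> = (\<lambda>p v. B_op E h S D \<eta> p v \<oplus>\<^bsub>fibre E p\<^esub> D_orth_op E h S D \<eta> p v) \<and>
        hs_operator E \<Phi> h D \<eta> =
          (\<lambda>p v. hs_B_op E \<Phi> h S D \<eta> p v \<oplus>\<^bsub>fibre E p\<^esub> hs_orth_op E \<Phi> h S D \<eta> p v)) \<and>
     hitchin_simpson_connection M (quot_bundle M E S) (quot_higgs E \<Phi> S) (quot_metric E h S)
       (hs_quot_op E \<Phi> h S D) \<and>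
     (\<forall>\<D>. hitchin_simpson_connection M (quot_bundle M E S) (quot_higgs E \<Phi> S) (quot_metric E h S) \<D> \<longrightarrow>
        (\<forall>\<zeta>\<in>sections M (quot_bundle M E S) (fib (quot_bundle M E S)).
           hs_quot_op E \<Phi> h S D \<zeta> = \<D> \<zeta>)) \<and>
     (\<exists>\<beta>\<in>hom_forms M E (orth E h S) S. \<forall>\<eta>\<in>sections M E (orth E h S).
        hs_B_op E \<Phi> h S D \<eta> = (\<lambda>p v. \<beta> p v (\<eta> p)))"
proof -
  interpret higgs_subbundle_setting M E h S D \<Phi>
    by unfold_locales
      (use assms in \<open>auto simp: compact_kaehler_manifold_def hermitian_higgs_bundle_def higgs_subbundle_def\<close>)
  show ?thesis
  proof (intro conjI ballI allI impI)
    fix \<eta> assume \<eta>: "\<eta> \<in> sections M E (orth E h S)"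
    show "B_op E h S D \<eta> \<in> forms M E S" by (rule B_op_forms[OF \<eta>])
    show "D_orth_op E h S D \<eta> \<in> forms M E (orth E h S)" by (rule D_orth_op_forms[OF \<eta>])
    show "D \<eta> = (\<lambda>p v. B_op E h S D \<eta> p v \<oplus>\<^bsub>fibre E p\<^esub> D_orth_op E h S D \<eta> p v)"
      by (intro ext D_decomp[OF \<eta>])
    show "hs_operator E \<Phi> h D \<eta> =
        (\<lambda>p v. hs_B_op E \<Phi> h S D \<eta> p v \<oplus>\<^bsub>fibre E p\<^esub> hs_orth_op E \<Phi> h S D \<eta> p v)"
      by (intro ext hs_decomp[OF \<eta>])
  next
    show "\<exists>\<beta>\<in>hom_forms M E (orth E h S) S. \<forall>\<eta>\<in>sections M E (orth E h S).
        hs_B_op E \<Phi> h S D \<eta> = (\<lambda>p v. \<beta> p v (\<eta> p))"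
      by (rule bexI[OF _ second_fundamental_form_hom_forms]) (intro ballI ext hs_B_op_eq)
  qed (rule hs_quot_op_hitchin_simpson hs_quot_op_unique; assumption)+
qed

end
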